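(* Let $\sigma$ be a finite nonnegative measure with infinite support on $[-1,1]$, let $s_{-1}\in\mathbb R$, and let $$\mathfrak F(\lambda)=\frac1\lambda\int_{-1}^1\frac{d\sigma(t)}{t-\lambda}-\frac{s_{-1}}{\lambda}\in\mathbf D^+_{-\infty},\qquad F(\lambda)=\int_{-1}^1\frac{d\sigma(t)}{t-\lambda}.$$ Let $\{\mathfrak n_j\}_{j\ge1}$ be the normal indices of the coefficient sequence $\mathfrak s_0=s_{-1}$, $\mathfrak s_{j}=\int t^{j-1}d\sigma(t)$ ($j\ge1$) of $\mathfrak F$, and $\mathfrak n_0=0$. Then the following statements are equivalent: (i) the operator $\mathfrak L$ in the block $LU$-factorization $\mathfrak J=\mathfrak L\mathfrak U$ of the monic generalized Jacobi matrix $\mathfrak J$ associated with $\mathfrak F$ is bounded in $\ell^2_{[0,\infty)}$; (ii) the operator $\mathfrak L=\mathfrak L(s_{-1})$ in the block $UL$-factorization $J=\mathfrak U\mathfrak L$, with the parameter $s_{-1}=\mathfrak s_0$, of the monic Jacobi matrix $J$ associated with $F$ is bounded in $\ell^2_{[0,\infty)}$; (iii) the sequence $\{\mathfrak F^{[\mathfrak n_j/\mathfrak n_j]}\}_{j=0}^\infty$ of diagonal Padé approximants converges to $\mathfrak F$ locally uniformly in $\widehat{\mathbb C}\setminus[-1-\varepsilon,1+\varepsilon]$ for some $\varepsilon\ge0$.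
   Context: $\widehat{\mathbb C}=\mathbb C\cup\{\infty\}$ with the spherical metric. $\lambda\widehat\to\infty$ means that $\lambda\to\infty$ inside a sector $\varepsilon<\arg\lambda<\pi-\varepsilon$, $\varepsilon>0$; $\mathfrak F(\lambda)\sim-\sum_j\mathfrak s_j\lambda^{-j-1}$ denotes the asymptotic expansion to all orders as $\lambda\widehat\to\infty$. $\mathbf N_{-\infty}$ is the class of functions $\int_{\mathbb R}\frac{d\mu(t)}{t-\lambda}$ with $\mu$ a finite measure with all moments finite. $\mathbf D^+_{-\infty}$: functions $\mathfrak F$ meromorphic in $\mathbb C_+$ with $\mathfrak F\sim-\sum_{j\ge0}\mathfrak s_j\lambda^{-j-1}$, $\mathfrak s_j\in\mathbb R$, and $\lambda\mathfrak F(\lambda)+\mathfrak s_0\in\mathbf N_{-\infty}$. Padé approximants: for a formal power series $\mathfrak F=-\sum_{j\ge0}\mathfrak s_j\lambda^{-j-1}$, the $[L/M]$ approximant is a ratio $A(1/\lambda)/B(1/\lambda)$ of polynomials of formal degrees $L$ and $M$ with $B(0)\neq0$ and $\sum_{j=0}^{L+M-1}\mathfrak s_j\lambda^{-j-1}+\mathfrak F^{[L/M]}(\lambda)=O(\lambda^{-L-M-1})$, $\lambda\to\infty$. Jacobi matrix: $s_j=\int t^jd\sigma$, $j\ge0$; the monic orthogonal polynomials $P_j$ of $\sigma/s_0$ satisfy $\lambda P_j=P_{j+1}+b_jP_j+c_{j-1}P_{j-1}$, $P_{-1}=0$, $P_0=1$; $Q_j(\lambda)=\int\frac{P_j(\lambda)-P_j(t)}{\lambda-t}d\sigma(t)$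 are the polynomials of the second kind; the monic Jacobi matrix associated with $F$ has $J_{j,j}=b_j$, $J_{j,j+1}=1$, $J_{j+1,j}=c_j$. Normal indices of $\{\mathfrak s_j\}_{j\ge0}$: integers $n\ge1$ with $\det(\mathfrak s_{i+k})_{i,k=0}^{n-1}\ne0$, listed increasingly $\mathfrak n_1<\mathfrak n_2<\dots$; $\mathfrak n_0=0$, $\mathfrak k_j=\mathfrak n_{j+1}-\mathfrak n_j\in\{1,2\}$. Generalized Jacobi matrix: $\mathfrak F$ (nonrational) is normalized if its first nonzero coefficient $\mathfrak s_{\mathfrak n_1-1}$ has modulus $1$. For normalized $\mathfrak F$ put $\mathfrak F_0=\mathfrak F$ and recursively $-1/\mathfrak F_j(\lambda)=\epsilon_j\mathfrak p_j(\lambda)+\mathfrak b_j^2\mathfrak F_{j+1}(\lambda)$, where $\epsilon_j=\pm1$ is the first nonzero asymptotic coefficient of $\mathfrak F_j$, $\mathfrak p_j$ is the monic polynomial (of degree $\mathfrak k_j$) with $-1/\mathfrak F_j-\epsilon_j\mathfrak p_j=o(1)$ as $\lambda\widehat\to\infty$, and $\mathfrak b_j>0$ makes $\mathfrak F_{j+1}$ normalized. Put $\mathfrak c_j=\epsilon_j\epsilon_{j+1}\mathfrak b_j^2$; $\mathfrak p_j(\lambda)=\lambda+\mathfrak p_0^{(j)}$ if $\mathfrak k_j=1$, $\mathfrak p_j(\lambda)=\lambda^2+\mathfrak p_1^{(j)}\lambda+\mathfrak p_0^{(j)}$ if $\mathfrak k_j=2$. The monic generalized Jacobi matrix associated with $\mathfrak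 F$ is the block tridiagonal matrix with diagonal blocks $-\mathfrak p_0^{(j)}$ ($\mathfrak k_j=1$) or $\begin{pmatrix}0&1\\-\mathfrak p_0^{(j)}&-\mathfrak p_1^{(j)}\end{pmatrix}$ ($\mathfrak k_j=2$), superdiagonal $\mathfrak k_j\times\mathfrak k_{j+1}$ blocks with lower-left entry $1$ and other entries $0$, and subdiagonal $\mathfrak k_{j+1}\times\mathfrak k_j$ blocks with lower-left entry $\mathfrak c_j$ and other entries $0$. For $\mathfrak F$ not normalized one uses $\mathfrak F/|\mathfrak s_{\mathfrak n_1-1}|$. Form of $\mathfrak L$ and $\mathfrak U$: $\mathfrak L$ is block lower bidiagonal with diagonal blocks $\mathfrak E_j$ and subdiagonal blocks $\mathfrak L_j$ ($\mathfrak k_j\times\mathfrak k_{j-1}$, in block row $j\ge1$, lower-right entry $\mathfrak l_j$, other entries $0$); $\mathfrak U$ is block upper bidiagonal with diagonal blocks $\mathfrak U_j$ and superdiagonal blocks $\mathfrak D_j$ ($\mathfrak k_j\times\mathfrak k_{j+1}$, lower-left entry $1$, other entries $0$); here $\mathfrak U_j=\mathfrak u_j$, $\mathfrak E_j=1$ if $\mathfrak k_j=1$, and $\mathfrak U_j=\begin{pmatrix}0&1\\ \mathfrak u_j&0\end{pmatrix}$, $\mathfrak E_j=\begin{pmatrix}1&0\\ \mathfrak e_j&1\end{pmatrix}$ if $\mathfrak k_j=2$. In (i), $\mathfrak J=\mathfrak L\mathfrak U$ is the factorization of this form with $\mathfrak u_j=-\mathfrak P_{j+1}(0)/\mathfrak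 P_j(0)$, $\mathfrak l_{j+1}=\mathfrak c_j/\mathfrak u_j$, $\mathfrak e_j=-\mathfrak p_1^{(j)}$, where $\mathfrak P_{-1}=0$, $\mathfrak P_0=1$, $\mathfrak P_{j+1}=\mathfrak p_j\mathfrak P_j-\mathfrak c_{j-1}\mathfrak P_{j-1}$ (one has $\mathfrak P_j(0)\ne0$). In (ii), $J=\mathfrak U\mathfrak L$ is the factorization of this form with $\mathfrak l_j=-\widehat P_{\mathfrak n_{j+1}-1}(0)/\widehat P_{\mathfrak n_j-1}(0)$, $j\in\mathbb N$, where $\widehat P_j=Q_j+s_{-1}P_j$ (one has $\widehat P_{\mathfrak n_j-1}(0)\neq0$). A matrix is bounded in $\ell^2_{[0,\infty)}$ if it defines a bounded operator there. *)

theory Defs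
  imports
    "HOL-Complex_Analysis.Complex_Analysis"
    "HOL-Library.Landau_Symbols"
    "HOL-Library.Infinite_Set"
    "Jordan_Normal_Form.Determinant"
begin

datatype riemann_sphere = Cpt complex | Infty

text \<open>The spherical metric is taken in its chordal form, through stereographic projection.\<close>

fun stereo :: "riemann_sphere \<Rightarrow> complex \<times> real" where
  "stereo (Cpt z) = (complex_of_real (2 / (1 + (cmod z)\<^sup>2)) * z, ((cmod z)\<^sup>2 - 1) / ((cmod z)\<^sup>2 + 1))"
| "stereo Infty = (0, 1)"

lemma stereo_inject: "stereo x = stereo y \<Longrightarrow> x = y"
proof (cases x; cases y)
  have pos: "1 + (cmod z)\<^sup>2 > 0" for z by (simp add: add_pos_nonneg)
  have snd_eq: "((cmod z)\<^sup>2 - 1) / ((cmod z)\<^sup>2 + 1) = 1 - 2 / (1 + (cmod z)\<^sup>2)" for z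
    using pos[of z] by (simp add: field_simps)
  have ne1: "((cmod z)\<^sup>2 - 1) / ((cmod z)\<^sup>2 + 1) \<noteq> 1" for z
    unfolding snd_eq using pos[of z] by simp
  assume eq: "stereo x = stereo y"
  {
    fix z w assume xy: "x = Cpt z" "y = Cpt w"
    then have r: "2 / (1 + (cmod z)\<^sup>2) = 2 / (1 + (cmod w)\<^sup>2)"
      using eq by (simp add: snd_eq)
    have "fst (stereo x) = fst (stereo y)" using eq by simp
    then have "complex_of_real (2 / (1 + (cmod z)\<^sup>2)) * z = complex_of_real (2 / (1 + (cmod z)\<^sup>2)) * w"
      unfolding xy stereo.simps fst_conv r .
    moreover have "2 / (1 + (cmod z)\<^sup>2) \<noteq> 0" using pos[of z] by simp
    ultimately have "z = w" by (metis mult_left_cancel of_real_eq_0_iff)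
    then show "x = y" using xy by simp
  next
    fix z assume "x = Cpt z" "y = Infty"
    then show "x = y" using eq ne1[of z] by simp
  next
    fix w assume "x = Infty" "y = Cpt w"
    then show "x = y" using eq ne1[of w] by simp
  next
    assume "x = Infty" "y = Infty"
    then show "x = y" by simp
  }
qed

instantiation riemann_sphere :: metric_space
begin

definition dist_riemann_sphere :: "riemann_sphere \<Rightarrow> riemann_sphere \<Rightarrow> real" where
  "dist (x :: riemann_sphere) y = dist (stereo x) (stereo y)"

definition uniformity_riemann_sphere :: "(riemann_sphere \<times> riemann_sphere) filter" where
  "(uniformity :: (riemann_sphere \<times> riemann_sphere) filter) = (INF e\<in>{0<..}. principal {(x :: riemann_sphere, y). dist x y < e})"

definition open_riemann_sphere :: "riemann_sphere set \<Rightarrow> bool" where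
  "open (U :: riemann_sphere set) \<longleftrightarrow> (\<forall>x\<in>U. \<forall>\<^sub>F (x', y) in uniformity. x' = x \<longrightarrow> y \<in> U)"

instance
proof
  fix x y z :: riemann_sphere
  show "(dist x y = 0) = (x = y)"
    by (auto simp: dist_riemann_sphere_def dest: stereo_inject)
  show "dist x y \<le> dist x z + dist y z"
    unfolding dist_riemann_sphere_def by (rule dist_triangle2)
qed (simp_all add: uniformity_riemann_sphere_def open_riemann_sphere_def)

end

definition at_infinity_sector :: "real \<Rightarrow> complex filter" where
  "at_infinity_sector \<delta> = inf at_infinity (principal {z. \<delta> < Arg z \<and> Arg z < pi - \<delta>})"

definition has_asymptotics :: "(complex \<Rightarrow> complex) \<Rightarrow> (nat \<Rightarrow> real) \<Rightarrow> bool" where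
  "has_asymptotics F s \<longleftrightarrow>
     (\<forall>\<delta>>0. \<forall>N. (\<lambda>z. F z + (\<Sum>j<N. complex_of_real (s j) / z ^ (j + 1)))
               \<in> O[at_infinity_sector \<delta>](\<lambda>z. 1 / z ^ (N + 1)))"

text \<open>\<open>class_N\<close> and \<open>class_D\<close> are the classes \<open>N\<^sub>-\<^sub>\<infinity>\<close> and \<open>D\<^sup>+\<^sub>-\<^sub>\<infinity>\<close>; members are compared on the upper half-plane
  only.\<close>

definition class_N :: "(complex \<Rightarrow> complex) set" where
  "class_N = {G. \<exists>\<mu> :: real measure. finite_measure \<mu> \<and> sets \<mu> = sets borel \<and>
     (\<forall>j. integrable \<mu> (\<lambda>t. t ^ j)) \<and>
     (\<forall>z. Im z > 0 \<longrightarrow> G z = (LINT t|\<mu>. 1 / (complex_of_real t - z)))}"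

definition class_D :: "(complex \<Rightarrow> complex) set" where
  "class_D = {F. F meromorphic_on {z. Im z > 0} \<and>
     (\<exists>s. has_asymptotics F s \<and> (\<lambda>z. z * F z + complex_of_real (s 0)) \<in> class_N)}"

definition asymp_coeffs :: "(complex \<Rightarrow> complex) \<Rightarrow> nat \<Rightarrow> real" where
  "asymp_coeffs F = (THE s. has_asymptotics F s)"

definition first_coeff :: "(complex \<Rightarrow> complex) \<Rightarrow> real" where
  "first_coeff F = asymp_coeffs F (LEAST j. asymp_coeffs F j \<noteq> 0)"

definition normalized :: "(complex \<Rightarrow> complex) \<Rightarrow> bool" where
  "normalized F \<longleftrightarrow> (\<exists>s. has_asymptotics F s \<and> (\<exists>j. s j \<noteq> 0) \<and> \<bar>s (LEAST j. s j \<noteq> 0)\<bar> = 1)"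

definition normal_indices :: "(nat \<Rightarrow> real) \<Rightarrow> nat set" where
  "normal_indices s = {n. n \<ge> 1 \<and> Determinant.det (mat n n (\<lambda>(i, k). s (i + k))) \<noteq> 0}"

text \<open>The value at \<open>0\<close> is \<open>0\<close>; the \<open>j\<close>-th normal index (\<open>j \<ge> 1\<close>) is at \<open>j\<close>.\<close>

definition normal_index :: "(nat \<Rightarrow> real) \<Rightarrow> nat \<Rightarrow> nat" where
  "normal_index s j = (case j of 0 \<Rightarrow> 0 | Suc i \<Rightarrow> enumerate (normal_indices s) i)"

type_synonym inf_matrix = "nat \<Rightarrow> nat \<Rightarrow> real"

text \<open>Meaningful only if every row of \<open>A\<close> has finitely many nonzero entries, as is the case for all
  matrices below.\<close>

definition inf_mult :: "inf_matrix \<Rightarrow> inf_matrix \<Rightarrow> inf_matrix" where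
  "inf_mult A B i k = (\<Sum>j | A i j \<noteq> 0. A i j * B j k)"

definition l2_bounded :: "inf_matrix \<Rightarrow> bool" where
  "l2_bounded A \<longleftrightarrow> (\<exists>C. \<forall>x :: nat \<Rightarrow> complex. summable (\<lambda>n. (cmod (x n))\<^sup>2) \<longrightarrow>
     (\<forall>i. summable (\<lambda>j. complex_of_real (A i j) * x j)) \<and>
     summable (\<lambda>i. (cmod (\<Sum>j. complex_of_real (A i j) * x j))\<^sup>2) \<and>
     sqrt (\<Sum>i. (cmod (\<Sum>j. complex_of_real (A i j) * x j))\<^sup>2) \<le> C * sqrt (\<Sum>n. (cmod (x n))\<^sup>2))"

text \<open>Block \<open>j\<close> consists of the indices \<open>n j, \<dots>, n (j + 1) - 1\<close>.\<close>

definition block_of :: "(nat \<Rightarrow> nat) \<Rightarrow> nat \<Rightarrow> nat" where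
  "block_of n i = (LEAST j. i < n (Suc j))"

definition block_size :: "(nat \<Rightarrow> nat) \<Rightarrow> nat \<Rightarrow> nat" where
  "block_size n j = n (Suc j) - n j"

definition block_matrix :: "(nat \<Rightarrow> nat) \<Rightarrow> (nat \<Rightarrow> nat \<Rightarrow> real mat) \<Rightarrow> inf_matrix" where
  "block_matrix n B i k =
     B (block_of n i) (block_of n k) $$ (i - n (block_of n i), k - n (block_of n k))"

definition lower_left_mat :: "nat \<Rightarrow> nat \<Rightarrow> real \<Rightarrow> real mat" where
  "lower_left_mat r c x = mat r c (\<lambda>(i, k). if i = r - 1 \<and> k = 0 then x else 0)"

definition lower_right_mat :: "nat \<Rightarrow> nat \<Rightarrow> real \<Rightarrow> real mat" where
  "lower_right_mat r c x = mat r c (\<lambda>(i, k). if i = r - 1 \<and> k = c - 1 then x else 0)"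

text \<open>In \<open>block_L\<close> the entry \<open>e j\<close> is used only if block \<open>j\<close> has size 2, and \<open>l j\<close> only for
  \<open>j \<ge> 1\<close>.\<close>

definition block_L :: "(nat \<Rightarrow> nat) \<Rightarrow> (nat \<Rightarrow> real) \<Rightarrow> (nat \<Rightarrow> real) \<Rightarrow> inf_matrix" where
  "block_L n e l = block_matrix n (\<lambda>j j'.
     if j' = j then
       (if block_size n j = 1 then mat_of_rows_list 1 [[1]]
        else mat_of_rows_list 2 [[1, 0], [e j, 1]])
     else if j = Suc j' then lower_right_mat (block_size n j) (block_size n j') (l j)
     else 0\<^sub>m (block_size n j) (block_size n j'))"

definition block_U :: "(nat \<Rightarrow> nat) \<Rightarrow> (nat \<Rightarrow> real) \<Rightarrow> inf_matrix" where
  "block_U n u = block_matrix n (\<lambda>j j'.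
     if j' = j then
       (if block_size n j = 1 then mat_of_rows_list 1 [[u j]]
        else mat_of_rows_list 2 [[0, 1], [u j, 0]])
     else if j' = Suc j then lower_left_mat (block_size n j) (block_size n j') 1
     else 0\<^sub>m (block_size n j) (block_size n j'))"

definition principal_poly :: "(complex \<Rightarrow> complex) \<Rightarrow> real poly" where
  "principal_poly G = (THE p. lead_coeff p = 1 \<and>
     (\<forall>\<delta>>0. ((\<lambda>z. - 1 / G z - complex_of_real (first_coeff G) * poly (map_poly complex_of_real p) z)
              \<longlongrightarrow> 0) (at_infinity_sector \<delta>)))"

definition step_remainder :: "(complex \<Rightarrow> complex) \<Rightarrow> complex \<Rightarrow> complex" where
  "step_remainder G z =
     - 1 / G z - complex_of_real (first_coeff G) * poly (map_poly complex_of_real (principal_poly G)) z"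

definition step_b :: "(complex \<Rightarrow> complex) \<Rightarrow> real" where
  "step_b G = (THE b. b > 0 \<and> normalized (\<lambda>z. step_remainder G z / complex_of_real (b\<^sup>2)))"

text \<open>\<open>gen_F F j\<close> is the \<open>j\<close>-th function in
  \<open>- 1 / F\<^sub>j = \<epsilon>\<^sub>j p\<^sub>j + b\<^sub>j\<^sup>2 F\<^sub>j\<^sub>+\<^sub>1\<close>, started from the normalization of \<open>F\<close>;
  \<open>\<epsilon>\<^sub>j = first_coeff (gen_F F j)\<close> and \<open>b\<^sub>j = step_b (gen_F F j)\<close>. Only the values near
  infinity matter, so the convention \<open>x / 0 = 0\<close> plays no role.\<close>

primrec gen_F :: "(complex \<Rightarrow> complex) \<Rightarrow> nat \<Rightarrow> complex \<Rightarrow> complex" where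
  "gen_F F 0 = (\<lambda>z. F z / complex_of_real \<bar>first_coeff F\<bar>)"
| "gen_F F (Suc j) = (\<lambda>z. step_remainder (gen_F F j) z / complex_of_real ((step_b (gen_F F j))\<^sup>2))"

definition gen_p :: "(complex \<Rightarrow> complex) \<Rightarrow> nat \<Rightarrow> real poly" where
  "gen_p F j = principal_poly (gen_F F j)"

definition gen_c :: "(complex \<Rightarrow> complex) \<Rightarrow> nat \<Rightarrow> real" where
  "gen_c F j = first_coeff (gen_F F j) * first_coeff (gen_F F (Suc j)) * (step_b (gen_F F j))\<^sup>2"

definition gen_jacobi :: "(complex \<Rightarrow> complex) \<Rightarrow> inf_matrix" where
  "gen_jacobi F = (let n = normal_index (asymp_coeffs F) in block_matrix n (\<lambda>j j'.
     if j' = j then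
       (if block_size n j = 1 then mat_of_rows_list 1 [[- coeff (gen_p F j) 0]]
        else mat_of_rows_list 2 [[0, 1], [- coeff (gen_p F j) 0, - coeff (gen_p F j) 1]])
     else if j' = Suc j then lower_left_mat (block_size n j) (block_size n j') 1
     else if j = Suc j' then lower_left_mat (block_size n j) (block_size n j') (gen_c F j')
     else 0\<^sub>m (block_size n j) (block_size n j')))"

fun gen_P :: "(complex \<Rightarrow> complex) \<Rightarrow> nat \<Rightarrow> real poly" where
  "gen_P F 0 = 1"
| "gen_P F (Suc 0) = gen_p F 0"
| "gen_P F (Suc (Suc j)) = gen_p F (Suc j) * gen_P F (Suc j) - Polynomial.smult (gen_c F j) (gen_P F j)"

definition block_LU_factorization :: "(complex \<Rightarrow> complex) \<Rightarrow> inf_matrix \<Rightarrow> inf_matrix \<Rightarrow> bool" where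
  "block_LU_factorization F L U \<longleftrightarrow> gen_jacobi F = inf_mult L U \<and>
     (\<exists>u e l. L = block_L (normal_index (asymp_coeffs F)) e l \<and>
              U = block_U (normal_index (asymp_coeffs F)) u \<and>
        (\<forall>j. u j = - poly (gen_P F (Suc j)) 0 / poly (gen_P F j) 0 \<and>
             l (Suc j) = gen_c F j / u j \<and>
             e j = - coeff (gen_p F j) 1))"

definition measure_support :: "real measure \<Rightarrow> real set" where
  "measure_support \<sigma> = {x. \<forall>V. open V \<and> x \<in> V \<longrightarrow> emeasure \<sigma> V > 0}"

definition moment :: "real measure \<Rightarrow> nat \<Rightarrow> real" where
  "moment \<sigma> j = (LINT t|\<sigma>. t ^ j)"

definition ortho_poly :: "real measure \<Rightarrow> nat \<Rightarrow> real poly" where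
  "ortho_poly \<sigma> n = (THE p. degree p = n \<and> lead_coeff p = 1 \<and>
     (\<forall>q. degree q < n \<longrightarrow> (LINT t|\<sigma>. poly p t * poly q t) = 0))"

definition monic_jacobi :: "real measure \<Rightarrow> inf_matrix" where
  "monic_jacobi \<sigma> = (THE J. \<exists>b c.
     (\<forall>j. [:0, 1:] * ortho_poly \<sigma> j = ortho_poly \<sigma> (Suc j) + Polynomial.smult (b j) (ortho_poly \<sigma> j) +
            (case j of 0 \<Rightarrow> 0 | Suc i \<Rightarrow> Polynomial.smult (c i) (ortho_poly \<sigma> i))) \<and>
     J = (\<lambda>i k. if k = i then b i else if k = Suc i then 1 else if i = Suc k then c k else 0))"

text \<open>The polynomial \<open>(p x - p t) / (x - t)\<close>; its value at \<open>t = x\<close> matters because \<open>\<sigma>\<close> may have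
  an atom at \<open>x\<close>.\<close>

definition divided_difference :: "real poly \<Rightarrow> real \<Rightarrow> real \<Rightarrow> real" where
  "divided_difference p x t =
     (if t = x then poly (pderiv p) x else (poly p x - poly p t) / (x - t))"

definition second_kind :: "real measure \<Rightarrow> nat \<Rightarrow> real \<Rightarrow> real" where
  "second_kind \<sigma> j x = (LINT t|\<sigma>. divided_difference (ortho_poly \<sigma> j) x t)"

definition P_hat :: "real measure \<Rightarrow> real \<Rightarrow> nat \<Rightarrow> real \<Rightarrow> real" where
  "P_hat \<sigma> s j x = second_kind \<sigma> j x + s * poly (ortho_poly \<sigma> j) x"

text \<open>The parameter \<open>s\<close> is the number \<open>s\<^sub>-\<^sub>1\<close>, so the sequence starts \<open>s, moment \<sigma> 0, moment \<sigma> 1, \<dots>\<close>.\<close>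

definition extended_moments :: "real measure \<Rightarrow> real \<Rightarrow> nat \<Rightarrow> real" where
  "extended_moments \<sigma> s j = (case j of 0 \<Rightarrow> s | Suc i \<Rightarrow> moment \<sigma> i)"

text \<open>The prescribed \<open>l j\<close> together with the product determine the entries of \<open>U\<close> and \<open>L\<close>.\<close>

definition block_UL_factorization :: "real measure \<Rightarrow> real \<Rightarrow> inf_matrix \<Rightarrow> inf_matrix \<Rightarrow> bool" where
  "block_UL_factorization \<sigma> s U L \<longleftrightarrow> monic_jacobi \<sigma> = inf_mult U L \<and>
     (let n = normal_index (extended_moments \<sigma> s) in
      \<exists>u e l. U = block_U n u \<and> L = block_L n e l \<and>
        (\<forall>j\<ge>1. l j = - P_hat \<sigma> s (n (Suc j) - 1) 0 / P_hat \<sigma> s (n j - 1) 0))"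

text \<open>The approximant is regarded as a map of the Riemann sphere to itself: the continuous
  extension of \<open>A (1/z) / B (1/z)\<close> over infinity, the poles and the common zeros of numerator and
  denominator.\<close>

definition is_pade :: "(nat \<Rightarrow> real) \<Rightarrow> nat \<Rightarrow> nat \<Rightarrow> (riemann_sphere \<Rightarrow> riemann_sphere) \<Rightarrow> bool" where
  "is_pade s L M R \<longleftrightarrow> continuous_on UNIV R \<and>
     (\<exists>A B :: complex poly. degree A \<le> L \<and> degree B \<le> M \<and> poly B 0 \<noteq> 0 \<and>
        (\<forall>z. z \<noteq> 0 \<and> poly B (1 / z) \<noteq> 0 \<longrightarrow> R (Cpt z) = Cpt (poly A (1 / z) / poly B (1 / z))) \<and>
        (\<lambda>z. (\<Sum>j<L + M. complex_of_real (s j) / z ^ (j + 1)) + poly A (1 / z) / poly B (1 / z))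
          \<in> O[at_infinity](\<lambda>z. 1 / z ^ (L + M + 1)))"

text \<open>For functions \<open>F\<close> with limit \<open>0\<close> at infinity.\<close>

definition sphere_extension :: "(complex \<Rightarrow> complex) \<Rightarrow> riemann_sphere \<Rightarrow> riemann_sphere" where
  "sphere_extension F x = (case x of Cpt z \<Rightarrow> Cpt (F z) | Infty \<Rightarrow> Cpt 0)"

definition locally_uniform_limit ::
  "riemann_sphere set \<Rightarrow> (nat \<Rightarrow> riemann_sphere \<Rightarrow> riemann_sphere) \<Rightarrow>
    (riemann_sphere \<Rightarrow> riemann_sphere) \<Rightarrow> bool" where
  "locally_uniform_limit S R G \<longleftrightarrow>
     (\<forall>K. compact K \<and> K \<subseteq> S \<longrightarrow> uniform_limit K R G sequentially)"

end

(* Write P_n for the monic orthogonal polynomials of sigma, F_n for their functions of the second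
   kind, and x_0 = -1, x_(n+1) = Phat_n(0).  A number n >= 1 is normal iff x_n is nonzero, and the
   sequence x satisfies the three-term recurrence of the P_n at the point 0, so consecutive normal
   indices differ by 1 or 2.  For normal n put a_n = - x_(n+1) / x_n; the denominators of the
   diagonal Pade approximants are the polynomials P_n + a_n P_(n-1) (a Geronimus transform).

   The two bidiagonal relations between the P_n and these polynomials are the factors U and L; they
   give both the UL-factorization of J and, applied to the functions F_n + a_n F_(n-1), the steps of
   the continued fraction that defines the generalized Jacobi matrix, so its LU-factorization has
   literally the same L.  The operator L is bounded iff its entries are, that is, iff the numbers
   a_n are bounded.

   The error of the approximant at z is (F_n + a_n F_(n-1)) / (z (P_n + a_n P_(n-1))).  If the a_n
   are bounded it tends to 0, because |P_n|^2 / |P_n|_sigma^2 grows geometrically off the interval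
   and Im (P_n / P_(n-1)) has the sign and at least the modulus of Im z.  If |a_n| is large, then
   P_n / P_(n-1) = - a_n has a real solution of modulus about |a_n|: a pole of the approximant near
   infinity, which excludes convergence there. *)

theory Submission
  imports Defs
begin

section \<open>Three-term recurrences and the Geronimus transform\<close>

text \<open>The number a_n is the one with x_(n+1) + a_n x_n = 0. The polynomials P_n, the functions
  F_n, the numerators and x all solve one recurrence and differ only in their starting values, so
  the relations for X_(n+1) + a_n X_n are proved once for an arbitrary solution X; the vanishing of
  this combination on x is what makes the numerators divisible by z. The zeros of x are the
  obstacle. Across such a zero two steps of the recurrence merge into one of degree 2; there a_n = 0
  and the entry of L is a coefficient of J of size at most 1. Hence boundedness of L and of the a_n
  still agree. Even for bounded a_n the approximants may have real poles outside [-1, 1]. A bound C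
  confines them to the disc of radius C + 4, while nonreal points are never poles because a_n is
  real. This is why the interval is enlarged by epsilon, and why convergence takes two estimates:
  one in a disc away from the real line, one near infinity.\<close>

definition three_term :: "(nat \<Rightarrow> real) \<Rightarrow> (nat \<Rightarrow> real) \<Rightarrow> 'a::real_field \<Rightarrow> (nat \<Rightarrow> 'a) \<Rightarrow> bool" where
  "three_term b g z X \<longleftrightarrow>
     (\<forall>n. X (Suc (Suc n)) = (z - of_real (b n)) * X (Suc n) - of_real (g n) * X n)"

lemma three_termD:
  "three_term b g z X \<Longrightarrow> X (Suc (Suc n)) = (z - of_real (b n)) * X (Suc n) - of_real (g n) * X n"
  by (simp add: three_term_def)

text \<open>One step of the recurrence multiplies this Casorati determinant by \<open>g n\<close>.
  With \<open>\<xi> s\<close> as partner it evaluates the denominators at 0; with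
  \<open>cD z\<close> it excludes common zeros of numerator and denominator.\<close>

lemma three_term_wronskian:
  assumes X: "three_term b g z X" and X': "three_term b g z X'"
  shows "X (Suc n) * X' n - X' (Suc n) * X n = of_real (\<Prod>k<n. g k) * (X 1 * X' 0 - X' 1 * X 0)"
proof (induction n)
  case (Suc n)
  have "X (Suc (Suc n)) * X' (Suc n) - X' (Suc (Suc n)) * X (Suc n)
      = of_real (g n) * (X (Suc n) * X' n - X' (Suc n) * X n)"
    unfolding three_termD[OF X] three_termD[OF X'] by (simp add: algebra_simps)
  then show ?case
    using Suc.IH by (simp add: mult_ac)
qed simp

text \<open>The sequences are shifted by one: \<open>x n\<close> stands for the value at \<open>0\<close> of the paper's
  \<open>P_hat (n - 1)\<close>.  With the starting value \<open>x 0 = -1\<close> the recurrence holds from the index \<open>0\<close> on, and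
  \<open>\<nn> 0 = 0\<close> behaves like a normal index.\<close>

locale darboux =
  fixes b g x :: "nat \<Rightarrow> real" and \<nn> :: "nat \<Rightarrow> nat"
  assumes g_pos: "g n > 0"
    and x_rec: "three_term b g 0 x"
    and x_0: "x 0 = -1"
    and nn_0: "\<nn> 0 = 0"
    and nn_Suc: "\<nn> (Suc j) = (if x (Suc (\<nn> j)) \<noteq> 0 then Suc (\<nn> j) else Suc (Suc (\<nn> j)))"
begin

definition eta :: "nat \<Rightarrow> real" where "eta n = (\<Prod>k<n. g k)"
definition a :: "nat \<Rightarrow> real" where "a n = - x (Suc n) / x n"
definition l :: "nat \<Rightarrow> real" where "l j = - x (\<nn> (Suc j)) / x (\<nn> j)"
text \<open>One formula serves both block sizes. It is also the quotient of values at 0 that the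
  LU-factorization prescribes, see \<open>gen_P_ratio\<close>.\<close>

definition u :: "nat \<Rightarrow> real" where "u j = eta (\<nn> (Suc j)) / (eta (\<nn> j) * l j)"
definition c :: "nat \<Rightarrow> real" where "c j = l (Suc j) * u j"
text \<open>The first block row of \<open>L\<close> has no subdiagonal block. The number
  \<open>l 0\<close> has another meaning: it is the first nonzero asymptotic coefficient of
  F.\<close>

definition l' :: "nat \<Rightarrow> real" where "l' j = (if j = 0 then 0 else l j)"
definition q :: "nat \<Rightarrow> real poly" where
  "q j = (if x (Suc (\<nn> j)) \<noteq> 0 then 1 else [:- b (\<nn> j), 1:])"
definition p :: "nat \<Rightarrow> real poly" where "p j = [:0, 1:] * q j - [:u j + l' j:]"
definition Y :: "(nat \<Rightarrow> 'a::real_field) \<Rightarrow> nat \<Rightarrow> 'a" where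
  "Y X j = X (Suc (\<nn> j)) + of_real (a (\<nn> j)) * X (\<nn> j)"

lemma x_Suc_Suc: "x (Suc (Suc n)) = - b n * x (Suc n) - g n * x n"
  using three_termD[OF x_rec, of n] by simp

lemma x_nn: "x (\<nn> j) \<noteq> 0"
proof (induction j)
  case (Suc j)
  then show ?case using g_pos[of "\<nn> j"] by (auto simp: nn_Suc x_Suc_Suc)
qed (simp add: nn_0 x_0)

lemma eta_pos: "eta n > 0" by (simp add: eta_def prod_pos g_pos)
lemma eta_Suc: "eta (Suc n) = g n * eta n" by (simp add: eta_def)

lemma l_nz: "l j \<noteq> 0" by (simp add: l_def x_nn)
lemma u_nz: "u j \<noteq> 0" using eta_pos by (simp add: u_def l_nz less_imp_neq[symmetric])
lemma c_nz: "c j \<noteq> 0" by (simp add: c_def l_nz u_nz)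

lemma short_block:
  assumes "x (Suc (\<nn> j)) \<noteq> 0"
  shows "\<nn> (Suc j) = Suc (\<nn> j)" "a (\<nn> j) = l j" "u j * l j = g (\<nn> j)"
    "a (\<nn> (Suc j)) + u j = b (\<nn> j)"
proof -
  let ?n = "\<nn> j"
  show N: "\<nn> (Suc j) = Suc ?n" using assms by (simp add: nn_Suc)
  show "a ?n = l j" by (simp add: a_def l_def N)
  show ul: "u j * l j = g ?n"
    using eta_pos[of ?n] l_nz[of j] by (simp add: u_def N eta_Suc)
  have "u j = g ?n / l j" using ul l_nz[of j] by (simp add: field_simps)
  then show "a (\<nn> (Suc j)) + u j = b ?n"
    using assms x_nn[of j] by (simp add: N a_def l_def x_Suc_Suc divide_simps)
qed

text \<open>At a zero of \<open>x\<close> inside a block \<open>a\<close> vanishes, so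
  \<open>Y\<close> is a single member of \<open>X\<close> there, and \<open>l\<close> is a
  recurrence coefficient instead of a value of \<open>a\<close>.\<close>

lemma long_block:
  assumes "x (Suc (\<nn> j)) = 0"
  shows "\<nn> (Suc j) = Suc (Suc (\<nn> j))" "a (\<nn> j) = 0" "l j = g (\<nn> j)" "u j = g (Suc (\<nn> j))"
    "a (\<nn> (Suc j)) = b (Suc (\<nn> j))"
proof -
  let ?n = "\<nn> j"
  show N: "\<nn> (Suc j) = Suc (Suc ?n)" using assms by (simp add: nn_Suc)
  show "a ?n = 0" by (simp add: a_def assms)
  show l: "l j = g ?n" using x_nn[of j] by (simp add: l_def N x_Suc_Suc assms)
  show "u j = g (Suc ?n)"
    using eta_pos[of ?n] g_pos[of ?n] by (simp add: u_def N eta_Suc l)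
  show "a (\<nn> (Suc j)) = b (Suc ?n)"
    using x_nn[of "Suc j"] by (simp add: N a_def x_Suc_Suc[of "Suc ?n"] assms)
qed

text \<open>\<open>Y_down\<close> and \<open>Y_up\<close> are the rows of \<open>U\<close> and \<open>L\<close>: they carry a solution \<open>X\<close> of the recurrence of
  \<open>J\<close> to the solution \<open>Y\<close> of the recurrence of the generalized Jacobi matrix and back.\<close>

lemma Y_down:
  assumes "three_term b g z X"
  shows "z * X (\<nn> (Suc j)) = Y X (Suc j) + of_real (u j) * Y X j"
proof (cases "x (Suc (\<nn> j)) = 0")
  case True
  note lb = long_block[OF this]
  have a: "a (Suc (Suc (\<nn> j))) = b (Suc (\<nn> j))" using lb(1,5) by simp
  show ?thesis
    by (simp add: Y_def lb a three_termD[OF assms, of "Suc (\<nn> j)"] algebra_simps)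
next
  case False
  note sb = short_block[OF this]
  have b: "of_real (b (\<nn> j)) = of_real (a (Suc (\<nn> j))) + (of_real (u j) :: 'a)"
    using sb(4) unfolding sb(1) by (metis of_real_add)
  have g: "of_real (g (\<nn> j)) = of_real (u j) * (of_real (l j) :: 'a)"
    using sb(3) by (metis of_real_mult)
  show ?thesis
    by (simp add: Y_def sb(1,2) three_termD[OF assms, of "\<nn> j"] b g algebra_simps)
qed

lemma Y_up:
  assumes "three_term b g z X"
  shows "poly (map_poly of_real (q j)) z * Y X j = X (\<nn> (Suc j)) + of_real (l j) * X (\<nn> j)"
proof (cases "x (Suc (\<nn> j)) = 0")
  case True
  note lb = long_block[OF this]
  show ?thesis
    by (simp add: Y_def q_def map_poly_pCons True lb three_termD[OF assms, of "\<nn> j"] algebra_simps)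
next
  case False
  note sb = short_block[OF this]
  show ?thesis by (simp add: Y_def q_def False sb)
qed

lemma poly_p:
  "poly (map_poly of_real (p j)) z
   = z * poly (map_poly of_real (q j)) z - of_real (u j) - (of_real (l' j) :: 'a::real_field)"
  by (simp add: p_def q_def map_poly_pCons one_pCons algebra_simps)

text \<open>The term \<open>z * X 0\<close> stands in for a member of \<open>Y\<close> before index
  0. It vanishes for the polynomials \<open>cA z\<close>; for \<open>B z\<close> it becomes, after
  division by \<open>z\<close>, the starting function \<open>\<Phi> 0 = -1\<close>.\<close>

lemma Y_Suc_0:
  assumes "three_term b g z X"
  shows "Y X (Suc 0) = poly (map_poly of_real (p 0)) z * Y X 0 - of_real (l 0) * (z * X 0)"
proof -
  have "z * (poly (map_poly of_real (q 0)) z * Y X 0)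
      = Y X (Suc 0) + of_real (u 0) * Y X 0 + of_real (l 0) * (z * X 0)"
    using Y_down[OF assms, of 0] by (simp add: Y_up[OF assms] distrib_left mult.left_commute[of z] nn_0)
  then show ?thesis by (simp add: poly_p l'_def algebra_simps)
qed

text \<open>Multiplying \<open>Y_up\<close> by \<open>z\<close> and inserting \<open>Y_down\<close>
  at \<open>j\<close> and at \<open>Suc j\<close> eliminates \<open>X\<close>. This is the product
  of the two bidiagonal factors acting on \<open>Y\<close>.\<close>

lemma Y_Suc_Suc:
  assumes "three_term b g z X"
  shows "Y X (Suc (Suc j)) = poly (map_poly of_real (p (Suc j))) z * Y X (Suc j) - of_real (c j) * Y X j"
proof -
  have "z * (poly (map_poly of_real (q (Suc j))) z * Y X (Suc j))
      = Y X (Suc (Suc j)) + of_real (u (Suc j)) * Y X (Suc j)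
        + of_real (l (Suc j)) * (Y X (Suc j) + of_real (u j) * Y X j)"
    using Y_down[OF assms, of "Suc j"] Y_down[OF assms, of j]
    by (simp add: Y_up[OF assms] distrib_left mult.left_commute[of z])
  then show ?thesis by (simp add: poly_p c_def l'_def algebra_simps)
qed

lemma coeff_p_0: "coeff (p j) 0 = - u j - l' j"
  by (simp add: p_def)

lemma coeff_p_1: "x (Suc (\<nn> j)) = 0 \<Longrightarrow> coeff (p j) 1 = - b (\<nn> j)"
  by (simp add: p_def q_def)

lemma lead_coeff_p: "lead_coeff (p j) = 1"
  by (auto simp: p_def q_def nn_Suc one_pCons)

end

text \<open>Brings the enumeration of the normal indices into the recursive form of the locale
  \<open>darboux\<close>. Adding 0 to the index set shifts the enumeration by one, which is how 0
  comes to behave like a normal index.\<close>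

lemma enumerate_consecutive_gaps:
  fixes x :: "nat \<Rightarrow> 'a::zero"
  assumes "x 0 \<noteq> 0" and gap: "\<And>n. x n \<noteq> 0 \<or> x (Suc n) \<noteq> 0"
  defines "S \<equiv> {n. x n \<noteq> 0}"
  shows "enumerate S 0 = 0"
    and "enumerate S (Suc j) = (if x (Suc (enumerate S j)) \<noteq> 0 then Suc (enumerate S j)
                                else Suc (Suc (enumerate S j)))"
    and "(case j of 0 \<Rightarrow> 0 | Suc i \<Rightarrow> enumerate {n. n \<ge> 1 \<and> x n \<noteq> 0} i) = enumerate S j"
proof -
  have inf: "infinite S"
    unfolding infinite_nat_iff_unbounded_le S_def
  proof (intro allI)
    fix m show "\<exists>n\<ge>m. n \<in> {n. x n \<noteq> 0}" using gap[of m] by (auto intro: exI[of _ m] exI[of _ "Suc m"])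
  qed
  show z: "enumerate S 0 = 0" using assms by (simp add: enumerate_0 S_def)
  show "enumerate S (Suc j) = (if x (Suc (enumerate S j)) \<noteq> 0 then Suc (enumerate S j)
                                else Suc (Suc (enumerate S j)))"
    unfolding enumerate_Suc''[OF inf]
    apply (rule Least_equality)
    subgoal using gap[of "Suc (enumerate S j)"] by (auto simp: S_def)
    subgoal for y using not_less_eq_eq by (cases "y = Suc (enumerate S j)") (auto simp: S_def)
    done
  have "S - {0} = {n. n \<ge> 1 \<and> x n \<noteq> 0}" by (auto simp: S_def)
  then have "enumerate S (Suc i) = enumerate {n. n \<ge> 1 \<and> x n \<noteq> 0} i" for i
    using z by (simp add: enumerate_Suc' del: enumerate_Suc)
  then show "(case j of 0 \<Rightarrow> 0 | Suc i \<Rightarrow> enumerate {n. n \<ge> 1 \<and> x n \<noteq> 0} i) = enumerate S j"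
    using z by (simp split: nat.split)
qed

section \<open>Block bidiagonal and tridiagonal matrices\<close>

locale block_index =
  fixes n :: "nat \<Rightarrow> nat"
  assumes n_0: "n 0 = 0" and n_gap: "n (Suc j) = Suc (n j) \<or> n (Suc j) = Suc (Suc (n j))"
begin

lemma n_less: "n j < n (Suc j)" using n_gap[of j] by auto
lemma strict_mono_n: "strict_mono n" by (simp add: strict_mono_Suc_iff n_less)

lemma block_of_eq:
  assumes "n j \<le> i" "i < n (Suc j)" shows "block_of n i = j"
  unfolding block_of_def
proof (rule Least_equality)
  fix k assume "i < n (Suc k)"
  then have "n j < n (Suc k)" using assms by simp
  then show "j \<le> k" using strict_mono_less[OF strict_mono_n] by simp
qed (use assms in simp)

text \<open>A block of size 1 counts as \<open>last\<close>, so that the formulas for the last row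
  of a block cover both sizes and only the first row of a long block is separate.\<close>

lemma block_cases:
  obtains (first) j where "i = n j" "n (Suc j) = Suc (Suc (n j))"
    | (last) j where "Suc i = n (Suc j)"
proof -
  have ex: "\<exists>j. i < n (Suc j)"
    using strict_mono_imp_increasing[OF strict_mono_n, of "Suc i"] by (auto intro!: exI[of _ i])
  define j where "j = (LEAST j. i < n (Suc j))"
  have 1: "i < n (Suc j)" unfolding j_def using ex by (rule LeastI_ex)
  have 2: "n j \<le> i"
  proof (cases j)
    case (Suc k)
    then have "\<not> i < n (Suc k)" using not_less_Least[of k "\<lambda>j. i < n (Suc j)"] by (simp add: j_def)
    then show ?thesis using Suc by simp
  qed (simp add: n_0)
  consider "i = n j" "n (Suc j) = Suc (Suc (n j))" | "Suc i = n (Suc j)"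
    using 1 2 n_gap[of j] by linarith
  then show ?thesis using that by cases auto
qed

lemma pos_eq_iff:
  assumes "n j + r < n (Suc j)" "n j' + r' < n (Suc j')"
  shows "n j + r = n j' + r' \<longleftrightarrow> j = j' \<and> r = r'"
proof
  assume eq: "n j + r = n j' + r'"
  have "block_of n (n j + r) = j" "block_of n (n j' + r') = j'"
    using assms by (auto intro: block_of_eq)
  then show "j = j' \<and> r = r'" using eq by auto
qed auto

lemma block_matrix_entry:
  assumes "n j + r < n (Suc j)" "n j' + r' < n (Suc j')"
  shows "block_matrix n B (n j + r) (n j' + r') = B j j' $$ (r, r')"
proof -
  have "block_of n (n j + r) = j" "block_of n (n j' + r') = j'"
    using assms by (auto intro: block_of_eq)
  then show ?thesis by (simp add: block_matrix_def)
qed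

lemma position:
  obtains j r where "i = n j + r" "n j + r < n (Suc j)" "r = 0 \<or> r = 1 \<and> n (Suc j) = Suc (Suc (n j))"
    "block_size n j = 1 \<or> block_size n j = 2" "n (Suc j) = n j + block_size n j"
proof (rule block_cases[of i])
  fix j assume j: "i = n j" "n (Suc j) = Suc (Suc (n j))"
  show ?thesis by (rule that[of j 0]) (simp_all add: j block_size_def)
next
  fix j assume a: "Suc i = n (Suc j)"
  consider "n (Suc j) = Suc (n j)" | "n (Suc j) = Suc (Suc (n j))" using n_gap[of j] by blast
  then show ?thesis
  proof cases
    case 1
    show ?thesis by (rule that[of j 0]) (use a 1 in \<open>simp_all add: block_size_def\<close>)
  next
    case 2
    show ?thesis by (rule that[of j 1]) (use a 2 in \<open>simp_all add: block_size_def\<close>)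
  qed
qed

lemma size_cases: "block_size n j = 1 \<and> n (Suc j) = Suc (n j) \<or> block_size n j = 2 \<and> n (Suc j) = Suc (Suc (n j))"
  using n_gap[of j] by (auto simp: block_size_def)

definition last_row :: "nat \<Rightarrow> nat" where "last_row j = n (Suc j) - 1"

lemma last_row: "last_row j = n j + (block_size n j - 1)" "n j + (block_size n j - 1) < n (Suc j)"
  using size_cases[of j] by (auto simp: last_row_def)

lemma col_eq:
  assumes "n j' + r' < n (Suc j')"
  shows "n j' + r' = n j \<longleftrightarrow> j' = j \<and> r' = 0"
    and "n j' + r' = last_row j \<longleftrightarrow> j' = j \<and> r' = block_size n j - 1"
    and "n (Suc j) = Suc (Suc (n j)) \<Longrightarrow> n j' + r' = Suc (n j) \<longleftrightarrow> j' = j \<and> r' = 1"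
  using pos_eq_iff[OF assms, of j 0] n_less[of j] pos_eq_iff[OF assms last_row(2), of j]
    pos_eq_iff[OF assms, of j 1]
  by (auto simp: last_row(1))

lemma mat_of_rows_list_entries:
  "r < 1 \<Longrightarrow> r' < 1 \<Longrightarrow> mat_of_rows_list 1 [[x]] $$ (r, r') = x"
  "r < 2 \<Longrightarrow> r' < 2 \<Longrightarrow> mat_of_rows_list 2 [[x, y], [z, w]] $$ (r, r')
     = (if r = 0 then if r' = 0 then x else y else if r' = 0 then z else w)"
  by (auto simp: mat_of_rows_list_def less_2_cases_iff)

lemma corner_mat_entries:
  assumes "r < s" "r' < s'"
  shows "lower_right_mat s s' x $$ (r, r') = of_bool (r = s - 1 \<and> r' = s' - 1) * x"
    and "lower_left_mat s s' x $$ (r, r') = of_bool (r = s - 1 \<and> r' = 0) * x"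
    and "0\<^sub>m s s' $$ (r, r') = (0 :: real)"
  using assms by (auto simp: lower_right_mat_def lower_left_mat_def)

lemma size_bounds:
  assumes "n j + r < n (Suc j)"
  shows "block_size n j = 1 \<or> block_size n j = 2" "r < block_size n j"
  using assms size_cases[of j] by auto

lemma block_L_entry:
  assumes "n j + r < n (Suc j)" "n j' + r' < n (Suc j')"
  shows "block_L n e l (n j + r) (n j' + r') =
    (if j' = j then of_bool (r' = r) + of_bool (r = 1 \<and> r' = 0) * e j
     else of_bool (j = Suc j' \<and> r = block_size n j - 1 \<and> r' = block_size n j' - 1) * l j)"
proof -
  note sb = size_bounds[OF assms(1)] size_bounds[OF assms(2)]
  show ?thesis
  proof (cases "j' = j")
    case True
    then show ?thesis
      using sb unfolding block_L_def block_matrix_entry[OF assms]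
      by (elim disjE) (auto simp: mat_of_rows_list_entries mat_of_rows_list_entries(1)[unfolded One_nat_def] less_2_cases_iff)
  next
    case False
    then show ?thesis
      unfolding block_L_def block_matrix_entry[OF assms]
      by (simp only: if_False if_distrib[of "\<lambda>M. M $$ _"] corner_mat_entries[OF sb(2) sb(4)]) auto
  qed
qed

lemma block_U_entry:
  assumes "n j + r < n (Suc j)" "n j' + r' < n (Suc j')"
  shows "block_U n u (n j + r) (n j' + r') =
    (if j' = j then (if r = block_size n j - 1 then of_bool (r' = 0) * u j else of_bool (r' = 1))
     else of_bool (j' = Suc j \<and> r = block_size n j - 1 \<and> r' = 0))"
proof -
  note sb = size_bounds[OF assms(1)] size_bounds[OF assms(2)]
  show ?thesis
  proof (cases "j' = j")
    case True
    then show ?thesis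
      using sb unfolding block_U_def block_matrix_entry[OF assms]
      by (elim disjE) (auto simp: mat_of_rows_list_entries mat_of_rows_list_entries(1)[unfolded One_nat_def] less_2_cases_iff)
  next
    case False
    then show ?thesis
      unfolding block_U_def block_matrix_entry[OF assms]
      by (simp only: if_False if_distrib[of "\<lambda>M. M $$ _"] corner_mat_entries[OF sb(2) sb(4)]) auto
  qed
qed

lemma block_L_last:
  "block_L n e l (last_row j) k = of_bool (k = last_row j)
     + (if n (Suc j) = Suc (Suc (n j)) then of_bool (k = n j) * e j else 0)
     + (case j of 0 \<Rightarrow> 0 | Suc i \<Rightarrow> of_bool (k = last_row i) * l j)"
proof -
  obtain j' r' where k: "k = n j' + r'" "n j' + r' < n (Suc j')" by (rule position[of k])
  have sz: "n (Suc j) = Suc (Suc (n j)) \<longleftrightarrow> block_size n j = 2" using size_cases[of j] by auto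
  note sb = size_bounds[OF k(2)]
  have one: "of_bool (k = Suc (n j)) = of_bool (j' = j \<and> r' = 1)" if "block_size n j = 2"
    using col_eq(3)[OF k(2), of j] that unfolding k(1) sz by simp
  have e: "block_L n e l (last_row j) k = block_L n e l (n j + (block_size n j - 1)) (n j' + r')"
    by (simp add: last_row(1) k(1))
  show ?thesis
  proof (cases "block_size n j = 2")
    case True
    show ?thesis
      using sb unfolding e block_L_entry[OF last_row(2) k(2)] unfolding k(1) sz col_eq(1,2)[OF k(2)]
      by (auto simp: True split: nat.splits)
  next
    case False
    then have 1: "block_size n j = 1" using size_cases[of j] by auto
    show ?thesis
      using sb unfolding e block_L_entry[OF last_row(2) k(2)] unfolding k(1) sz col_eq(1,2)[OF k(2)]
      by (auto simp: 1 split: nat.splits)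
  qed
qed

lemma block_U_last:
  "block_U n u (last_row j) k = of_bool (k = n (Suc j)) + of_bool (k = n j) * u j"
proof -
  obtain j' r' where k: "k = n j' + r'" "n j' + r' < n (Suc j')" by (rule position[of k])
  have sz: "n (Suc j) = Suc (Suc (n j)) \<longleftrightarrow> block_size n j = 2" using size_cases[of j] by auto
  note sb = size_bounds[OF k(2)]
  have one: "of_bool (k = Suc (n j)) = of_bool (j' = j \<and> r' = 1)" if "block_size n j = 2"
    using col_eq(3)[OF k(2), of j] that unfolding k(1) sz by simp
  have e: "block_U n u (last_row j) k = block_U n u (n j + (block_size n j - 1)) (n j' + r')"
    by (simp add: last_row(1) k(1))
  show ?thesis
  proof (cases "block_size n j = 2")
    case True
    show ?thesis
      using sb unfolding e block_U_entry[OF last_row(2) k(2)] unfolding k(1) sz col_eq(1,2)[OF k(2)]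
      by (auto simp: True split: nat.splits)
  next
    case False
    then have 1: "block_size n j = 1" using size_cases[of j] by auto
    show ?thesis
      using sb unfolding e block_U_entry[OF last_row(2) k(2)] unfolding k(1) sz col_eq(1,2)[OF k(2)]
      by (auto simp: 1 split: nat.splits)
  qed
qed

definition block_J :: "(nat \<Rightarrow> real poly) \<Rightarrow> (nat \<Rightarrow> real) \<Rightarrow> inf_matrix" where
  "block_J p c = block_matrix n (\<lambda>j j'.
     if j' = j then
       (if block_size n j = 1 then mat_of_rows_list 1 [[- coeff (p j) 0]]
        else mat_of_rows_list 2 [[0, 1], [- coeff (p j) 0, - coeff (p j) 1]])
     else if j' = Suc j then lower_left_mat (block_size n j) (block_size n j') 1
     else if j = Suc j' then lower_left_mat (block_size n j) (block_size n j') (c j')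
     else 0\<^sub>m (block_size n j) (block_size n j'))"

lemma block_J_entry:
  assumes "n j + r < n (Suc j)" "n j' + r' < n (Suc j')"
  shows "block_J p c (n j + r) (n j' + r') =
    (if j' = j then (if r = block_size n j - 1 then - coeff (p j) r' else of_bool (r' = 1))
     else if j' = Suc j then of_bool (r = block_size n j - 1 \<and> r' = 0)
     else of_bool (j = Suc j' \<and> r = block_size n j - 1 \<and> r' = 0) * c j')"
proof -
  note sb = size_bounds[OF assms(1)] size_bounds[OF assms(2)]
  show ?thesis
  proof (cases "j' = j")
    case True
    then show ?thesis
      using sb unfolding block_J_def block_matrix_entry[OF assms]
      by (elim disjE) (auto simp: mat_of_rows_list_entries mat_of_rows_list_entries(1)[unfolded One_nat_def] less_2_cases_iff)
  next
    case False
    then show ?thesis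
      unfolding block_J_def block_matrix_entry[OF assms]
      by (simp only: if_False if_distrib[of "\<lambda>M. M $$ _"] corner_mat_entries[OF sb(2) sb(4)]) auto
  qed
qed

lemma block_first_row:
  assumes two: "n (Suc j) = Suc (Suc (n j))"
  shows block_L_first: "block_L n e l (n j) k = of_bool (k = n j)"
    and block_U_first: "block_U n u (n j) k = of_bool (k = Suc (n j))"
    and block_J_first: "block_J p c (n j) k = of_bool (k = Suc (n j))"
proof -
  obtain j' r' where k: "k = n j' + r'" "n j' + r' < n (Suc j')" by (rule position[of k])
  have sz: "block_size n j = 2" and j: "n j + 0 < n (Suc j)" using two by (simp_all add: block_size_def)
  show "block_L n e l (n j) k = of_bool (k = n j)" "block_U n u (n j) k = of_bool (k = Suc (n j))"
    "block_J p c (n j) k = of_bool (k = Suc (n j))"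
    using block_L_entry[OF j k(2)] block_U_entry[OF j k(2)] block_J_entry[OF j k(2)] col_eq(1,3)[OF k(2), of j] two
    unfolding k(1) sz by auto
qed

lemma block_J_last:
  "block_J p c (last_row j) k = of_bool (k = n (Suc j)) - of_bool (k = n j) * coeff (p j) 0
     - (if n (Suc j) = Suc (Suc (n j)) then of_bool (k = Suc (n j)) * coeff (p j) 1 else 0)
     + (case j of 0 \<Rightarrow> 0 | Suc i \<Rightarrow> of_bool (k = n i) * c i)"
proof -
  obtain j' r' where k: "k = n j' + r'" "n j' + r' < n (Suc j')" by (rule position[of k])
  have sz: "n (Suc j) = Suc (Suc (n j)) \<longleftrightarrow> block_size n j = 2" using size_cases[of j] by auto
  note sb = size_bounds[OF k(2)]
  have e: "block_J p c (last_row j) k = block_J p c (n j + (block_size n j - 1)) (n j' + r')"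
    by (simp add: last_row(1) k(1))
  show ?thesis
  proof (cases "block_size n j = 2")
    case True
    then have two: "n (Suc j) = Suc (Suc (n j))" by (simp add: sz)
    consider "j' = j" "r' = 0" | "j' = j" "r' = 1" | "j' \<noteq> j"
      using sb(2) True less_2_cases[of r'] by fastforce
    then show ?thesis
      using sb unfolding e block_J_entry[OF last_row(2) k(2)] unfolding k(1) sz col_eq(1,2)[OF k(2)]
        col_eq(3)[OF k(2) two]
      by cases (auto simp: True split: nat.splits)
  next
    case False
    then have 1: "block_size n j = 1" using size_cases[of j] by auto
    have "r' = 0" if "j' = j" using sb(2) 1 that by simp
    then show ?thesis
      using sb(1) unfolding e block_J_entry[OF last_row(2) k(2)] unfolding k(1) sz col_eq(1,2)[OF k(2)]
      by (auto simp: 1 split: nat.splits)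
  qed
qed

lemma inf_mult_sum:
  assumes "finite S" "\<And>m. m \<notin> S \<Longrightarrow> A i m = 0"
  shows "inf_mult A B i k = (\<Sum>m\<in>S. A i m * B m k)"
  unfolding inf_mult_def by (rule sum.mono_neutral_left) (use assms in auto)

lemma sum_of_bool_row:
  fixes f :: "nat \<Rightarrow> real"
  assumes "a \<le> K" shows "(\<Sum>m\<le>K. of_bool (m = a) * f m) = f a" "(\<Sum>m\<le>K. of_bool (m = a) * x * f m) = x * f a"
  using assms by (simp_all add: of_bool_def if_distrib if_distribR sum.delta cong: if_cong)

lemma row_bounds: "n j \<le> n (Suc j)" "last_row j \<le> n (Suc j)" "last_row j \<le> n (Suc (Suc j))" "last_row j < n (Suc j)"
  "Suc (last_row j) = n (Suc j)" "n j \<le> n (Suc (Suc j))"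
  using n_less[of j] n_less[of "Suc j"] by (auto simp: last_row_def)

text \<open>In the first row of a long block \<open>L\<close> acts as the identity and
  \<open>U\<close> already agrees with the tridiagonal matrix, so all conditions come from the last
  rows of the blocks.\<close>

lemma block_LU_mult:
  assumes "coeff (p 0) 0 = - u 0"
    and "\<And>j. coeff (p (Suc j)) 0 = - u (Suc j) - l (Suc j)"
    and "\<And>j. n (Suc j) = Suc (Suc (n j)) \<Longrightarrow> coeff (p j) 1 = - e j"
    and "\<And>j. c j = l (Suc j) * u j"
  shows "inf_mult (block_L n e l) (block_U n u) = block_J p c"
proof (intro ext)
  fix i k
  show "inf_mult (block_L n e l) (block_U n u) i k = block_J p c i k"
  proof (rule block_cases[of i])
    fix j assume j: "i = n j" "n (Suc j) = Suc (Suc (n j))"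
    show ?thesis
      by (subst inf_mult_sum[where S = "{..n j}"])
         (auto simp: j(1) block_L_first[OF j(2)] block_U_first[OF j(2)] block_J_first[OF j(2)] sum_of_bool_row)
  next
    fix j assume "Suc i = n (Suc j)"
    then have i: "i = last_row j" by (simp add: last_row_def)
    have "inf_mult (block_L n e l) (block_U n u) i k = block_U n u (last_row j) k
        + (if n (Suc j) = Suc (Suc (n j)) then e j * block_U n u (n j) k else 0)
        + (case j of 0 \<Rightarrow> 0 | Suc m \<Rightarrow> l j * block_U n u (last_row m) k)"
      unfolding i
    proof (subst inf_mult_sum[where S = "{..n (Suc j)}"])
      show "block_L n e l (last_row j) m = 0" if "m \<notin> {..n (Suc j)}" for m
        unfolding block_L_last using that row_bounds[of j] row_bounds(3)[of "j - 1"]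
        by (auto split: nat.split)
      have "last_row m \<le> n (Suc j)" if "j = Suc m" for m using row_bounds(3)[of m] that by simp
      then show "(\<Sum>m\<le>n (Suc j). block_L n e l (last_row j) m * block_U n u m k)
        = block_U n u (last_row j) k
        + (if n (Suc j) = Suc (Suc (n j)) then e j * block_U n u (n j) k else 0)
        + (case j of 0 \<Rightarrow> 0 | Suc m \<Rightarrow> l j * block_U n u (last_row m) k)"
        using row_bounds(1,2)[of j]
        by (cases j) (auto simp: block_L_last sum.distrib distrib_right sum_of_bool_row)
    qed simp
    also have "\<dots> = block_J p c i k"
    proof -
      have e: "(if n (Suc j) = Suc (Suc (n j)) then e j * block_U n u (n j) k else 0)
          = - (if n (Suc j) = Suc (Suc (n j)) then of_bool (k = Suc (n j)) * coeff (p j) 1 else 0)"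
        using block_U_first[of j u k] assms(3)[of j] by simp
      show ?thesis
        unfolding i block_J_last block_U_last e
        by (cases j) (simp_all add: assms(1,2,4) row_bounds algebra_simps)
    qed
    finally show ?thesis .
  qed
qed

definition tridiag :: "(nat \<Rightarrow> real) \<Rightarrow> (nat \<Rightarrow> real) \<Rightarrow> inf_matrix" where
  "tridiag b c = (\<lambda>i k. if k = i then b i else if k = Suc i then 1 else if i = Suc k then c k else 0)"

text \<open>The last row of a block of \<open>U\<close> reaches the first row of the next block of
  \<open>L\<close>, which contains \<open>l\<close> only if that block has size 1. This is the
  origin of the \<open>if\<close> terms.\<close>

lemma block_UL_mult:
  assumes first: "\<And>j. n (Suc j) = Suc (Suc (n j)) \<Longrightarrow> e j = b (n j)"
    and first_l: "\<And>j. n (Suc (Suc j)) = Suc (Suc (n (Suc j))) \<Longrightarrow> l (Suc j) = c (last_row j)"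
    and short: "\<And>j. n (Suc j) = Suc (n j) \<Longrightarrow>
        b (n j) = (if n (Suc (Suc j)) = Suc (n (Suc j)) then l (Suc j) else 0) + u j"
    and short_l: "\<And>j. n (Suc (Suc j)) = Suc (n (Suc j)) \<Longrightarrow> c (last_row j) = u (Suc j) * l (Suc j)"
    and long: "\<And>j. n (Suc j) = Suc (Suc (n j)) \<Longrightarrow>
        b (Suc (n j)) = (if n (Suc (Suc j)) = Suc (n (Suc j)) then l (Suc j) else 0) \<and> c (n j) = u j"
  shows "inf_mult (block_U n u) (block_L n e l) = tridiag b c"
proof (intro ext)
  fix i k
  have L_first: "block_L n e l (n j) k = (if n (Suc j) = Suc (Suc (n j)) then of_bool (k = n j)
       else of_bool (k = n j) + (case j of 0 \<Rightarrow> 0 | Suc i \<Rightarrow> of_bool (k = last_row i) * l j))" for j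
    using block_L_first[of j e l k] block_L_last[of e l j k] n_gap[of j] by (auto simp: last_row_def)
  have fr: "n (Suc j) = Suc (last_row j)" for j by (simp add: row_bounds)
  show "inf_mult (block_U n u) (block_L n e l) i k = tridiag b c i k"
  proof (rule block_cases[of i])
    fix j assume j: "i = n j" "n (Suc j) = Suc (Suc (n j))"
    then have lr: "Suc (n j) = last_row j" by (simp add: last_row_def)
    have "inf_mult (block_U n u) (block_L n e l) i k = block_L n e l (last_row j) k"
      by (subst inf_mult_sum[where S = "{..last_row j}"])
         (auto simp: j(1) block_U_first[OF j(2)] lr sum_of_bool_row)
    also have "\<dots> = tridiag b c i k"
      unfolding block_L_last tridiag_def j(1)
      using first[OF j(2)] first_l n_less j(2) lr[symmetric] fr
      by (cases j) (auto simp: of_bool_def n_0 split: if_splits)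
    finally show ?thesis .
  next
    fix j assume "Suc i = n (Suc j)"
    then have i: "i = last_row j" by (simp add: last_row_def)
    have "inf_mult (block_U n u) (block_L n e l) i k
        = block_L n e l (n (Suc j)) k + u j * block_L n e l (n j) k"
      unfolding i using row_bounds[of j]
      by (subst inf_mult_sum[where S = "{..n (Suc j)}"])
         (auto simp: block_U_last sum.distrib distrib_right sum_of_bool_row)
    also have "\<dots> = tridiag b c i k"
    proof (cases "n (Suc j) = Suc (n j)")
      case True
      then have lr: "last_row j = n j" by (simp add: last_row_def)
      show ?thesis
        unfolding L_first tridiag_def i
        using short[OF True] short_l True lr n_gap[of "Suc j"]
        by (cases j) (auto simp: of_bool_def fr n_0 split: if_splits)
    next
      case False
      then have two: "n (Suc j) = Suc (Suc (n j))" using n_gap[of j] by simp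
      then have lr: "last_row j = Suc (n j)" by (simp add: last_row_def)
      show ?thesis
        unfolding L_first tridiag_def i
        using long[OF two] two lr n_gap[of "Suc j"]
        by (auto simp: of_bool_def split: if_splits)
    qed
    finally show ?thesis .
  qed
qed

end

section \<open>Orthogonal polynomials of a measure on the interval\<close>

text \<open>The complement of the support is a union of open null sets, and by Lindelof countably
  many of them cover it.\<close>

lemma AE_measure_support:
  fixes \<sigma> :: "real measure"
  assumes "sets \<sigma> = sets borel"
  shows "AE t in \<sigma>. t \<in> measure_support \<sigma>"
proof -
  define F where "F = {V::real set. open V \<and> emeasure \<sigma> V = 0}"
  obtain F' where F': "F' \<subseteq> F" "countable F'" "\<Union>F' = \<Union>F"
    by (rule Lindelof[of F]) (auto simp: F_def)
  have "\<Union>F' \<in> null_sets \<sigma>"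
    using F' by (intro null_sets_UN'[where N = "\<lambda>V. V" and I = F', simplified])
      (auto simp: F_def null_sets_def assms)
  moreover have "{t \<in> space \<sigma>. t \<notin> measure_support \<sigma>} \<subseteq> \<Union>F'"
    unfolding F'(3) by (auto simp: F_def measure_support_def zero_less_iff_neq_zero)
  ultimately show ?thesis by (rule AE_I')
qed

locale interval_supported_measure = finite_measure \<sigma> for \<sigma> :: "real measure" +
  assumes sets_borel: "sets \<sigma> = sets borel"
    and support_subset: "measure_support \<sigma> \<subseteq> {-1..1}"
    and support_infinite: "infinite (measure_support \<sigma>)"
begin

lemma space_UNIV: "space \<sigma> = UNIV"
  using sets_eq_imp_space_eq[OF sets_borel] by simp

lemma AE_interval: "AE t in \<sigma>. t \<in> {-1..1}"
  using AE_measure_support[OF sets_borel] by eventually_elim (use support_subset in auto)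

lemma borel_measurable_iff: "f \<in> borel_measurable \<sigma> \<longleftrightarrow> f \<in> borel_measurable borel"
  by (simp add: measurable_cong_sets[OF sets_borel refl])

lemma integrable_bounded:
  fixes f :: "real \<Rightarrow> 'b::{banach, second_countable_topology}"
  assumes "f \<in> borel_measurable borel" "\<And>t. t \<in> {-1..1} \<Longrightarrow> norm (f t) \<le> B"
  shows "integrable \<sigma> f"
  by (rule integrable_const_bound[where B = B])
     (use AE_interval assms in \<open>auto simp: borel_measurable_iff elim: eventually_mono\<close>)

lemma integrable_continuous:
  fixes f :: "real \<Rightarrow> 'b::{banach, second_countable_topology}"
  assumes "f \<in> borel_measurable borel" "continuous_on {-1..1} f"
  shows "integrable \<sigma> f"
proof -
  have "bounded (f ` {-1..1})"
    by (intro compact_imp_bounded compact_continuous_image assms(2)) simp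
  then obtain B where "\<forall>y\<in>f ` {-1..1}. norm y \<le> B" by (auto simp: bounded_iff)
  then show ?thesis by (intro integrable_bounded[OF assms(1), of B]) auto
qed

lemma poly_measurable [measurable]: "poly (p::real poly) \<in> borel_measurable borel"
  by (intro borel_measurable_continuous_onI continuous_intros)

lemma integrable_poly: "integrable \<sigma> (poly p)"
  by (intro integrable_continuous poly_measurable continuous_intros)

lemma integrable_poly_mult: "integrable \<sigma> (\<lambda>t. poly p t * poly q t)"
proof -
  have "poly (p * q) = (\<lambda>t. poly p t * poly q t)" by (simp add: fun_eq_iff)
  then show ?thesis using integrable_poly[of "p * q"] by simp
qed

definition ip :: "real poly \<Rightarrow> real poly \<Rightarrow> real" where
  "ip p q = (LINT t|\<sigma>. poly p t * poly q t)"

lemma ip_sym: "ip p q = ip q p" by (simp add: ip_def mult.commute)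
lemma ip_add: "ip (p + p') q = ip p q + ip p' q"
  by (simp add: ip_def distrib_right integrable_poly_mult)
lemma ip_diff: "ip (p - p') q = ip p q - ip p' q"
  by (simp add: ip_def left_diff_distrib integrable_poly_mult)
lemma ip_smult: "ip (Polynomial.smult c p) q = c * ip p q"
  by (simp add: ip_def mult.assoc)
lemma ip_add2: "ip q (p + p') = ip q p + ip q p'" by (metis ip_sym ip_add)
lemma ip_diff2: "ip q (p - p') = ip q p - ip q p'" by (metis ip_sym ip_diff)
lemma ip_smult2: "ip q (Polynomial.smult c p) = c * ip q p" by (metis ip_sym ip_smult)
lemma ip_0 [simp]: "ip 0 q = 0" "ip q 0 = 0" by (simp_all add: ip_def)
lemmas ip_linear = ip_add ip_diff ip_smult ip_add2 ip_diff2 ip_smult2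
lemma ip_mult_swap: "ip (r * p) q = ip p (r * q)" by (simp add: ip_def mult_ac)

lemma ip_nonneg: "ip p p \<ge> 0" by (simp add: ip_def)

lemma ip_pos: assumes "p \<noteq> 0" shows "ip p p > 0"
proof (rule ccontr)
  assume "\<not> ip p p > 0"
  then have "ip p p = 0" using ip_nonneg[of p] by simp
  then have "AE t in \<sigma>. poly p t * poly p t = 0"
    unfolding ip_def using integrable_poly_mult[of p p]
    by (subst (asm) integral_nonneg_eq_0_iff_AE) auto
  then have ae: "AE t in \<sigma>. poly p t = 0" by eventually_elim simp
  have "measure_support \<sigma> \<subseteq> {t. poly p t = 0}"
  proof (rule ccontr)
    assume "\<not> ?thesis"
    then obtain t where t: "t \<in> measure_support \<sigma>" "poly p t \<noteq> 0" by auto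
    have "open {t. poly p t \<noteq> 0}"
      by (intro open_Collect_neq continuous_intros)
    then have "emeasure \<sigma> {t. poly p t \<noteq> 0} > 0" using t by (auto simp: measure_support_def)
    moreover have "emeasure \<sigma> {t. poly p t \<noteq> 0} = 0"
    proof (rule AE_iff_measurable[THEN iffD1, OF _ _ ae])
      show "{t. poly p t \<noteq> 0} \<in> sets \<sigma>" unfolding sets_borel
        by (intro borel_open) (intro open_Collect_neq continuous_intros)
    qed (simp add: space_UNIV)
    ultimately show False by simp
  qed
  moreover have "finite {t. poly p t = 0}" using assms by (rule poly_roots_finite)
  ultimately show False using support_infinite finite_subset by auto
qed

text \<open>Multiplication by t is a contraction on [-1, 1]. This and
  \<open>ip_multiplier_bound\<close> give the bounds 1 for the recurrence coefficients.\<close>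

lemma ip_monom_bound: "ip ([:0, 1:] * p) ([:0, 1:] * p) \<le> ip p p"
  unfolding ip_def
proof (rule integral_mono_AE)
  show "AE t in \<sigma>. poly ([:0, 1:] * p) t * poly ([:0, 1:] * p) t \<le> poly p t * poly p t"
    using AE_interval
  proof eventually_elim
    case (elim t)
    then have "t * t \<le> 1" using mult_le_one[of "\<bar>t\<bar>" "\<bar>t\<bar>"] by (simp add: abs_le_iff)
    then have "(t * t) * (poly p t * poly p t) \<le> 1 * (poly p t * poly p t)"
      by (intro mult_right_mono) auto
    then show ?case by (simp add: mult_ac)
  qed
qed (rule integrable_poly_mult)+

lemma ip_multiplier_bound: "\<bar>ip ([:0, 1:] * p) p\<bar> \<le> ip p p"
proof -
  have "\<bar>ip ([:0, 1:] * p) p\<bar> \<le> (LINT t|\<sigma>. \<bar>poly ([:0, 1:] * p) t * poly p t\<bar>)"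
    unfolding ip_def by (rule integral_abs_bound)
  also have "\<dots> \<le> ip p p"
    unfolding ip_def
  proof (rule integral_mono_AE)
    show "AE t in \<sigma>. \<bar>poly ([:0, 1:] * p) t * poly p t\<bar> \<le> poly p t * poly p t"
      using AE_interval
    proof eventually_elim
      case (elim t)
      then have "\<bar>t\<bar> * (\<bar>poly p t\<bar> * \<bar>poly p t\<bar>) \<le> 1 * (\<bar>poly p t\<bar> * \<bar>poly p t\<bar>)"
        by (intro mult_right_mono) auto
      then show ?case by (simp add: abs_mult mult_ac)
    qed
  qed (intro integrable_abs integrable_poly_mult)+
  finally show ?thesis .
qed

text \<open>\<open>A (Suc n)\<close> is the monic orthogonal polynomial of degree \<open>n\<close>.  In the recurrence for \<open>A 2\<close> the
  quotient by \<open>ip (A 0) (A 0) = 0\<close> is harmless, since it multiplies \<open>A 0 = 0\<close>; the coefficient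
  \<open>g 0\<close> is the total mass.\<close>

fun A :: "nat \<Rightarrow> real poly" where
  "A 0 = 0"
| "A (Suc 0) = 1"
| "A (Suc (Suc n)) =
     [:- (ip ([:0, 1:] * A (Suc n)) (A (Suc n)) / ip (A (Suc n)) (A (Suc n))), 1:] * A (Suc n)
     - Polynomial.smult (ip (A (Suc n)) (A (Suc n)) / ip (A n) (A n)) (A n)"

definition b :: "nat \<Rightarrow> real" where
  "b n = ip ([:0, 1:] * A (Suc n)) (A (Suc n)) / ip (A (Suc n)) (A (Suc n))"
text \<open>The value 1 at index 0 replaces the squared norm of \<open>A 0 = 0\<close>. It keeps
  \<open>g\<close> positive and makes \<open>h\<close> the product of the numbers
  \<open>g k\<close>.\<close>

definition h :: "nat \<Rightarrow> real" where "h n = (case n of 0 \<Rightarrow> 1 | Suc m \<Rightarrow> ip (A n) (A n))"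
definition g :: "nat \<Rightarrow> real" where "g n = h (Suc n) / h n"

lemma A_rec: "A (Suc (Suc n)) = [:0, 1:] * A (Suc n) - Polynomial.smult (b n) (A (Suc n)) - Polynomial.smult (g n) (A n)"
  by (cases n) (simp_all add: b_def g_def h_def)

declare A.simps(3) [simp del]

lemma degree_A: "degree (A (Suc n)) = n" and lead_coeff_A: "coeff (A (Suc n)) n = 1"
proof -
  have "degree (A (Suc n)) = n \<and> coeff (A (Suc n)) n = 1"
  proof (induction n rule: less_induct)
    case (less n)
    show ?case
    proof (cases n)
      case (Suc m)
      have Am: "degree (A (Suc m)) = m" "coeff (A (Suc m)) m = 1" using less[of m] Suc by auto
      have dm: "degree (A m) \<le> m" "coeff (A m) (Suc m) = 0"
        using less[of "m - 1"] Suc by (cases m; auto simp: coeff_eq_0)+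
      have c: "coeff (A (Suc (Suc m))) (Suc m) = 1"
        using Am dm by (simp add: A_rec coeff_eq_0)
      have "degree (A (Suc (Suc m))) \<le> Suc m"
        unfolding A_rec using Am dm
        by (intro degree_diff_le order.trans[OF degree_smult_le] order.trans[OF degree_mult_le]) auto
      moreover have "degree (A (Suc (Suc m))) \<ge> Suc m" using c by (intro le_degree) simp
      ultimately show ?thesis using c Suc by simp
    qed simp
  qed
  then show "degree (A (Suc n)) = n" "coeff (A (Suc n)) n = 1" by auto
qed

lemma A_nz: "A (Suc n) \<noteq> 0" using lead_coeff_A[of n] by auto
lemma h_pos: "h n > 0" by (cases n) (auto simp: h_def ip_pos A_nz)
lemma h_0: "h 0 = 1" by (simp add: h_def)
lemma g_pos: "g n > 0" by (simp add: g_def h_pos)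
lemma h_Suc: "h (Suc n) = ip (A (Suc n)) (A (Suc n))" by (simp add: h_def)
lemma h_prod: "(\<Prod>k<n. g k) = h n"
  by (induction n) (use h_pos in \<open>auto simp: h_0 g_def less_imp_neq[symmetric]\<close>)

lemma degree_reduce:
  fixes q :: "real poly"
  assumes "degree q \<le> Suc n" shows "degree (q - Polynomial.smult (coeff q (Suc n)) (A (Suc (Suc n)))) \<le> n"
proof (rule degree_le, intro allI impI)
  fix i assume "n < i"
  then consider "i = Suc n" | "i > Suc n" by linarith
  then show "coeff (q - Polynomial.smult (coeff q (Suc n)) (A (Suc (Suc n)))) i = 0"
    using assms degree_A[of "Suc n"] lead_coeff_A[of "Suc n"] by cases (auto simp: coeff_eq_0)
qed

lemma monic_X_A: "degree ([:0, 1:] * A (Suc n) - A (Suc (Suc n))) \<le> n"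
proof -
  have "degree ([:0, 1:] * A (Suc n)) = Suc n" using A_nz degree_A[of n] by (simp add: degree_pCons_eq_if)
  then show ?thesis using degree_reduce[of "[:0, 1:] * A (Suc n)" n] lead_coeff_A[of n] by simp
qed

text \<open>Induction along the recurrence. Splitting off the two leading parts of \<open>q\<close>
  leaves a remainder that stays of low degree after multiplication by t, which can be moved across
  the inner product. Against the two leading parts orthogonality holds by the choice of
  \<open>b\<close> and of \<open>g\<close>.\<close>

lemma A_orthogonal: "degree q < n \<Longrightarrow> ip (A (Suc n)) q = 0"
proof (induction n arbitrary: q rule: less_induct)
  case (less n)
  show ?case
  proof (cases n)
    case (Suc m)
    have IH: "ip (A (Suc m)) q = 0" if "degree q < m" for q using less.IH[of m q] that Suc by simp
    have top: "ip (A (Suc (Suc m))) (A (Suc m)) = 0"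
    proof -
      have 0: "ip (A m) (A (Suc m)) = 0"
      proof (cases m)
        case (Suc i)
        then have "ip (A (Suc m)) (A m) = 0" by (intro IH) (simp add: degree_A)
        then show ?thesis by (simp only: ip_sym[of "A m" "A (Suc m)"])
      qed simp
      have "b m * ip (A (Suc m)) (A (Suc m)) = ip ([:0, 1:] * A (Suc m)) (A (Suc m))"
        using ip_pos[OF A_nz[of m]] by (simp add: b_def del: mult_pCons_left)
      then show ?thesis by (simp only: A_rec[of m] ip_diff ip_smult 0 mult_zero_right diff_self)
    qed
    show ?thesis
    proof (cases m)
      case 0
      then have "q = Polynomial.smult (coeff q 0) 1" using less.prems Suc
        by (auto elim: degree_eq_zeroE)
      moreover have "ip (A (Suc (Suc 0))) 1 = 0" using top by (simp add: 0)
      ultimately show ?thesis using ip_smult2 unfolding Suc 0 by (metis mult_zero_right)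
    next
      case (Suc k)
      have dq: "degree q \<le> Suc k" using less.prems Suc \<open>n = Suc m\<close> by simp
      define r where "r = q - Polynomial.smult (coeff q (Suc k)) (A (Suc (Suc k)))"
      have r: "degree r \<le> k" unfolding r_def by (rule degree_reduce[OF dq])
      define r' where "r' = r - Polynomial.smult (coeff r k) (A (Suc k))"
      have r': "r' = 0 \<or> degree r' < k"
      proof (cases k)
        case 0
        then show ?thesis using r by (auto simp: r'_def elim!: degree_eq_zeroE)
      next
        case (Suc i) then show ?thesis using degree_reduce[of r i] r by (auto simp: r'_def)
      qed
      have q: "q = Polynomial.smult (coeff q (Suc k)) (A (Suc (Suc k))) + (Polynomial.smult (coeff r k) (A (Suc k)) + r')"
        by (simp add: r_def r'_def)
      have second: "ip (A (Suc (Suc m))) (A (Suc k)) = 0"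
      proof -
        have "ip (A (Suc m)) ([:0, 1:] * A (Suc k) - A (Suc (Suc k))) = 0"
          using monic_X_A[of k] Suc by (intro IH) simp
        then have e: "ip ([:0, 1:] * A (Suc m)) (A (Suc k)) = ip (A (Suc m)) (A (Suc m))"
          using Suc by (simp add: ip_mult_swap ip_diff2 del: mult_pCons_left)
        have "ip (A (Suc m)) (A (Suc k)) = 0" using Suc by (intro IH) (simp add: degree_A)
        moreover have "g m * ip (A m) (A m) = ip (A (Suc m)) (A (Suc m))"
          using ip_pos[OF A_nz[of k]] by (simp add: g_def h_def Suc)
        ultimately show ?thesis unfolding A_rec[of m] ip_diff ip_smult e using Suc by simp
      qed
      have third: "ip (A (Suc (Suc m))) r' = 0"
      proof (cases "r' = 0")
        case False
        then have d: "degree r' < k" using r' by simp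
        then have "degree ([:0, 1:] * r') < m" using Suc by (simp add: degree_pCons_eq_if)
        then have "ip (A (Suc m)) ([:0, 1:] * r') = 0" "ip (A (Suc m)) r' = 0" "ip (A m) r' = 0"
          using IH less.IH[of k r'] d Suc \<open>n = Suc m\<close> by (auto simp del: mult_pCons_left)
        then show ?thesis by (simp add: A_rec[of m] ip_linear ip_mult_swap del: mult_pCons_left)
      qed simp
      have "ip (A (Suc (Suc m))) q = 0"
        apply (subst q)
        unfolding ip_add2 ip_smult2 using top second third Suc by simp
      then show ?thesis using \<open>n = Suc m\<close> by simp
    qed
  qed (use less.prems in simp)
qed

lemma A_orthogonal_iff:
  assumes "degree q \<le> n" "\<And>r. degree r < n \<Longrightarrow> ip q r = 0"
  shows "q = Polynomial.smult (coeff q n) (A (Suc n))"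
proof -
  define r where "r = q - Polynomial.smult (coeff q n) (A (Suc n))"
  have "r = 0"
  proof (cases n)
    case 0 then show ?thesis using assms by (auto simp: r_def elim!: degree_eq_zeroE)
  next
    case (Suc m)
    have d: "degree r < n" using degree_reduce[of q m] assms Suc by (simp add: r_def)
    have "ip r r = ip q r - coeff q n * ip (A (Suc n)) r" by (subst (1) r_def) (simp add: ip_linear)
    then have "ip r r = 0" using assms(2)[OF d] A_orthogonal[OF d] by simp
    then show ?thesis using ip_pos[of r] by force
  qed
  then show ?thesis by (simp add: r_def)
qed

lemma ortho_poly_eq: "ortho_poly \<sigma> n = A (Suc n)"
  unfolding ortho_poly_def
proof (rule the_equality)
  show "degree (A (Suc n)) = n \<and> lead_coeff (A (Suc n)) = 1 \<and>
     (\<forall>q. degree q < n \<longrightarrow> (LINT t|\<sigma>. poly (A (Suc n)) t * poly q t) = 0)"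
    using degree_A lead_coeff_A A_orthogonal by (simp add: ip_def)
next
  fix p assume p: "degree p = n \<and> lead_coeff p = 1 \<and>
     (\<forall>q. degree q < n \<longrightarrow> (LINT t|\<sigma>. poly p t * poly q t) = 0)"
  then show "p = A (Suc n)"
    using A_orthogonal_iff[of p n] by (auto simp: ip_def)
qed

lemma b_bound: "\<bar>b n\<bar> \<le> 1"
  unfolding b_def using ip_multiplier_bound[of "A (Suc n)"] ip_pos[OF A_nz[of n]]
  by (simp add: abs_div_pos[symmetric] del: mult_pCons_left)

text \<open>Pythagoras: t times an orthogonal polynomial is the next one plus a part of lower degree
  orthogonal to it, so the norm cannot grow. The coefficient \<open>g 0\<close> is the total mass
  and has no such bound.\<close>

lemma g_bound: "g (Suc n) \<le> 1"
proof -
  let ?x = "[:0, 1:] * A (Suc n)"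
  define r where "r = ?x - A (Suc (Suc n))"
  have "ip (A (Suc (Suc n))) r = 0"
    using monic_X_A[of n] by (intro A_orthogonal) (simp add: r_def)
  moreover have "?x = A (Suc (Suc n)) + r" by (simp add: r_def)
  ultimately have "ip ?x ?x = ip (A (Suc (Suc n))) (A (Suc (Suc n))) + ip r r"
    by (simp add: ip_linear ip_sym del: mult_pCons_left)
  then have "ip (A (Suc (Suc n))) (A (Suc (Suc n))) \<le> ip (A (Suc n)) (A (Suc n))"
    using ip_nonneg[of r] ip_monom_bound[of "A (Suc n)"] by linarith
  then show ?thesis using ip_pos[OF A_nz[of n]] by (simp add: g_def h_def)
qed

text \<open>Comparing the coefficients of degree \<open>j\<close> in the recurrence fixes
  \<open>b\<close>, and then those of degree \<open>i\<close> fix \<open>c\<close>, so the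
  description has only one solution.\<close>

lemma monic_jacobi_eq:
  "monic_jacobi \<sigma> = (\<lambda>i k. if k = i then b i else if k = Suc i then 1 else if i = Suc k then g (Suc k) else 0)"
  (is "_ = ?J b (\<lambda>k. g (Suc k))")
  unfolding monic_jacobi_def
proof (rule the_equality)
  let ?R = "\<lambda>b c. \<forall>j. [:0, 1:] * ortho_poly \<sigma> j = ortho_poly \<sigma> (Suc j) + Polynomial.smult (b j) (ortho_poly \<sigma> j) +
            (case j of 0 \<Rightarrow> 0 | Suc i \<Rightarrow> Polynomial.smult (c i) (ortho_poly \<sigma> i))"
  have R: "?R b (\<lambda>k. g (Suc k))"
    by (simp add: ortho_poly_eq A_rec split: nat.split del: mult_pCons_left)
  then show "\<exists>b' c. ?R b' c \<and> ?J b (\<lambda>k. g (Suc k)) = ?J b' c"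
    by (intro exI[of _ b] exI[of _ "\<lambda>k. g (Suc k)"] conjI refl)
  fix J assume "\<exists>b c. ?R b c \<and> J = ?J b c"
  then obtain b' c' where R': "?R b' c'" and J: "J = ?J b' c'" by blast
  have eq: "Polynomial.smult (b j) (A (Suc j)) + (case j of 0 \<Rightarrow> 0 | Suc i \<Rightarrow> Polynomial.smult (g (Suc i)) (A (Suc i)))
      = Polynomial.smult (b' j) (A (Suc j)) + (case j of 0 \<Rightarrow> 0 | Suc i \<Rightarrow> Polynomial.smult (c' i) (A (Suc i)))" for j
    using R[rule_format, of j] R'[rule_format, of j] unfolding ortho_poly_eq by (simp only: add.assoc add_left_cancel)
  have b': "b' j = b j" for j
  proof -
    have "coeff (case j of 0 \<Rightarrow> 0 | Suc i \<Rightarrow> Polynomial.smult (k i) (A (Suc i))) j = 0" for k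
      by (auto split: nat.split intro!: coeff_eq_0 simp: degree_A)
    then show ?thesis using arg_cong[OF eq[of j], of "\<lambda>p. coeff p j"] by (simp add: lead_coeff_A)
  qed
  have "c' i = g (Suc i)" for i
    using arg_cong[OF eq[of "Suc i"], of "\<lambda>p. coeff p i"] lead_coeff_A[of i] by (simp add: b')
  then show "J = ?J b (\<lambda>k. g (Suc k))" using J b' by (auto intro!: ext)
qed

end

section \<open>Real polynomials evaluated in a larger field\<close>

lemma poly_of_real_mult:
  "poly (map_poly of_real (p * q)) z = poly (map_poly of_real p) z * poly (map_poly (of_real :: real \<Rightarrow> 'a::real_field) q) z"
proof -
  have "map_poly (of_real :: real \<Rightarrow> 'a) (p * q) = map_poly of_real p * map_poly of_real q"
    by (intro poly_eqI) (simp add: coeff_map_poly coeff_mult)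
  then show ?thesis by simp
qed

lemma poly_of_real_diff:
  "poly (map_poly of_real (p - q)) z = poly (map_poly of_real p) z - poly (map_poly (of_real :: real \<Rightarrow> 'a::real_field) q) z"
proof -
  have "map_poly (of_real :: real \<Rightarrow> 'a) (p - q) = map_poly of_real p - map_poly of_real q"
    by (intro poly_eqI) (simp add: coeff_map_poly)
  then show ?thesis by simp
qed

lemma poly_of_real_add:
  "poly (map_poly of_real (p + q)) z = poly (map_poly of_real p) z + poly (map_poly (of_real :: real \<Rightarrow> 'a::real_field) q) z"
proof -
  have "map_poly (of_real :: real \<Rightarrow> 'a) (p + q) = map_poly of_real p + map_poly of_real q"
    by (intro poly_eqI) (simp add: coeff_map_poly)
  then show ?thesis by simp
qed

lemma poly_of_real_smult:
  "poly (map_poly of_real (Polynomial.smult c q)) z = of_real c * poly (map_poly (of_real :: real \<Rightarrow> 'a::real_field) q) z"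
proof -
  have "map_poly (of_real :: real \<Rightarrow> 'a) (Polynomial.smult c q) = Polynomial.smult (of_real c) (map_poly of_real q)"
    by (intro poly_eqI) (simp add: coeff_map_poly)
  then show ?thesis by simp
qed

lemma poly_of_real_of_real:
  "poly (map_poly of_real p) (of_real x) = (of_real (poly p x) :: 'a::real_field)"
  by (induction p) (simp_all add: map_poly_pCons)

lemmas poly_of_real_hom = poly_of_real_mult poly_of_real_diff poly_of_real_add poly_of_real_smult

lemma poly_lessThan_sum:
  fixes q :: "'a::comm_ring_1 poly"
  assumes "\<And>k. k \<ge> n \<Longrightarrow> coeff q k = 0"
  shows "poly q t = (\<Sum>k<n. coeff q k * t ^ k)"
  unfolding poly_altdef using assms by (intro sum.mono_neutral_cong) (auto simp: coeff_eq_0 not_less)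

section \<open>Functions of the second kind, the extended moment functional and its Hankel
  determinants\<close>

context interval_supported_measure
begin

definition cA :: "'a::real_field \<Rightarrow> nat \<Rightarrow> 'a" where
  "cA z n = poly (map_poly of_real (A n)) z"

lemma cA_rec: "three_term b g z (cA z)"
  unfolding three_term_def cA_def
  by (simp add: A_rec poly_of_real_hom map_poly_pCons algebra_simps del: mult_pCons_left)

lemma cA_0 [simp]: "cA z 0 = 0" and cA_1 [simp]: "cA z (Suc 0) = 1"
  by (simp_all add: cA_def one_pCons map_poly_pCons)

definition off_interval :: "complex \<Rightarrow> bool" where
  "off_interval z \<longleftrightarrow> z \<notin> complex_of_real ` {-1..1}"

definition stieltjes :: "complex \<Rightarrow> real poly \<Rightarrow> complex" where
  "stieltjes z q = (LINT t|\<sigma>. of_real (poly q t) / (of_real t - z))"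

lemma integrable_stieltjes:
  assumes "off_interval z" shows "integrable \<sigma> (\<lambda>t. of_real (poly q t) / (of_real t - z))"
proof (rule integrable_continuous)
  show "(\<lambda>t. of_real (poly q t) / (of_real t - z)) \<in> borel_measurable borel" by measurable
  show "continuous_on {-1..1} (\<lambda>t. of_real (poly q t) / (of_real t - z))"
    using assms by (intro continuous_intros) (auto simp: off_interval_def)
qed

lemma stieltjes_diff: "off_interval z \<Longrightarrow> stieltjes z (p - q) = stieltjes z p - stieltjes z q"
  by (simp add: stieltjes_def diff_divide_distrib integrable_stieltjes)
lemma stieltjes_smult: "stieltjes z (Polynomial.smult c q) = of_real c * stieltjes z q"
  by (simp add: stieltjes_def flip: times_divide_eq_right)

text \<open>Integrate t / (t - z) = 1 + z / (t - z) against \<open>q\<close>.\<close>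

lemma stieltjes_shift:
  assumes "off_interval z"
  shows "stieltjes z ([:0, 1:] * q) = z * stieltjes z q + of_real (LINT t|\<sigma>. poly q t)"
proof -
  have "z * stieltjes z q + of_real (LINT t|\<sigma>. poly q t)
      = (LINT t|\<sigma>. z * (of_real (poly q t) / (of_real t - z)) + of_real (poly q t))"
    unfolding stieltjes_def integral_complex_of_real[symmetric] integral_mult_right_zero[symmetric]
    by (intro Bochner_Integration.integral_add[symmetric] integrable_mult_right integrable_stieltjes assms
        integrable_of_real integrable_poly)
  also have "\<dots> = stieltjes z ([:0, 1:] * q)"
    unfolding stieltjes_def
  proof (rule integral_cong_AE)
    show "AE t in \<sigma>. z * (of_real (poly q t) / (of_real t - z)) + of_real (poly q t)
       = of_real (poly ([:0, 1:] * q) t) / (of_real t - z)"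
      using AE_interval
    proof eventually_elim
      case (elim t)
      then have "of_real t - z \<noteq> 0" using assms by (auto simp: off_interval_def)
      then show ?case by (simp add: field_simps)
    qed
  qed (simp_all add: borel_measurable_iff)
  finally show ?thesis by simp
qed

text \<open>The functions of the second kind, again shifted by one; the value \<open>-1\<close> at index \<open>0\<close> absorbs the
  total mass \<open>g 0\<close> into the recurrence.\<close>

definition B :: "complex \<Rightarrow> nat \<Rightarrow> complex" where
  "B z n = (if n = 0 then -1 else stieltjes z (A n))"

lemma B_0 [simp]: "B z 0 = -1" by (simp add: B_def)

lemma integral_A: "(LINT t|\<sigma>. poly (A (Suc n)) t) = (if n = 0 then g 0 else 0)"
proof -
  have "(LINT t|\<sigma>. poly (A (Suc n)) t) = ip (A (Suc n)) 1" by (simp add: ip_def)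
  also have "\<dots> = (if n = 0 then g 0 else 0)"
    using A_orthogonal[of 1 n] by (auto simp: g_def h_def)
  finally show ?thesis .
qed

lemma stieltjes_0 [simp]: "stieltjes z 0 = 0" by (simp add: stieltjes_def)

lemma B_rec: "off_interval z \<Longrightarrow> three_term b g z (B z)"
  unfolding three_term_def
proof
  fix n assume z: "off_interval z"
  have "stieltjes z (A (Suc (Suc n))) = z * stieltjes z (A (Suc n)) + of_real (if n = 0 then g 0 else 0)
     - of_real (b n) * stieltjes z (A (Suc n)) - of_real (g n) * stieltjes z (A n)"
    using z by (simp only: A_rec stieltjes_diff stieltjes_smult stieltjes_shift integral_A)
  then show "B z (Suc (Suc n)) = (z - of_real (b n)) * B z (Suc n) - of_real (g n) * B z n"
    by (cases n) (simp_all add: B_def algebra_simps)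
qed

text \<open>The linear functional on polynomials with moments \<open>s\<close>, \<open>moment \<sigma> 0\<close>, \<open>moment \<sigma> 1\<close>, \<open>\<dots>\<close>.\<close>

definition shifted_mean :: "real \<Rightarrow> real poly \<Rightarrow> real" where
  "shifted_mean s q = s * coeff q 0 + (LINT t|\<sigma>. poly (poly_shift 1 q) t)"

lemma shifted_mean_diff: "shifted_mean s (p - q) = shifted_mean s p - shifted_mean s q"
proof -
  have "poly_shift (Suc 0) (p - q) = poly_shift (Suc 0) p - poly_shift (Suc 0) q"
    by (intro poly_eqI) (simp add: coeff_poly_shift)
  then show ?thesis by (simp add: shifted_mean_def integrable_poly right_diff_distrib)
qed

lemma shifted_mean_smult: "shifted_mean s (Polynomial.smult c q) = c * shifted_mean s q"
proof -
  have "poly_shift 1 (Polynomial.smult c q) = Polynomial.smult c (poly_shift 1 q)" by (intro poly_eqI) (simp add: coeff_poly_shift)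
  then show ?thesis by (simp add: shifted_mean_def algebra_simps)
qed

lemma shifted_mean_shift: "shifted_mean s (pCons 0 q) = (LINT t|\<sigma>. poly q t)"
proof -
  have "poly_shift 1 (pCons 0 q) = q" by (intro poly_eqI) (simp add: coeff_poly_shift)
  then show ?thesis by (simp add: shifted_mean_def)
qed

text \<open>This is the sequence \<open>x\<close> of the locale \<open>darboux\<close>. Defining it
  through the functional gives both the recurrence and the link to Hankel determinants;
  \<open>P_hat_eq\<close> connects it with \<open>P_hat\<close>.\<close>

definition \<xi> :: "real \<Rightarrow> nat \<Rightarrow> real" where
  "\<xi> s n = (if n = 0 then -1 else shifted_mean s (A n))"

lemma \<xi>_0 [simp]: "\<xi> s 0 = -1" by (simp add: \<xi>_def)

lemma shifted_mean_0 [simp]: "shifted_mean s 0 = 0" using shifted_mean_smult[of s 0 0] by simp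
lemma \<xi>_1: "\<xi> s (Suc 0) = s"
proof -
  have "poly_shift 1 (1::real poly) = 0" by (intro poly_eqI) (simp add: coeff_poly_shift)
  then show ?thesis by (simp add: \<xi>_def shifted_mean_def)
qed

lemma \<xi>_rec: "three_term b g 0 (\<xi> s)"
  unfolding three_term_def
proof
  fix n
  have "[:0, 1:] * A (Suc n) = pCons 0 (A (Suc n))" by simp
  then have "shifted_mean s (A (Suc (Suc n))) = (if n = 0 then g 0 else 0)
     - b n * shifted_mean s (A (Suc n)) - g n * shifted_mean s (A n)"
    by (simp only: A_rec shifted_mean_diff shifted_mean_smult shifted_mean_shift integral_A)
  then show "\<xi> s (Suc (Suc n)) = (0 - of_real (b n)) * \<xi> s (Suc n) - of_real (g n) * \<xi> s n"
    by (cases n) (simp_all add: \<xi>_def)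
qed

text \<open>At the point 0 the divided difference in t is the polynomial with its constant term
  removed and one factor t cancelled. At t = 0 the derivative gives the same value.\<close>

lemma P_hat_eq: "P_hat \<sigma> s n 0 = \<xi> s (Suc n)"
proof -
  have "divided_difference (A (Suc n)) 0 t = poly (poly_shift 1 (A (Suc n))) t" for t
  proof -
    obtain c q where q: "A (Suc n) = pCons c q" by (cases "A (Suc n)")
    have "poly_shift 1 (pCons c q) = q" by (intro poly_eqI) (simp add: coeff_poly_shift)
    then show ?thesis by (simp add: divided_difference_def q pderiv_pCons)
  qed
  then show ?thesis
    by (simp add: P_hat_def second_kind_def ortho_poly_eq \<xi>_def shifted_mean_def poly_0_coeff_0)
qed

lemma integral_poly_sum:
  assumes "\<And>k. k \<ge> n \<Longrightarrow> coeff q k = 0"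
  shows "(LINT t|\<sigma>. poly q t * poly r t) = (\<Sum>k<n. coeff q k * (LINT t|\<sigma>. t ^ k * poly r t))"
proof -
  have i: "integrable \<sigma> (\<lambda>t. t ^ k * poly r t)" for k
    using integrable_poly_mult[of "monom 1 k" r] by (simp add: poly_monom)
  have "(LINT t|\<sigma>. poly q t * poly r t) = (LINT t|\<sigma>. (\<Sum>k<n. coeff q k * (t ^ k * poly r t)))"
    by (simp add: poly_lessThan_sum[OF assms] sum_distrib_right mult.assoc)
  also have "\<dots> = (\<Sum>k<n. coeff q k * (LINT t|\<sigma>. t ^ k * poly r t))"
    using i by (subst Bochner_Integration.integral_sum) auto
  finally show ?thesis .
qed

lemma shifted_mean_monom_mult:
  assumes q: "\<And>k. k \<ge> n \<Longrightarrow> coeff q k = 0"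
  shows "shifted_mean s (monom 1 i * q) = (\<Sum>k<n. coeff q k * extended_moments \<sigma> s (i + k))"
proof (cases i)
  case 0
  have "(LINT t|\<sigma>. poly (poly_shift 1 q) t) = (\<Sum>k<n. coeff q (Suc k) * moment \<sigma> k)"
    using integral_poly_sum[of n "poly_shift 1 q" 1] q by (simp add: coeff_poly_shift moment_def)
  also have "\<dots> = (\<Sum>k<n. coeff q (Suc k) * extended_moments \<sigma> s (Suc k))"
    by (simp add: extended_moments_def)
  finally have "shifted_mean s q = (\<Sum>k<Suc n. coeff q k * extended_moments \<sigma> s k)"
    unfolding shifted_mean_def sum.lessThan_Suc_shift by (simp add: extended_moments_def)
  then show ?thesis using q[of n] by (simp add: 0 monom_0)
next
  case (Suc j)
  have "monom 1 i * q = pCons 0 (monom 1 j * q)" by (simp add: Suc monom_Suc)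
  then have "shifted_mean s (monom 1 i * q) = (LINT t|\<sigma>. poly q t * poly (monom 1 j) t)"
    by (simp add: shifted_mean_shift mult.commute)
  then show ?thesis
    using q by (subst (asm) integral_poly_sum[of n])
      (simp_all add: poly_monom extended_moments_def Suc moment_def power_add[symmetric] add.commute)
qed

text \<open>A kernel vector is the coefficient vector of a polynomial q of degree at most
  \<open>m\<close> whose products with 1, z, ..., z^m are annihilated by the functional. The rows
  from 1 on say that q is orthogonal to lower degrees, hence a multiple of \<open>A (Suc m)\<close>;
  row 0 then says that \<open>\<xi> s (Suc m)\<close> vanishes.\<close>

lemma det_moments_eq_0_iff:
  "Determinant.det (mat (Suc m) (Suc m) (\<lambda>(i, k). extended_moments \<sigma> s (i + k))) = 0 \<longleftrightarrow> \<xi> s (Suc m) = 0"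
  (is "det ?M = 0 \<longleftrightarrow> _")
proof -
  have C: "?M \<in> carrier_mat (Suc m) (Suc m)" by simp
  have row: "vec_index (?M *\<^sub>v v) i = shifted_mean s (monom 1 i * q)"
    if "i < Suc m" "v \<in> carrier_vec (Suc m)" "\<And>k. k < Suc m \<Longrightarrow> vec_index v k = coeff q k"
       "\<And>k. k \<ge> Suc m \<Longrightarrow> coeff q k = 0" for v q i
    using that by (subst shifted_mean_monom_mult[of "Suc m"])
      (auto simp: scalar_prod_def atLeast0LessThan mult.commute intro!: sum.cong)
  show ?thesis
  proof
    assume x: "\<xi> s (Suc m) = 0"
    define v where "v = vec (Suc m) (coeff (A (Suc m)))"
    have z: "k \<ge> Suc m \<Longrightarrow> coeff (A (Suc m)) k = 0" for k by (simp add: coeff_eq_0 degree_A)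
    have "?M *\<^sub>v v = 0\<^sub>v (Suc m)"
    proof (rule eq_vecI)
      fix i assume i: "i < dim_vec (0\<^sub>v (Suc m) :: real vec)"
      then have "vec_index (?M *\<^sub>v v) i = shifted_mean s (monom 1 i * A (Suc m))"
        using z by (intro row) (auto simp: v_def)
      also have "\<dots> = 0"
      proof (cases i)
        case 0 then show ?thesis using x by (simp add: \<xi>_def monom_0)
      next
        case (Suc j)
        then have "degree (monom (1::real) j) < m" using i by (simp add: degree_monom_eq)
        then have "ip (A (Suc m)) (monom 1 j) = 0" by (rule A_orthogonal)
        then show ?thesis by (simp add: Suc monom_Suc shifted_mean_shift ip_def mult.commute)
      qed
      finally show "vec_index (?M *\<^sub>v v) i = vec_index (0\<^sub>v (Suc m)) i" using i by simp
    qed simp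
    moreover have "v \<noteq> 0\<^sub>v (Suc m)"
    proof
      assume "v = 0\<^sub>v (Suc m)"
      then have "vec_index v m = 0" by simp
      then show False by (simp add: v_def lead_coeff_A)
    qed
    ultimately show "det ?M = 0"
      unfolding det_0_iff_vec_prod_zero[OF C] by (intro exI[of _ v]) (simp add: v_def)
  next
    assume "det ?M = 0"
    then obtain v where v: "v \<in> carrier_vec (Suc m)" "v \<noteq> 0\<^sub>v (Suc m)" "?M *\<^sub>v v = 0\<^sub>v (Suc m)"
      unfolding det_0_iff_vec_prod_zero[OF C] by blast
    define q where "q = (\<Sum>k<Suc m. monom (vec_index v k) k)"
    have cq: "coeff q k = (if k < Suc m then vec_index v k else 0)" for k
      by (auto simp: q_def coeff_sum if_distrib sum.delta cong: if_cong)
    have mean: "shifted_mean s (monom 1 i * q) = 0" if "i < Suc m" for i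
      using row[of i v q] that v by (simp add: cq)
    have "q = Polynomial.smult (coeff q m) (A (Suc m))"
    proof (rule A_orthogonal_iff)
      show "degree q \<le> m" by (rule degree_le) (auto simp: cq)
      fix r :: "real poly" assume r: "degree r < m"
      have "ip q r = ip r q" by (rule ip_sym)
      also have "\<dots> = (\<Sum>k<m. coeff r k * (LINT t|\<sigma>. t ^ k * poly q t))"
        using r unfolding ip_def by (intro integral_poly_sum) (simp add: coeff_eq_0)
      also have "\<dots> = (\<Sum>k<m. coeff r k * shifted_mean s (monom 1 (Suc k) * q))"
        by (simp add: monom_Suc shifted_mean_shift poly_monom)
      also have "\<dots> = 0" using mean by simp
      finally show "ip q r = 0" .
    qed
    moreover have "q \<noteq> 0"
    proof
      assume "q = 0"
      then have "vec_index v k = 0" if "k < Suc m" for k using cq[of k] that by simp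
      then have "v = 0\<^sub>v (Suc m)" using v(1) by (intro eq_vecI) auto
      then show False using v(2) by simp
    qed
    ultimately obtain d where d: "q = Polynomial.smult d (A (Suc m))" "d \<noteq> 0" by force
    then have "d * \<xi> s (Suc m) = 0" using mean[of 0] by (simp add: monom_0 \<xi>_def shifted_mean_smult)
    then show "\<xi> s (Suc m) = 0" using d by simp
  qed
qed

lemma normal_indices_eq: "normal_indices (extended_moments \<sigma> s) = {n. n \<ge> 1 \<and> \<xi> s n \<noteq> 0}"
proof (rule Set.set_eqI)
  fix n show "n \<in> normal_indices (extended_moments \<sigma> s) \<longleftrightarrow> n \<in> {n. n \<ge> 1 \<and> \<xi> s n \<noteq> 0}"
    using det_moments_eq_0_iff[of "n - 1" s] by (cases n) (auto simp: normal_indices_def)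
qed

lemma \<xi>_gap: "\<xi> s n \<noteq> 0 \<or> \<xi> s (Suc n) \<noteq> 0"
proof (induction n)
  case (Suc n)
  then show ?case using g_pos[of n] by (auto simp: three_termD[OF \<xi>_rec])
qed simp

lemma darboux: "darboux b g (\<xi> s) (normal_index (extended_moments \<sigma> s))"
proof -
  note E = enumerate_consecutive_gaps[of "\<xi> s", OF _ \<xi>_gap, simplified]
  have "normal_index (extended_moments \<sigma> s) j = enumerate {n. \<xi> s n \<noteq> 0} j" for j
    unfolding normal_index_def normal_indices_eq using E(3)[of j] by simp
  then show ?thesis
    unfolding darboux_def using E(1,2) g_pos \<xi>_rec by simp
qed

end

section \<open>Growth estimates off the interval\<close>

context interval_supported_measure
begin

definition A_ratio :: "'a::real_field \<Rightarrow> nat \<Rightarrow> 'a" where "A_ratio z n = cA z (Suc n) / cA z n"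

lemma A_ratio_1: "A_ratio z (Suc 0) = z - of_real (b 0)"
  using three_termD[OF cA_rec, of z 0] by (simp add: A_ratio_def)

lemma A_ratio_Suc:
  assumes "cA z (Suc n) \<noteq> 0" "cA z (Suc (Suc n)) \<noteq> 0"
  shows "A_ratio z (Suc (Suc n)) = z - of_real (b (Suc n)) - of_real (g (Suc n)) / A_ratio z (Suc n)"
  using assms three_termD[OF cA_rec, of z "Suc n"] by (simp add: A_ratio_def field_simps)

lemma cA_Suc_eq: "cA z n \<noteq> 0 \<Longrightarrow> cA z (Suc n) = A_ratio z n * cA z n"
  by (simp add: A_ratio_def)

lemma Im_A_ratio_Suc:
  assumes "cA z (Suc n) \<noteq> 0" "cA z (Suc (Suc n)) \<noteq> 0"
  shows "Im (A_ratio z (Suc (Suc n))) = Im z + g (Suc n) * (Im (A_ratio z (Suc n)) / (cmod (A_ratio z (Suc n)))\<^sup>2)"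
proof -
  have "of_real (g (Suc n)) / A_ratio z (Suc n) = of_real (g (Suc n)) * (1 / A_ratio z (Suc n))" by simp
  then have "Im (of_real (g (Suc n)) / A_ratio z (Suc n)) = g (Suc n) * Im (1 / A_ratio z (Suc n))"
    by (simp only: times_complex.sel Re_complex_of_real Im_complex_of_real mult_zero_left add_0_right)
  moreover have "Im (1 / A_ratio z (Suc n)) = - Im (A_ratio z (Suc n)) / (cmod (A_ratio z (Suc n)))\<^sup>2"
    by (simp add: Im_divide cmod_power2)
  ultimately show ?thesis by (simp add: A_ratio_Suc[OF assms])
qed

text \<open>The ratios are Herglotz functions that dominate the identity: multiplying by \<open>Im z\<close> treats both
  half-planes at once.\<close>

lemma A_ratio_nonreal:
  assumes "Im z \<noteq> 0"
  shows "cA z (Suc n) \<noteq> 0 \<and> Im (A_ratio z (Suc n)) * Im z \<ge> (Im z)\<^sup>2"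
proof (induction n)
  case 0
  show ?case by (simp add: A_ratio_1 power2_eq_square)
next
  case (Suc n)
  let ?m = "A_ratio z (Suc n)"
  have "(Im z)\<^sup>2 > 0" using assms by simp
  then have mz: "?m \<noteq> 0" using Suc by auto
  then have nz: "cA z (Suc (Suc n)) \<noteq> 0" using Suc by (simp add: cA_Suc_eq)
  have "Im (A_ratio z (Suc (Suc n))) = Im z + g (Suc n) * (Im ?m / (cmod ?m)\<^sup>2)"
    using Suc nz by (intro Im_A_ratio_Suc) auto
  then have "Im (A_ratio z (Suc (Suc n))) * Im z = (Im z)\<^sup>2 + g (Suc n) * (Im ?m * Im z / (cmod ?m)\<^sup>2)"
    by (simp add: power2_eq_square algebra_simps)
  moreover have "Im ?m * Im z \<ge> 0" using Suc order.trans[OF zero_le_power2] by blast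
  then have "g (Suc n) * (Im ?m * Im z / (cmod ?m)\<^sup>2) \<ge> 0" using g_pos[of "Suc n"] by simp
  ultimately show ?case using nz by simp
qed

lemma cA_nonreal: "Im z \<noteq> 0 \<Longrightarrow> cA z (Suc n) \<noteq> 0"
  using A_ratio_nonreal by blast

lemma Im_A_ratio_nonreal:
  assumes "Im z \<noteq> 0" shows "\<bar>Im z\<bar> \<le> \<bar>Im (A_ratio z (Suc n))\<bar>"
proof -
  have "\<bar>Im z\<bar> * \<bar>Im z\<bar> \<le> \<bar>Im (A_ratio z (Suc n))\<bar> * \<bar>Im z\<bar>"
    using A_ratio_nonreal[OF assms, of n] abs_ge_self[of "Im (A_ratio z (Suc n)) * Im z"]
    by (simp add: power2_eq_square abs_mult)
  then show ?thesis by (rule mult_right_le_imp_le) (use assms in simp)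
qed

text \<open>Each ratio is \<open>z - b - g / m\<close> with \<open>m\<close> the previous ratio,
  whose modulus is at least that of \<open>Im z\<close>; the coefficients that occur have modulus at
  most 1.\<close>

lemma norm_A_ratio_nonreal:
  assumes "Im z \<noteq> 0" shows "cmod (A_ratio z (Suc n)) \<le> cmod z + 1 + 1 / \<bar>Im z\<bar>"
proof (cases n)
  case 0
  have "cmod (z - of_real (b 0)) \<le> cmod z + \<bar>b 0\<bar>"
    by (metis norm_of_real norm_triangle_ineq4)
  also have "\<dots> \<le> cmod z + 1 + 1 / \<bar>Im z\<bar>" using b_bound[of 0] by (simp add: add_increasing2)
  finally show ?thesis by (simp add: 0 A_ratio_1)
next
  case (Suc k)
  have "\<bar>Im z\<bar> \<le> cmod (A_ratio z (Suc k))" using Im_A_ratio_nonreal[OF assms, of k] abs_Im_le_cmod order.trans by blast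
  then have "g (Suc k) / cmod (A_ratio z (Suc k)) \<le> 1 / \<bar>Im z\<bar>"
    using assms g_bound[of k] g_pos[of "Suc k"] by (intro frac_le) auto
  moreover have "cmod (z - of_real (b (Suc k)) - of_real (g (Suc k)) / A_ratio z (Suc k))
      \<le> cmod z + \<bar>b (Suc k)\<bar> + g (Suc k) / cmod (A_ratio z (Suc k))"
    using g_pos[of "Suc k"]
    by (intro order.trans[OF norm_triangle_ineq4] add_mono) (auto simp: norm_divide intro: order.trans[OF norm_triangle_ineq4])
  ultimately show ?thesis
    using b_bound[of "Suc k"] by (simp add: Suc A_ratio_Suc cA_nonreal[OF assms])
qed

definition scaled_A :: "complex \<Rightarrow> nat \<Rightarrow> real" where "scaled_A z n = (cmod (cA z n))\<^sup>2 / h n"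

lemma scaled_A_Suc: "cA z (Suc n) \<noteq> 0 \<Longrightarrow> scaled_A z (Suc (Suc n)) * g (Suc n) = scaled_A z (Suc n) * (cmod (A_ratio z (Suc n)))\<^sup>2"
  using h_pos[of "Suc n"] h_pos[of "Suc (Suc n)"]
  by (simp add: scaled_A_def cA_Suc_eq[of z "Suc n"] norm_mult power_mult_distrib g_def field_simps)

lemma scaled_A_pos: "cA z n \<noteq> 0 \<Longrightarrow> scaled_A z n > 0" by (simp add: scaled_A_def h_pos)

text \<open>With \<open>T n = scaled_A z (Suc n) * Im (A_ratio z (Suc n)) * Im z\<close> the Christoffel-Darboux identity reads
  \<open>T (Suc n) = T n + scaled_A z (Suc (Suc n)) * (Im z)\<^sup>2\<close>, and \<open>T\<close> is at most a constant multiple of \<open>scaled_A\<close>.\<close>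

lemma scaled_A_growth_nonreal:
  assumes z: "Im z \<noteq> 0" and D: "cmod z + 1 + 1 / \<bar>Im z\<bar> \<le> D"
  shows "(Im z)\<^sup>2 / h 1 * (1 + \<bar>Im z\<bar> / D) ^ n \<le> scaled_A z (Suc n) * (D * \<bar>Im z\<bar>)"
proof -
  define T where "T n = scaled_A z (Suc n) * (Im (A_ratio z (Suc n)) * Im z)" for n
  have D0: "D > 0" using D by (smt (verit) norm_ge_zero zero_less_divide_1_iff abs_ge_zero divide_nonneg_nonneg)
  have T_le: "T n \<le> scaled_A z (Suc n) * (D * \<bar>Im z\<bar>)" for n
  proof -
    have "Im (A_ratio z (Suc n)) * Im z \<le> \<bar>Im (A_ratio z (Suc n))\<bar> * \<bar>Im z\<bar>" by (metis abs_ge_self abs_mult)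
    also have "\<dots> \<le> D * \<bar>Im z\<bar>"
      using norm_A_ratio_nonreal[OF z, of n] abs_Im_le_cmod[of "A_ratio z (Suc n)"] D by (intro mult_right_mono) auto
    finally show ?thesis unfolding T_def
      using scaled_A_pos[OF cA_nonreal[OF z]] by (intro mult_left_mono) (auto intro: less_imp_le)
  qed
  have T_nonneg: "T n \<ge> 0" for n
  proof -
    have "Im (A_ratio z (Suc n)) * Im z \<ge> 0" using A_ratio_nonreal[OF z, of n] order.trans[OF zero_le_power2] by blast
    then show ?thesis unfolding T_def using scaled_A_pos[OF cA_nonreal[OF z], of n] by simp
  qed
  have T_Suc: "T (Suc n) = T n + scaled_A z (Suc (Suc n)) * (Im z)\<^sup>2" for n
  proof -
    let ?m = "A_ratio z (Suc n)"
    have mz: "?m \<noteq> 0" using Im_A_ratio_nonreal[OF z, of n] z by auto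
    have I: "Im (A_ratio z (Suc (Suc n))) = Im z + g (Suc n) * (Im ?m / (cmod ?m)\<^sup>2)"
      using cA_nonreal[OF z] by (intro Im_A_ratio_Suc)
    have "T (Suc n) = scaled_A z (Suc (Suc n)) * (Im z)\<^sup>2
        + (scaled_A z (Suc (Suc n)) * g (Suc n)) * (Im ?m * Im z) / (cmod ?m)\<^sup>2"
      unfolding T_def I by (simp add: algebra_simps power2_eq_square)
    then show ?thesis
      unfolding scaled_A_Suc[OF cA_nonreal[OF z]] using mz by (simp add: T_def)
  qed
  have "(Im z)\<^sup>2 / h 1 * (1 + \<bar>Im z\<bar> / D) ^ n \<le> T n"
  proof (induction n)
    case 0
    show ?case using h_pos[of 1] by (simp add: T_def scaled_A_def A_ratio_1 power2_eq_square)
  next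
    case (Suc n)
    \<comment> \<open>The increment of \<open>T\<close> is thus at least a fixed multiple of
      \<open>T\<close> itself, which turns additive growth into geometric growth.\<close>
    have "T (Suc n) * (\<bar>Im z\<bar> / D) \<le> scaled_A z (Suc (Suc n)) * (D * \<bar>Im z\<bar>) * (\<bar>Im z\<bar> / D)"
      using T_le[of "Suc n"] D0 by (intro mult_right_mono) auto
    also have "\<dots> = scaled_A z (Suc (Suc n)) * (Im z)\<^sup>2" using D0 by (simp add: power2_eq_square)
    finally have "T n + T (Suc n) * (\<bar>Im z\<bar> / D) \<le> T (Suc n)" by (simp add: T_Suc)
    moreover have "T n \<le> T (Suc n)" using scaled_A_pos[OF cA_nonreal[OF z], of "Suc n"] by (simp add: T_Suc)
    then have "T n * (\<bar>Im z\<bar> / D) \<le> T (Suc n) * (\<bar>Im z\<bar> / D)" using D0 by (intro mult_right_mono) auto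
    ultimately have "T n * (1 + \<bar>Im z\<bar> / D) \<le> T (Suc n)" by (simp add: distrib_left)
    moreover have "(Im z)\<^sup>2 / h 1 * (1 + \<bar>Im z\<bar> / D) ^ n * (1 + \<bar>Im z\<bar> / D) \<le> T n * (1 + \<bar>Im z\<bar> / D)"
      using Suc D0 by (intro mult_right_mono) auto
    ultimately show ?case by (simp add: mult_ac)
  qed
  then show ?thesis using T_le[of n] by linarith
qed

lemma poly_diff_synthetic_div:
  fixes p :: "'a::comm_ring_1 poly"
  shows "poly p t - poly p z = (t - z) * poly (synthetic_div p z) t"
proof -
  have "poly p t = poly ([:- z, 1:] * synthetic_div p z + [:poly p z:]) t"
    by (simp only: synthetic_div_correct')
  then show ?thesis by (simp add: algebra_simps)
qed

text \<open>The test polynomial in \<open>B_mult_cA\<close> is a difference quotient at a complex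
  point, so its coefficients are complex.\<close>

lemma A_orthogonal_complex:
  assumes "\<And>k. k \<ge> n \<Longrightarrow> coeff q k = 0"
  shows "(LINT t|\<sigma>. of_real (poly (A (Suc n)) t) * poly q (complex_of_real t)) = 0"
proof -
  have i: "integrable \<sigma> (\<lambda>t. coeff q k * complex_of_real (poly (A (Suc n)) t * t ^ k))" for k
    using integrable_poly_mult[of "A (Suc n)" "monom 1 k"]
    by (intro integrable_mult_right integrable_of_real) (simp add: poly_monom)
  have "(LINT t|\<sigma>. of_real (poly (A (Suc n)) t) * poly q (complex_of_real t))
      = (LINT t|\<sigma>. (\<Sum>k<n. coeff q k * complex_of_real (poly (A (Suc n)) t * t ^ k)))"
    by (simp add: poly_lessThan_sum[OF assms] sum_distrib_left mult_ac)
  also have "\<dots> = (\<Sum>k<n. coeff q k * complex_of_real (LINT t|\<sigma>. poly (A (Suc n)) t * t ^ k))"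
    using i by (subst Bochner_Integration.integral_sum) (auto simp del: of_real_mult of_real_power)
  also have "\<dots> = 0"
  proof (rule sum.neutral, rule ballI)
    fix k assume "k \<in> {..<n}"
    then have "ip (A (Suc n)) (monom 1 k) = 0" by (intro A_orthogonal) (simp add: degree_monom_eq)
    then show "coeff q k * complex_of_real (LINT t|\<sigma>. poly (A (Suc n)) t * t ^ k) = 0"
      by (simp add: ip_def poly_monom)
  qed
  finally show ?thesis .
qed

text \<open>The quotient (P(t) - P(z)) / (t - z) has smaller degree than P, so P is orthogonal to
  it; expanding that integral gives the identity. Unlike \<open>B\<close> alone, the product is an
  integral of a nonnegative weight and so is bounded by the squared norm of P over the distance to
  the interval.\<close>

lemma B_mult_cA:
  assumes "off_interval z"
  shows "B z (Suc n) * cA z (Suc n)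
    = (LINT t|\<sigma>. of_real ((poly (A (Suc n)) t)\<^sup>2) / (of_real t - z))"
proof -
  define p where "p = map_poly complex_of_real (A (Suc n))"
  define q where "q = synthetic_div p z"
  have "degree p = n" by (simp add: p_def degree_map_poly degree_A)
  then have q: "coeff q k = 0" if "k \<ge> n" for k
    using that synthetic_div_eq_0_iff[of p z] degree_synthetic_div[of p z]
    by (cases "n = 0") (auto simp: q_def intro!: coeff_eq_0)
  have pt: "poly p (of_real t) = of_real (poly (A (Suc n)) t)" for t
    by (simp add: p_def poly_of_real_of_real)
  have nz: "of_real t - z \<noteq> 0" if "t \<in> {-1..1}" for t
    using that assms by (auto simp: off_interval_def)
  have I1: "integrable \<sigma> (\<lambda>t. of_real ((poly (A (Suc n)) t)\<^sup>2) / (of_real t - z))"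
    using integrable_stieltjes[OF assms, of "A (Suc n) * A (Suc n)"] by (simp add: power2_eq_square)
  have "0 = (LINT t|\<sigma>. of_real (poly (A (Suc n)) t) * poly q (complex_of_real t))"
    using A_orthogonal_complex[OF q] by simp
  also have "\<dots> = (LINT t|\<sigma>. of_real ((poly (A (Suc n)) t)\<^sup>2) / (of_real t - z)
      - cA z (Suc n) * (of_real (poly (A (Suc n)) t) / (of_real t - z)))"
  proof (rule integral_cong_AE)
    show "AE t in \<sigma>. of_real (poly (A (Suc n)) t) * poly q (complex_of_real t)
      = of_real ((poly (A (Suc n)) t)\<^sup>2) / (of_real t - z)
      - cA z (Suc n) * (of_real (poly (A (Suc n)) t) / (of_real t - z))"
      using AE_interval
    proof eventually_elim
      case (elim t)
      have "of_real (poly (A (Suc n)) t) - cA z (Suc n) = (of_real t - z) * poly q (of_real t)"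
        using poly_diff_synthetic_div[of p "of_real t" z] by (simp add: pt q_def cA_def p_def[symmetric])
      then have "poly q (of_real t) = (of_real (poly (A (Suc n)) t) - cA z (Suc n)) / (of_real t - z)"
        using nz[OF elim] by simp
      then show ?case by (simp add: diff_divide_distrib right_diff_distrib power2_eq_square mult_ac)
    qed
    have "(\<lambda>t. poly q (complex_of_real t)) \<in> borel_measurable borel"
      by (intro borel_measurable_continuous_onI continuous_intros)
    then show "(\<lambda>t. of_real (poly (A (Suc n)) t) * poly q (complex_of_real t)) \<in> borel_measurable \<sigma>"
      by (simp add: borel_measurable_iff)
  qed (simp add: borel_measurable_iff)
  also have "\<dots> = (LINT t|\<sigma>. of_real ((poly (A (Suc n)) t)\<^sup>2) / (of_real t - z)) - cA z (Suc n) * B z (Suc n)"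
    using I1 integrable_stieltjes[OF assms, of "A (Suc n)"]
    by (subst Bochner_Integration.integral_diff) (auto simp: B_def stieltjes_def simp del: of_real_power times_divide_eq_right)
  finally show ?thesis by (simp add: mult.commute)
qed

lemma norm_B_mult_cA:
  assumes d: "d > 0" "\<And>t. t \<in> {-1..1} \<Longrightarrow> cmod (of_real t - z) \<ge> d"
  shows "cmod (B z (Suc n) * cA z (Suc n)) \<le> h (Suc n) / d"
proof -
  have z: "off_interval z" using d by (force simp: off_interval_def)
  have i2: "integrable \<sigma> (\<lambda>t. (poly (A (Suc n)) t)\<^sup>2)"
    using integrable_poly_mult[of "A (Suc n)" "A (Suc n)"] by (simp add: power2_eq_square)
  have i1: "integrable \<sigma> (\<lambda>t. of_real ((poly (A (Suc n)) t)\<^sup>2) / (of_real t - z))"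
    using integrable_stieltjes[OF z, of "A (Suc n) * A (Suc n)"] by (simp add: power2_eq_square)
  have "cmod (B z (Suc n) * cA z (Suc n)) \<le> (LINT t|\<sigma>. cmod (of_real ((poly (A (Suc n)) t)\<^sup>2) / (of_real t - z)))"
    unfolding B_mult_cA[OF z] by (rule integral_norm_bound)
  also have "\<dots> \<le> (LINT t|\<sigma>. (poly (A (Suc n)) t)\<^sup>2 / d)"
  proof (rule integral_mono_AE)
    show "AE t in \<sigma>. cmod (of_real ((poly (A (Suc n)) t)\<^sup>2) / (of_real t - z)) \<le> (poly (A (Suc n)) t)\<^sup>2 / d"
      using AE_interval
    proof eventually_elim
      case (elim t)
      have "cmod (of_real ((poly (A (Suc n)) t)\<^sup>2) / (of_real t - z)) = (poly (A (Suc n)) t)\<^sup>2 / cmod (of_real t - z)"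
        by (simp add: norm_divide norm_power)
      also have "\<dots> \<le> (poly (A (Suc n)) t)\<^sup>2 / d" using d(2)[OF elim] d(1) by (intro frac_le) auto
      finally show ?case .
    qed
  qed (use i1 i2 in \<open>simp_all add: integrable_norm\<close>)
  also have "\<dots> = h (Suc n) / d" using i2 by (simp add: h_Suc ip_def power2_eq_square)
  finally show ?thesis .
qed

text \<open>Writing B / A as B A / A^2 reduces the decay of the quotient to the growth of
  \<open>scaled_A\<close>.\<close>

lemma norm_B_over_cA:
  assumes "d > 0" "\<And>t. t \<in> {-1..1} \<Longrightarrow> cmod (of_real t - z) \<ge> d" "cA z (Suc n) \<noteq> 0"
  shows "cmod (B z (Suc n) / cA z (Suc n)) \<le> 1 / (d * scaled_A z (Suc n))"
proof -
  have "cmod (B z (Suc n) / cA z (Suc n)) = cmod (B z (Suc n) * cA z (Suc n)) / (cmod (cA z (Suc n)))\<^sup>2"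
    using assms(3) by (simp add: norm_divide norm_mult power2_eq_square)
  also have "\<dots> \<le> h (Suc n) / d / (cmod (cA z (Suc n)))\<^sup>2"
    by (intro divide_right_mono norm_B_mult_cA assms) auto
  finally show ?thesis by (simp add: scaled_A_def)
qed

lemma dist_interval_nonreal: "cmod (of_real t - z) \<ge> \<bar>Im z\<bar>"
  using abs_Im_le_cmod[of "of_real t - z"] by simp

lemma off_interval_nonreal: "Im z \<noteq> 0 \<Longrightarrow> off_interval z"
  by (auto simp: off_interval_def)

text \<open>\<open>D\<close> bounds the ratios of consecutive polynomials on the whole truncated
  region, so the growth rate does not depend on \<open>z\<close>.\<close>

lemma B_over_cA_nonreal:
  assumes "\<delta> > 0" "\<bar>Im z\<bar> \<ge> \<delta>" "cmod z \<le> \<rho>"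
  defines "D \<equiv> \<rho> + 1 + 1 / \<delta>"
  shows "cmod (B z (Suc n) / cA z (Suc n)) \<le> D * h 1 / \<delta>\<^sup>2 * (1 / (1 + \<delta> / D)) ^ n"
proof -
  have z: "Im z \<noteq> 0" using assms by auto
  have "1 / \<bar>Im z\<bar> \<le> 1 / \<delta>" using assms by (intro divide_left_mono) auto
  then have D: "cmod z + 1 + 1 / \<bar>Im z\<bar> \<le> D" using assms by (simp add: D_def)
  have D0: "D > 0" using D by (smt (verit) norm_ge_zero zero_less_divide_1_iff abs_ge_zero divide_nonneg_nonneg)
  have "\<delta>\<^sup>2 / h 1 * (1 + \<delta> / D) ^ n \<le> (Im z)\<^sup>2 / h 1 * (1 + \<bar>Im z\<bar> / D) ^ n"
    using assms(1,2) D0 h_pos[of 1] power_mono[OF assms(2), of 2]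
    by (intro mult_mono power_mono[of "1 + _"] divide_right_mono add_left_mono)
      (auto intro: less_imp_le add_nonneg_nonneg)
  also note scaled_A_growth_nonreal[OF z D]
  finally have w: "\<delta>\<^sup>2 / h 1 * (1 + \<delta> / D) ^ n \<le> D * (\<bar>Im z\<bar> * scaled_A z (Suc n))" by (simp add: mult_ac)
  have p: "\<delta>\<^sup>2 / h 1 * (1 + \<delta> / D) ^ n > 0" using assms(1) D0 h_pos[of 1] by (simp add: add_pos_pos)
  have q: "\<bar>Im z\<bar> * scaled_A z (Suc n) > 0" using z scaled_A_pos[OF cA_nonreal[OF z]] by simp
  have "cmod (B z (Suc n) / cA z (Suc n)) \<le> 1 / (\<bar>Im z\<bar> * scaled_A z (Suc n))"
    using z by (intro norm_B_over_cA dist_interval_nonreal cA_nonreal) auto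
  also have "\<dots> = D / (D * (\<bar>Im z\<bar> * scaled_A z (Suc n)))" using D0 by simp
  also have "\<dots> \<le> D / (\<delta>\<^sup>2 / h 1 * (1 + \<delta> / D) ^ n)"
    by (intro frac_le w p) (use D0 in auto)
  also have "\<dots> = D * h 1 / \<delta>\<^sup>2 * (1 / (1 + \<delta> / D)) ^ n" by (simp add: power_one_over field_simps)
  finally show ?thesis .
qed

text \<open>If a ratio is within 2 of \<open>z\<close>, its modulus is at least 2, so the next one
  differs from \<open>z\<close> by at most 1 + 1. This self-consistency is the origin of the
  threshold 4. The type is general because the ratio is used on the complex plane and, to find
  poles, on the real line.\<close>

lemma A_ratio_large:
  fixes z :: "'a::real_normed_field"
  assumes "norm z \<ge> 4"
  shows "cA z (Suc n) \<noteq> 0 \<and> norm (A_ratio z (Suc n) - z) \<le> 2"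
proof (induction n)
  case 0
  show ?case using b_bound[of 0] by (simp add: A_ratio_1)
next
  case (Suc n)
  have m2: "norm (A_ratio z (Suc n)) \<ge> 2"
    using Suc assms norm_triangle_ineq2[of z "z - A_ratio z (Suc n)"] by (simp add: norm_minus_commute)
  then have nz: "cA z (Suc (Suc n)) \<noteq> 0" using Suc cA_Suc_eq[of z "Suc n"] by auto
  have "g (Suc n) / norm (A_ratio z (Suc n)) \<le> 1 / 1"
    using g_bound[of n] g_pos[of "Suc n"] m2 by (intro frac_le) auto
  moreover have "A_ratio z (Suc (Suc n)) - z = - (of_real (b (Suc n)) + of_real (g (Suc n)) / A_ratio z (Suc n))"
    using A_ratio_Suc[of z n] nz Suc by simp
  then have "norm (A_ratio z (Suc (Suc n)) - z) \<le> \<bar>b (Suc n)\<bar> + g (Suc n) / norm (A_ratio z (Suc n))"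
    using g_pos[of "Suc n"] norm_triangle_ineq[of "of_real (b (Suc n))" "of_real (g (Suc n)) / A_ratio z (Suc n)"]
    by (simp only: norm_minus_cancel) (simp add: norm_divide)
  ultimately show ?case using nz b_bound[of "Suc n"] by simp
qed

lemma norm_A_ratio_large:
  fixes z :: "'a::real_normed_field"
  assumes "norm z \<ge> 4" shows "norm z - 2 \<le> norm (A_ratio z (Suc n))" "norm (A_ratio z (Suc n)) \<le> norm z + 2"
  using A_ratio_large[OF assms, of n] norm_triangle_ineq2[of z "z - A_ratio z (Suc n)"] norm_triangle_ineq2[of "A_ratio z (Suc n)" z]
  by (simp_all add: norm_minus_commute)

lemma off_interval_large: "cmod z > 1 \<Longrightarrow> off_interval z"
  by (force simp: off_interval_def)

lemma dist_interval_large: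
  assumes "t \<in> {-1..1}" shows "cmod (of_real t - z) \<ge> cmod z - 1"
  using assms norm_triangle_ineq2[of z "of_real t"] by (auto simp: norm_minus_commute)

text \<open>Every ratio has modulus at least 2 and every \<open>g (Suc n)\<close> is at most 1, so
  \<open>scaled_A\<close> grows at least by the factor 4 in each step.\<close>

lemma B_over_cA_large:
  assumes z: "cmod z \<ge> 4"
  shows "cmod (B z (Suc n) / cA z (Suc n)) \<le> h 1 * (1 / 4) ^ n"
proof -
  have nz: "cA z (Suc n) \<noteq> 0" for n using A_ratio_large[OF z] by blast
  have w: "scaled_A z (Suc n) \<ge> 4 ^ n / h 1"
  proof (induction n)
    case 0 show ?case by (simp add: scaled_A_def)
  next
    case (Suc n)
    have "2 ^ 2 \<le> (cmod (A_ratio z (Suc n)))\<^sup>2" using norm_A_ratio_large(1)[OF z, of n] z by (intro power_mono) auto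
    then have "scaled_A z (Suc n) * 4 \<le> scaled_A z (Suc n) * (cmod (A_ratio z (Suc n)))\<^sup>2"
      using scaled_A_pos[OF nz] by (intro mult_left_mono) (auto intro: less_imp_le)
    also have "\<dots> = scaled_A z (Suc (Suc n)) * g (Suc n)" using scaled_A_Suc[OF nz] by simp
    also have "\<dots> \<le> scaled_A z (Suc (Suc n))" using scaled_A_pos[OF nz, of "Suc n"] g_bound[of n] by simp
    finally show ?case using Suc by simp
  qed
  have "cmod (B z (Suc n) / cA z (Suc n)) \<le> 1 / (1 * scaled_A z (Suc n))"
    using dist_interval_large[of _ z] z nz by (intro norm_B_over_cA) force+
  also have "\<dots> \<le> 1 / (4 ^ n / h 1)"
    using w h_pos[of 1] scaled_A_pos[OF nz] by (intro divide_left_mono) auto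
  finally show ?thesis by (simp add: power_one_over field_simps)
qed

section \<open>The error of the approximants, and poles near infinity\<close>

definition pade_err :: "real \<Rightarrow> complex \<Rightarrow> nat \<Rightarrow> complex" where
  "pade_err a z n = (B z (Suc n) + of_real a * B z n) / (z * (cA z (Suc n) + of_real a * cA z n))"

text \<open>Dividing numerator and denominator by \<open>cA z n\<close> leaves only the ratio,
  \<open>a\<close> and the small quotients of \<open>B\<close> by \<open>cA\<close>. The number
  \<gamma> keeps the ratio away from the pole condition \<open>A_ratio z n = - of_real a\<close>. As
  \<open>a\<close> is arbitrary, the estimates become uniform over all orders once the numbers
  \<open>a\<close> are bounded.\<close>

lemma pade_err_bound:
  assumes "cA z n \<noteq> 0" "cA z (Suc n) \<noteq> 0" "cmod (A_ratio z n) \<le> D" "cmod (A_ratio z n + of_real a) \<ge> \<gamma>" "\<gamma> > 0"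
    "\<bar>a\<bar> \<le> C" "cmod (B z n / cA z n) \<le> e" "cmod (B z (Suc n) / cA z (Suc n)) \<le> e" "z \<noteq> 0"
  shows "cA z (Suc n) + of_real a * cA z n \<noteq> 0" "cmod (pade_err a z n) \<le> e * (D + C) / (cmod z * \<gamma>)"
proof -
  have den: "cA z (Suc n) + of_real a * cA z n = (A_ratio z n + of_real a) * cA z n"
    using assms(1) by (simp add: A_ratio_def field_simps)
  have mn: "A_ratio z n + of_real a \<noteq> 0" using assms by auto
  show "cA z (Suc n) + of_real a * cA z n \<noteq> 0" using den mn assms by simp
  have "pade_err a z n = (B z (Suc n) / cA z (Suc n) * A_ratio z n + of_real a * (B z n / cA z n)) / (z * (A_ratio z n + of_real a))"
    unfolding pade_err_def den using assms(1,2,9) mn by (simp add: A_ratio_def divide_simps)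
  then have "cmod (pade_err a z n) = cmod (B z (Suc n) / cA z (Suc n) * A_ratio z n + of_real a * (B z n / cA z n))
      / (cmod z * cmod (A_ratio z n + of_real a))"
    by (simp add: norm_divide norm_mult)
  also have "\<dots> \<le> (e * D + C * e) / (cmod z * \<gamma>)"
  proof (intro frac_le)
    have "cmod (B z (Suc n) / cA z (Suc n) * A_ratio z n) \<le> e * D"
      unfolding norm_mult using assms(3,8) by (intro mult_mono) (auto intro: order.trans[OF norm_ge_zero])
    moreover have "cmod (of_real a * (B z n / cA z n)) \<le> C * e"
      unfolding norm_mult using assms(6,7) by (intro mult_mono) (auto intro: order.trans[OF abs_ge_zero])
    ultimately show "cmod (B z (Suc n) / cA z (Suc n) * A_ratio z n + of_real a * (B z n / cA z n)) \<le> e * D + C * e"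
      by (intro order.trans[OF norm_triangle_ineq] add_mono)
    have "e \<ge> 0" "D \<ge> 0" "C \<ge> 0" using assms(3,6,7) norm_ge_zero abs_ge_zero order.trans by blast+
    then show "0 \<le> e * D + C * e" by simp
  qed (use assms in auto)
  finally show "cmod (pade_err a z n) \<le> e * (D + C) / (cmod z * \<gamma>)"
    by (simp add: distrib_left mult.commute)
qed

text \<open>Adding a real number does not change the imaginary part of the ratio, so the ratio plus
  \<open>a\<close> has modulus at least \<delta> whatever \<open>a\<close> is. The order starts at
  \<open>Suc n\<close> because \<open>cA z 0 = 0\<close> cannot be divided by.\<close>

lemma pade_err_nonreal:
  assumes "\<delta> > 0" "\<rho> \<ge> 0" "C \<ge> 0"
  obtains K r where "0 \<le> r" "r < 1"
    "\<And>z a n. \<bar>Im z\<bar> \<ge> \<delta> \<Longrightarrow> cmod z \<le> \<rho> \<Longrightarrow> \<bar>a\<bar> \<le> C \<Longrightarrow>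
      cA z (Suc (Suc n)) + of_real a * cA z (Suc n) \<noteq> 0 \<and> cmod (pade_err a z (Suc n)) \<le> K * r ^ n"
proof
  define D where "D = \<rho> + 1 + 1 / \<delta>"
  define r where "r = 1 / (1 + \<delta> / D)"
  have D0: "D > 0" using assms by (simp add: D_def add_nonneg_pos)
  show r: "0 \<le> r" "r < 1" using assms D0 by (simp_all add: r_def add_pos_pos)
  fix z :: complex and a :: real and n
  assume z: "\<bar>Im z\<bar> \<ge> \<delta>" "cmod z \<le> \<rho>" and a: "\<bar>a\<bar> \<le> C"
  define e where "e = D * h 1 / \<delta>\<^sup>2 * r ^ n"
  have Imz: "Im z \<noteq> 0" using z assms by auto
  have e1: "cmod (B z (Suc n) / cA z (Suc n)) \<le> e"
    using B_over_cA_nonreal[OF assms(1) z, of n] by (simp add: e_def r_def D_def)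
  have "cmod (B z (Suc (Suc n)) / cA z (Suc (Suc n))) \<le> D * h 1 / \<delta>\<^sup>2 * r ^ Suc n"
    using B_over_cA_nonreal[OF assms(1) z, of "Suc n"] by (simp add: r_def D_def)
  also have "\<dots> \<le> e" unfolding e_def using r D0 h_pos[of 1] power_decreasing[of n "Suc n" r]
    by (intro mult_left_mono) auto
  finally have e2: "cmod (B z (Suc (Suc n)) / cA z (Suc (Suc n))) \<le> e" .
  have "1 / \<bar>Im z\<bar> \<le> 1 / \<delta>" using assms z by (intro divide_left_mono) auto
  then have mD: "cmod (A_ratio z (Suc n)) \<le> D" using norm_A_ratio_nonreal[OF Imz, of n] z by (simp add: D_def)
  have ma: "cmod (A_ratio z (Suc n) + of_real a) \<ge> \<delta>"
    using Im_A_ratio_nonreal[OF Imz, of n] z abs_Im_le_cmod[of "A_ratio z (Suc n) + of_real a"] by simp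
  have zn: "z \<noteq> 0" "cmod z \<ge> \<delta>" using Imz z abs_Im_le_cmod[of z] by auto
  note P = pade_err_bound[OF cA_nonreal[OF Imz] cA_nonreal[OF Imz] mD ma assms(1) a e1 e2 zn(1)]
  have "e \<ge> 0" using e1 norm_ge_zero order.trans by blast
  then have "e * (D + C) / (cmod z * \<delta>) \<le> e * (D + C) / (\<delta> * \<delta>)"
    using zn assms D0 by (intro divide_left_mono mult_right_mono) auto
  then show "cA z (Suc (Suc n)) + of_real a * cA z (Suc n) \<noteq> 0 \<and>
      cmod (pade_err a z (Suc n)) \<le> (D * h 1 / \<delta>\<^sup>2 * (D + C) / (\<delta> * \<delta>)) * r ^ n"
    using P by (auto simp: e_def mult_ac)
qed

text \<open>The ratio has modulus at least \<open>C + 2\<close> here and cannot be cancelled by a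
  number of modulus at most \<open>C\<close>. Its growth at infinity is compensated by the factor
  1/z of the error, which makes the bound uniform up to infinity.\<close>

lemma pade_err_large:
  assumes "\<bar>a\<bar> \<le> C" "cmod z \<ge> C + 4"
  shows "cA z (Suc (Suc n)) + of_real a * cA z (Suc n) \<noteq> 0"
    "cmod (pade_err a z (Suc n)) \<le> h 1 * (2 + C) * (1 / 4) ^ n"
proof -
  have one0: "(0::real) < 1" by simp
  have C: "C \<ge> 0" using assms by linarith
  then have z: "cmod z \<ge> 4" using assms by simp
  have nz: "cA z (Suc n) \<noteq> 0" for n using A_ratio_large[OF z] by blast
  define e where "e = h 1 * (1 / 4) ^ n"
  have e1: "cmod (B z (Suc n) / cA z (Suc n)) \<le> e" using B_over_cA_large[OF z] by (simp add: e_def)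
  have "cmod (B z (Suc (Suc n)) / cA z (Suc (Suc n))) \<le> h 1 * (1 / 4) ^ Suc n" by (rule B_over_cA_large[OF z])
  also have "\<dots> \<le> e" using h_pos[of 1] by (simp add: e_def)
  finally have e2: "cmod (B z (Suc (Suc n)) / cA z (Suc (Suc n))) \<le> e" .
  have ma: "cmod (A_ratio z (Suc n) + of_real a) \<ge> 1"
    using norm_A_ratio_large(1)[OF z, of n] assms norm_triangle_ineq2[of "A_ratio z (Suc n)" "- of_real a"] by simp
  have z0: "z \<noteq> 0" using z by auto
  note P = pade_err_bound[OF nz[of n] nz[of "Suc n"] norm_A_ratio_large(2)[OF z, of n] ma one0 assms(1) e1 e2 z0]
  show "cA z (Suc (Suc n)) + of_real a * cA z (Suc n) \<noteq> 0" by (rule P)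
  have e0: "e \<ge> 0" using e1 norm_ge_zero order.trans by blast
  have "cmod z + 2 + C \<le> (2 + C) * cmod z"
    using C z mult_left_mono[of 1 "cmod z" C] by (simp add: distrib_right)
  then have "e * (cmod z + 2 + C) / cmod z \<le> e * ((2 + C) * cmod z) / cmod z"
    using e0 by (intro divide_right_mono mult_left_mono) auto
  then show "cmod (pade_err a z (Suc n)) \<le> h 1 * (2 + C) * (1 / 4) ^ n"
    using P(2) z0 by (simp add: e_def mult_ac)
qed

lemma cA_of_real: "cA (of_real x) n = (of_real (cA x n) :: complex)"
  using poly_of_real_of_real[of "A n" "x"] poly_of_real_of_real[of "A n" "x", where ?'a = real]
  by (simp add: cA_def)

text \<open>The ratio differs from the identity by at most 2, so by the intermediate value theorem
  it takes the value \<open>- a\<close> on the half-line on that side. The margin 2 in the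
  hypothesis gives the inequality at the inner endpoint.\<close>

lemma large_pole:
  assumes \<rho>: "\<rho> \<ge> 4" and a: "\<bar>a\<bar> \<ge> \<rho> + 2"
  obtains x :: real where "\<bar>x\<bar> \<ge> \<rho>" "cA x (Suc (Suc n)) + a * cA x (Suc n) = 0"
proof -
  have mx: "\<bar>A_ratio x (Suc n) - x\<bar> \<le> 2" "cA x (Suc n) \<noteq> 0" if "\<bar>x\<bar> \<ge> 4" for x :: real
    using A_ratio_large[of x n] that by auto
  have cont: "continuous_on S (\<lambda>x::real. A_ratio x (Suc n))" if "\<And>x. x \<in> S \<Longrightarrow> \<bar>x\<bar> \<ge> 4" for S
    unfolding A_ratio_def cA_def using mx(2) that by (intro continuous_intros) (auto simp: cA_def)
  have "\<exists>x::real. \<bar>x\<bar> \<ge> \<rho> \<and> A_ratio x (Suc n) = - a"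
  proof (cases "a \<ge> 0")
    case True
    have "\<exists>x. - (a + 2) \<le> x \<and> x \<le> - \<rho> \<and> A_ratio x (Suc n) = - a"
      using mx(1)[of "- (a + 2)"] mx(1)[of "- \<rho>"] a \<rho> True by (intro IVT' cont) auto
    then show ?thesis using \<rho> by force
  next
    case False
    have "\<exists>x. \<rho> \<le> x \<and> x \<le> - a + 2 \<and> A_ratio x (Suc n) = - a"
      using mx(1)[of "- a + 2"] mx(1)[of "\<rho>"] a \<rho> False by (intro IVT' cont) auto
    then show ?thesis using \<rho> by force
  qed
  then obtain x where x: "\<bar>x\<bar> \<ge> \<rho>" "A_ratio x (Suc n) = - a" by blast
  then have "cA x (Suc (Suc n)) = - a * cA x (Suc n)"
    using cA_Suc_eq[of x "Suc n"] mx(2)[of x] \<rho> by simp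
  then show ?thesis using that x by simp
qed

end

section \<open>Maps of the Riemann sphere\<close>

lemma continuous_on_stereo: "continuous_on S stereo"
  unfolding continuous_on_iff dist_riemann_sphere_def by blast

lemma continuous_on_sphere_iff:
  fixes f :: "'a::metric_space \<Rightarrow> riemann_sphere"
  shows "continuous_on S f \<longleftrightarrow> continuous_on S (\<lambda>x. stereo (f x))"
  unfolding continuous_on_iff dist_riemann_sphere_def ..

text \<open>The point with homogeneous coordinates (a : b), for (a, b) other than (0, 0).\<close>

definition ratio_point :: "complex \<Rightarrow> complex \<Rightarrow> riemann_sphere" where
  "ratio_point a b = (if b = 0 then Infty else Cpt (a / b))"

text \<open>The formula is free of division by \<open>b\<close>; hence continuity at poles is no
  different from continuity elsewhere.\<close>

lemma stereo_ratio_point: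
  assumes "a \<noteq> 0 \<or> b \<noteq> 0"
  shows "stereo (ratio_point a b) = (complex_of_real (2 / ((cmod a)\<^sup>2 + (cmod b)\<^sup>2)) * (a * cnj b),
           ((cmod a)\<^sup>2 - (cmod b)\<^sup>2) / ((cmod a)\<^sup>2 + (cmod b)\<^sup>2))"
proof (cases "b = 0")
  case True
  then show ?thesis using assms by (simp add: ratio_point_def)
next
  case False
  define r where "r = (cmod a)\<^sup>2" define q where "q = (cmod b)\<^sup>2"
  have q: "q > 0" and r: "r \<ge> 0" using False by (simp_all add: q_def r_def)
  have ab: "(cmod (a / b))\<^sup>2 = r / q" by (simp add: norm_divide power_divide q_def r_def)
  have "b * cnj b = of_real q" by (simp add: q_def complex_norm_square[symmetric] mult.commute)
  then have d: "a / b = a * cnj b / of_real q" using False q by (simp add: field_simps)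
  have 1: "2 / (1 + r / q) = 2 * q / (r + q)" using q r by (simp add: field_simps)
  have "complex_of_real (2 / (1 + (cmod (a / b))\<^sup>2)) * (a / b) = complex_of_real (2 / (1 + r / q)) * (a / b)"
    by (simp only: ab)
  also have "\<dots> = complex_of_real (2 * q / (r + q)) * (a * cnj b / of_real q)" by (simp only: 1 d)
  also have "\<dots> = complex_of_real (2 / (r + q)) * (a * cnj b)" using q by simp
  finally have "complex_of_real (2 / (1 + (cmod (a / b))\<^sup>2)) * (a / b) = complex_of_real (2 / (r + q)) * (a * cnj b)" .
  moreover have "r / q - 1 = (r - q) / q" "r / q + 1 = (r + q) / q"
    using q by (simp_all add: diff_divide_distrib add_divide_distrib)
  then have "((cmod (a / b))\<^sup>2 - 1) / ((cmod (a / b))\<^sup>2 + 1) = (r - q) / (r + q)"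
    unfolding ab using q by simp
  ultimately show ?thesis using False by (simp add: ratio_point_def q_def r_def)
qed

lemma continuous_on_ratio_point:
  fixes f g :: "'a::metric_space \<Rightarrow> complex"
  assumes "continuous_on S f" "continuous_on S g" "\<And>x. x \<in> S \<Longrightarrow> f x \<noteq> 0 \<or> g x \<noteq> 0"
  shows "continuous_on S (\<lambda>x. ratio_point (f x) (g x))"
proof -
  have pos: "(cmod (f x))\<^sup>2 + (cmod (g x))\<^sup>2 \<noteq> 0" if "x \<in> S" for x
    using assms(3)[OF that] by (simp add: sum_power2_eq_zero_iff)
  have "continuous_on S (\<lambda>x. (complex_of_real (2 / ((cmod (f x))\<^sup>2 + (cmod (g x))\<^sup>2)) * (f x * cnj (g x)),
           ((cmod (f x))\<^sup>2 - (cmod (g x))\<^sup>2) / ((cmod (f x))\<^sup>2 + (cmod (g x))\<^sup>2)))"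
    using assms(1,2) pos by (intro continuous_intros) auto
  then show ?thesis
    unfolding continuous_on_sphere_iff by (rule continuous_on_eq) (use assms(3) in \<open>simp add: stereo_ratio_point\<close>)
qed

lemma continuous_on_Cpt: "continuous_on S Cpt"
proof -
  have "continuous_on S (\<lambda>z. ratio_point z 1)" by (intro continuous_on_ratio_point continuous_intros) auto
  then show ?thesis by (simp add: ratio_point_def cong: continuous_on_cong)
qed

text \<open>\<open>coord\<close> and \<open>icoord\<close> are the two affine charts z and 1/z.
  Expressed through \<open>stereo\<close> they are quotients of continuous functions.\<close>

definition coord :: "riemann_sphere \<Rightarrow> complex" where
  "coord x = fst (stereo x) / of_real (1 - snd (stereo x))"
definition icoord :: "riemann_sphere \<Rightarrow> complex" where
  "icoord x = cnj (fst (stereo x)) / of_real (1 + snd (stereo x))"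

lemma stereo_height: "1 - snd (stereo (Cpt z)) = 2 / (1 + (cmod z)\<^sup>2)" "1 + snd (stereo (Cpt z)) = 2 * (cmod z)\<^sup>2 / (1 + (cmod z)\<^sup>2)"
proof -
  have "1 + (cmod z)\<^sup>2 > 0" by (simp add: add_pos_nonneg)
  then show "1 - snd (stereo (Cpt z)) = 2 / (1 + (cmod z)\<^sup>2)" "1 + snd (stereo (Cpt z)) = 2 * (cmod z)\<^sup>2 / (1 + (cmod z)\<^sup>2)"
    by (simp_all add: field_simps)
qed

lemma one_plus_norm: "1 + (cmod z)\<^sup>2 \<noteq> 0"
  by (smt (verit) zero_le_power2)

lemma coord_Cpt: "coord (Cpt z) = z"
  unfolding coord_def stereo_height using one_plus_norm[of z] by (simp del: of_real_add of_real_power)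

lemma icoord_Cpt: "icoord (Cpt z) = 1 / z"
proof (cases "z = 0")
  case False
  have "z * cnj z = of_real ((cmod z)\<^sup>2)" by (simp add: complex_norm_square[symmetric])
  then have "1 / z = cnj z / of_real ((cmod z)\<^sup>2)" using False by (simp add: field_simps)
  then show ?thesis
    unfolding icoord_def stereo_height using one_plus_norm[of z] False
    by (simp del: of_real_add of_real_power)
qed (simp add: icoord_def)

lemma icoord_Infty: "icoord Infty = 0" by (simp add: icoord_def)

lemma continuous_on_coord: "continuous_on (- {Infty}) coord"
proof -
  have "1 - snd (stereo x) \<noteq> 0" if "x \<in> - {Infty}" for x
    using that stereo_height(1) one_plus_norm by (cases x) auto
  then show ?thesis unfolding coord_def
    by (intro continuous_intros continuous_on_stereo) auto
qed

lemma continuous_on_icoord: "continuous_on (- {Cpt 0}) icoord"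
proof -
  have "1 + snd (stereo x) \<noteq> 0" if "x \<in> - {Cpt 0}" for x
    using that stereo_height(2) one_plus_norm by (cases x) (auto simp del: of_real_add stereo.simps(1))
  then show ?thesis unfolding icoord_def
    by (intro continuous_intros continuous_on_stereo) (simp del: of_real_add)
qed

text \<open>In the chart z the map is (N : P), in the chart w = 1/z it is (A : B), the same pair up
  to the factor w^n. The point w = 0 needs \<open>B0\<close>; all others are covered by
  coprimality.\<close>

lemma continuous_rational_map:
  fixes N P A B :: "complex poly"
  assumes rev: "\<And>w. w \<noteq> 0 \<Longrightarrow> poly A w = w ^ n * poly N (1 / w)" "\<And>w. w \<noteq> 0 \<Longrightarrow> poly B w = w ^ n * poly P (1 / w)"
    and B0: "poly B 0 \<noteq> 0" and coprime: "\<And>z. poly N z \<noteq> 0 \<or> poly P z \<noteq> 0"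
  defines "R \<equiv> \<lambda>x. case x of Cpt z \<Rightarrow> ratio_point (poly N z) (poly P z) | Infty \<Rightarrow> ratio_point (poly A 0) (poly B 0)"
  shows "continuous_on UNIV R"
proof -
  have "continuous_on (- {Infty}) (\<lambda>x. ratio_point (poly N (coord x)) (poly P (coord x)))"
    using coprime by (intro continuous_on_ratio_point continuous_on_poly continuous_on_coord)
  then have 1: "continuous_on (- {Infty}) R"
    by (rule continuous_on_eq) (auto simp: R_def coord_Cpt split: riemann_sphere.split)
  have "poly A (icoord x) \<noteq> 0 \<or> poly B (icoord x) \<noteq> 0" if "x \<noteq> Cpt 0" for x
  proof (cases "icoord x = 0")
    case False
    then show ?thesis using coprime[of "1 / icoord x"] by (simp add: rev)
  qed (simp add: B0)
  then have "continuous_on (- {Cpt 0}) (\<lambda>x. ratio_point (poly A (icoord x)) (poly B (icoord x)))"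
    by (intro continuous_on_ratio_point continuous_on_poly continuous_on_icoord) auto
  then have 2: "continuous_on (- {Cpt 0}) R"
  proof (rule continuous_on_eq)
    fix x assume "x \<in> - {Cpt 0}"
    then show "ratio_point (poly A (icoord x)) (poly B (icoord x)) = R x"
      by (cases x) (auto simp: R_def icoord_Cpt icoord_Infty rev ratio_point_def)
  qed
  have "continuous_on (- {Infty} \<union> - {Cpt 0}) R"
    by (intro continuous_on_open_Un 1 2) auto
  moreover have "- {Infty} \<union> - {Cpt 0} = UNIV" by auto
  ultimately show ?thesis by simp
qed

text \<open>Chordal distance dominates the difference of heights, and a finite point z lies 2 / (1 +
  |z|^2) below the pole. The size of \<open>u\<close> makes its gap at most half of the lower bound
  for the gap of \<open>v\<close>.\<close>

lemma sphere_dist_lower: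
  assumes "cmod v \<le> M" "cmod u \<ge> 2 * M + 2"
  shows "dist (Cpt u) (Cpt v) \<ge> 1 / (1 + M\<^sup>2)"
proof -
  have M: "M \<ge> 0" using assms(1) norm_ge_zero order.trans by blast
  have "(cmod v)\<^sup>2 \<le> M\<^sup>2" using assms(1) by (intro power_mono) auto
  then have v: "1 - snd (stereo (Cpt v)) \<ge> 2 / (1 + M\<^sup>2)"
    unfolding stereo_height by (intro divide_left_mono) (auto simp: add_pos_nonneg)
  have "(2 * M + 2)\<^sup>2 \<le> (cmod u)\<^sup>2" using assms(2) M by (intro power_mono) auto
  moreover have "2 * (1 + M\<^sup>2) \<le> (2 * M + 2)\<^sup>2" using M by (simp add: power2_sum power_mult_distrib)
  ultimately have "2 * (1 + M\<^sup>2) \<le> 1 + (cmod u)\<^sup>2" by linarith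
  then have "2 / (1 + (cmod u)\<^sup>2) \<le> 2 / (2 * (1 + M\<^sup>2))"
    by (intro divide_left_mono) (auto simp: add_pos_nonneg)
  also have "2 / (2 * y) = 1 / y" for y :: real by simp
  finally have u: "1 - snd (stereo (Cpt u)) \<le> 1 / (1 + M\<^sup>2)" unfolding stereo_height .
  have "2 / (1 + M\<^sup>2) = 1 / (1 + M\<^sup>2) + 1 / (1 + M\<^sup>2)" by simp
  then have "1 / (1 + M\<^sup>2) \<le> \<bar>snd (stereo (Cpt u)) - snd (stereo (Cpt v))\<bar>"
    using u v by linarith
  also have "\<dots> \<le> dist (Cpt u) (Cpt v)"
    unfolding dist_riemann_sphere_def by (metis dist_snd_le dist_real_def)
  finally show ?thesis .
qed

text \<open>The functions eventually take values in the ball of radius \<open>M + 1\<close>, on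
  which \<open>Cpt\<close> is uniformly continuous by compactness.\<close>

lemma uniform_limit_Cpt:
  fixes f :: "'b \<Rightarrow> 'a \<Rightarrow> complex"
  assumes "uniform_limit K f g F" "\<And>x. x \<in> K \<Longrightarrow> cmod (g x) \<le> M"
  shows "uniform_limit K (\<lambda>n x. Cpt (f n x)) (\<lambda>x. Cpt (g x)) F"
proof (rule uniform_limitI)
  fix e :: real assume e: "e > 0"
  have "uniformly_continuous_on (cball 0 (M + 1)) Cpt"
    by (intro compact_uniformly_continuous continuous_on_Cpt) simp
  then obtain d where d: "d > 0" "\<And>z w. z \<in> cball 0 (M + 1) \<Longrightarrow> w \<in> cball 0 (M + 1) \<Longrightarrow> dist w z < d \<Longrightarrow> dist (Cpt w) (Cpt z) < e"
    using e unfolding uniformly_continuous_on_def by metis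
  have "\<forall>\<^sub>F n in F. \<forall>x\<in>K. dist (f n x) (g x) < min d 1"
    using assms(1) by (rule uniform_limitD) (use d in simp)
  then show "\<forall>\<^sub>F n in F. \<forall>x\<in>K. dist (Cpt (f n x)) (Cpt (g x)) < e"
  proof eventually_elim
    case (elim n)
    show ?case
    proof
      fix x assume x: "x \<in> K"
      then have *: "dist (f n x) (g x) < d" "dist (f n x) (g x) < 1" using elim by auto
      have "cmod (f n x) \<le> cmod (g x) + dist (f n x) (g x)"
        using norm_triangle_sub[of "f n x" "g x"] by (simp add: dist_norm)
      then show "dist (Cpt (f n x)) (Cpt (g x)) < e" using assms(2)[OF x] * by (intro d(2)) auto
    qed
  qed
qed

text \<open>In the coordinate w = 1/z the cap is a closed disc.\<close>

lemma compact_outer_cap: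
  assumes "\<rho> > 0"
  shows "compact (insert Infty (Cpt ` {z. cmod z \<ge> \<rho>}))"
proof -
  have "compact ((\<lambda>w. ratio_point 1 w) ` cball 0 (1 / \<rho>))"
    by (intro compact_continuous_image continuous_on_ratio_point continuous_intros) auto
  moreover have "(\<lambda>w. ratio_point 1 w) ` cball 0 (1 / \<rho>) = insert Infty (Cpt ` {z. cmod z \<ge> \<rho>})"
  proof (intro equalityI subsetI)
    fix x assume "x \<in> (\<lambda>w. ratio_point 1 w) ` cball 0 (1 / \<rho>)"
    then obtain w where w: "cmod w \<le> 1 / \<rho>" "x = ratio_point 1 w" by auto
    show "x \<in> insert Infty (Cpt ` {z. cmod z \<ge> \<rho>})"
    proof (cases "w = 0")
      case False
      then have "cmod (1 / w) \<ge> \<rho>" using w(1) assms by (simp add: norm_divide field_simps)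
      then show ?thesis using False w by (auto simp: ratio_point_def)
    qed (simp add: w ratio_point_def)
  next
    fix x assume "x \<in> insert Infty (Cpt ` {z. cmod z \<ge> \<rho>})"
    then show "x \<in> (\<lambda>w. ratio_point 1 w) ` cball 0 (1 / \<rho>)"
    proof
      assume "x = Infty" then show ?thesis using assms by (intro image_eqI[of _ _ 0]) (auto simp: ratio_point_def)
    next
      assume "x \<in> Cpt ` {z. cmod z \<ge> \<rho>}"
      then obtain z where z: "x = Cpt z" "cmod z \<ge> \<rho>" by auto
      then have "cmod z > 0" "1 / cmod z \<le> 1 / \<rho>" using assms z by (auto intro!: frac_le)
      then show ?thesis using z
        by (intro image_eqI[of _ _ "1 / z"]) (auto simp: ratio_point_def norm_divide)
    qed
  qed
  ultimately show ?thesis by simp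
qed

text \<open>Reversal with respect to a formal degree \<open>n\<close>, since the numerators have
  smaller degree than the order of the approximant.\<close>

definition reversed_poly :: "nat \<Rightarrow> complex poly \<Rightarrow> complex poly" where
  "reversed_poly n p = (\<Sum>k\<le>n. monom (coeff p k) (n - k))"

lemma degree_reversed_poly: "degree (reversed_poly n p) \<le> n"
  unfolding reversed_poly_def by (intro degree_sum_le) (auto intro: order.trans[OF degree_monom_le])

lemma poly_reversed_poly:
  assumes "degree p \<le> n" "w \<noteq> 0" shows "poly (reversed_poly n p) w = w ^ n * poly p (1 / w)"
proof -
  have "poly p (1 / w) = (\<Sum>k\<le>n. coeff p k * (1 / w) ^ k)"
    unfolding poly_altdef using assms(1) by (intro sum.mono_neutral_left) (auto simp: coeff_eq_0)
  moreover have "w ^ n * (1 / w) ^ k = w ^ (n - k)" if "k \<le> n" for k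
    using assms(2) that by (simp add: power_diff power_one_over)
  ultimately show ?thesis
    by (simp add: reversed_poly_def poly_sum poly_monom sum_distrib_left mult.left_commute[of "w ^ n"])
qed

lemma poly_reversed_poly_0: "poly (reversed_poly n p) 0 = coeff p n"
proof -
  have "poly (reversed_poly n p) 0 = (\<Sum>k\<le>n. if k = n then coeff p k else 0)"
    unfolding reversed_poly_def poly_sum poly_monom by (intro sum.cong) auto
  then show ?thesis by simp
qed

text \<open>A nonzero polynomial vanishes at 0 to an order at most its degree, so it cannot decay
  like 1/z^(d+1) in 1/z. This yields the uniqueness of Pade approximants.\<close>

lemma inverse_poly_bigo_imp_0:
  fixes Q :: "complex poly"
  assumes "degree Q \<le> d" "(\<lambda>z. poly Q (1 / z)) \<in> O[at_infinity](\<lambda>z. 1 / z ^ Suc d)"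
  shows "Q = 0"
proof (rule ccontr)
  assume "Q \<noteq> 0"
  obtain q where q: "Q = [:- 0, 1:] ^ order 0 Q * q" "\<not> [:- 0, 1:] dvd q"
    using order_decomp[OF \<open>Q \<noteq> 0\<close>] by blast
  define k where "k = order 0 Q"
  have Qz: "poly Q w = w ^ k * poly q w" for w
    by (subst q(1)) (simp add: k_def poly_monom poly_power)
  have q0: "poly q 0 \<noteq> 0" using q(2) by (simp add: poly_eq_0_iff_dvd)
  have "k \<le> degree Q" unfolding k_def using \<open>Q \<noteq> 0\<close> by (rule order_degree)
  then have kd: "k \<le> d" using assms(1) by simp
  have lim: "((\<lambda>z. poly q (1 / z)) \<longlongrightarrow> poly q 0) at_infinity"
    unfolding divide_inverse mult_1 by (intro tendsto_poly tendsto_inverse_0)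
  have "(\<lambda>z::complex. z ^ k * poly Q (1 / z)) \<in> O[at_infinity](\<lambda>z. z ^ k * (1 / z ^ Suc d))"
    by (intro landau_o.big.mult landau_o.big_refl assms)
  moreover have "\<forall>\<^sub>F z::complex in at_infinity. z ^ k * poly Q (1 / z) = poly q (1 / z)"
    using eventually_not_equal_at_infinity[of 0] by eventually_elim (simp add: Qz power_one_over)
  ultimately have "(\<lambda>z. poly q (1 / z)) \<in> O[at_infinity](\<lambda>z. z ^ k * (1 / z ^ Suc d))"
    by (simp add: landau_o.big.in_cong)
  moreover have "\<forall>\<^sub>F z::complex in at_infinity. z ^ k * (1 / z ^ Suc d) = inverse z ^ Suc (d - k)"
    using eventually_not_equal_at_infinity[of 0]
  proof eventually_elim
    case (elim z)
    have "z ^ Suc d = z ^ k * z ^ Suc (d - k)" using kd by (simp flip: power_add power_Suc)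
    then show ?case using elim by (simp add: power_inverse field_simps)
  qed
  moreover have "((\<lambda>z::complex. inverse z ^ Suc (d - k)) \<longlongrightarrow> 0 ^ Suc (d - k)) at_infinity"
    by (intro tendsto_power tendsto_inverse_0)
  then have "(\<lambda>z::complex. inverse z ^ Suc (d - k)) \<in> o[at_infinity](\<lambda>_. 1 :: complex)"
    by (intro smalloI_tendsto) auto
  ultimately have "(\<lambda>z. poly q (1 / z)) \<in> O[at_infinity](\<lambda>z. inverse z ^ Suc (d - k))"
    "(\<lambda>z::complex. inverse z ^ Suc (d - k)) \<in> o[at_infinity](\<lambda>_. 1 :: complex)"
    by (simp_all add: landau_o.big.cong)
  then have "(\<lambda>z. poly q (1 / z)) \<in> o[at_infinity](\<lambda>_. 1 :: complex)"
    by (rule landau_o.big_small_trans)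
  then have "((\<lambda>z. poly q (1 / z)) \<longlongrightarrow> 0) at_infinity" by (auto dest: smalloD_tendsto)
  then show False using lim q0 tendsto_unique[OF _ lim] by (metis trivial_limit_at_infinity)
qed

section \<open>Asymptotic expansions and the continued fraction\<close>

definition complex_fps :: "real fps \<Rightarrow> complex fps" where
  "complex_fps r = Abs_fps (\<lambda>n. complex_of_real (fps_nth r n))"

lemma complex_fps_nth [simp]: "fps_nth (complex_fps r) n = of_real (fps_nth r n)" by (simp add: complex_fps_def)
lemma complex_fps_add: "complex_fps (r + q) = complex_fps r + complex_fps q" by (intro fps_ext) simp
lemma complex_fps_diff: "complex_fps (r - q) = complex_fps r - complex_fps q" by (intro fps_ext) simp
lemma complex_fps_mult: "complex_fps (r * q) = complex_fps r * complex_fps q" by (intro fps_ext) (simp add: fps_mult_nth)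
lemma complex_fps_1: "complex_fps 1 = 1" by (intro fps_ext) simp
lemma complex_fps_const: "complex_fps (fps_const c) = fps_const (of_real c)" by (intro fps_ext) simp
lemma complex_fps_X: "complex_fps fps_X = fps_X" by (intro fps_ext) (simp add: fps_X_def)
lemma complex_fps_inverse: "fps_nth r 0 \<noteq> 0 \<Longrightarrow> complex_fps (inverse r) = inverse (complex_fps r)"
  by (rule fps_inverse_unique[symmetric]) (simp add: complex_fps_mult[symmetric] inverse_mult_eq_1' complex_fps_1)
lemma complex_fps_shift: "complex_fps (fps_shift n r) = fps_shift n (complex_fps r)" by (intro fps_ext) simp

text \<open>The functions of the continued fraction are analytic at infinity. Convergent series in
  1/z are closed under the field operations that occur and imply the expansion in every
  sector.\<close>

definition expands :: "(complex \<Rightarrow> complex) \<Rightarrow> real fps \<Rightarrow> bool" where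
  "expands G r \<longleftrightarrow> (\<exists>\<phi>. \<phi> has_fps_expansion complex_fps r \<and> (\<forall>\<^sub>F z in at_infinity. G z = \<phi> (inverse z)))"

lemma expandsI:
  "\<phi> has_fps_expansion complex_fps r \<Longrightarrow> \<forall>\<^sub>F z in at_infinity. G z = \<phi> (inverse z) \<Longrightarrow> expands G r"
  unfolding expands_def by blast

lemma expandsE:
  assumes "expands G r"
  obtains \<phi> where "\<phi> has_fps_expansion complex_fps r" "\<forall>\<^sub>F z in at_infinity. G z = \<phi> (inverse z)"
  using assms unfolding expands_def by blast

lemma expands_cong:
  assumes "expands G r" "\<forall>\<^sub>F z in at_infinity. H z = G z" shows "expands H r"
proof -
  obtain \<phi> where p: "\<phi> has_fps_expansion complex_fps r" "\<forall>\<^sub>F z in at_infinity. G z = \<phi> (inverse z)"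
    using assms(1) by (rule expandsE)
  show ?thesis by (rule expandsI[OF p(1)]) (use assms(2) p(2) in \<open>eventually_elim, simp\<close>)
qed

lemma expands_binary:
  assumes "expands G r" "expands H q"
    and op: "\<And>\<phi> \<psi>. \<phi> has_fps_expansion complex_fps r \<Longrightarrow> \<psi> has_fps_expansion complex_fps q \<Longrightarrow>
      (\<lambda>w. f (\<phi> w) (\<psi> w)) has_fps_expansion complex_fps t"
  shows "expands (\<lambda>z. f (G z) (H z)) t"
proof -
  obtain \<phi> where p: "\<phi> has_fps_expansion complex_fps r" "\<forall>\<^sub>F z in at_infinity. G z = \<phi> (inverse z)"
    using assms(1) by (rule expandsE)
  obtain \<psi> where q: "\<psi> has_fps_expansion complex_fps q" "\<forall>\<^sub>F z in at_infinity. H z = \<psi> (inverse z)"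
    using assms(2) by (rule expandsE)
  show ?thesis
    by (rule expandsI[OF op[OF p(1) q(1)]]) (use p(2) q(2) in \<open>eventually_elim, simp\<close>)
qed

lemma expands_add: "expands G r \<Longrightarrow> expands H q \<Longrightarrow> expands (\<lambda>z. G z + H z) (r + q)"
  by (rule expands_binary[where f = "(+)"], assumption+, unfold complex_fps_add, rule has_fps_expansion_add)

lemma expands_diff: "expands G r \<Longrightarrow> expands H q \<Longrightarrow> expands (\<lambda>z. G z - H z) (r - q)"
  by (rule expands_binary[where f = "(-)"], assumption+, unfold complex_fps_diff, rule has_fps_expansion_diff)

lemma expands_mult: "expands G r \<Longrightarrow> expands H q \<Longrightarrow> expands (\<lambda>z. G z * H z) (r * q)"
  by (rule expands_binary[where f = "(*)"], assumption+, unfold complex_fps_mult, rule has_fps_expansion_mult)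

lemma expands_inverse:
  assumes "expands G r" "fps_nth r 0 \<noteq> 0" shows "expands (\<lambda>z. inverse (G z)) (inverse r)"
proof -
  obtain \<phi> where p: "\<phi> has_fps_expansion complex_fps r" "\<forall>\<^sub>F z in at_infinity. G z = \<phi> (inverse z)"
    using assms(1) by (rule expandsE)
  have "(\<lambda>w. inverse (\<phi> w)) has_fps_expansion complex_fps (inverse r)"
    unfolding complex_fps_inverse[OF assms(2)] using assms(2) by (intro has_fps_expansion_inverse p(1)) simp
  then show ?thesis by (rule expandsI) (use p(2) in \<open>eventually_elim, simp\<close>)
qed

lemma expands_const: "expands (\<lambda>z. of_real c) (fps_const c)"
  unfolding expands_def complex_fps_const by (intro exI[of _ "\<lambda>_. of_real c"]) auto

lemma expands_inverse_z: "expands (\<lambda>z. inverse z) fps_X"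
  unfolding expands_def complex_fps_X by (intro exI[of _ "\<lambda>z. z"]) (auto intro: fps_expansion_intros)

lemma expands_inverse_power: "expands (\<lambda>z. 1 / z ^ k) (fps_X ^ k)"
proof (induction k)
  case 0 show ?case using expands_const[of 1] by simp
next
  case (Suc k) show ?case using expands_mult[OF expands_inverse_z Suc] by (simp add: field_simps)
qed

lemma expands_cmult: "expands G r \<Longrightarrow> expands (\<lambda>z. of_real c * G z) (fps_const c * r)"
  by (rule expands_mult[OF expands_const])

lemma expands_shift:
  assumes "expands G r" "\<And>i. i < n \<Longrightarrow> fps_nth r i = 0"
  shows "expands (\<lambda>z. z ^ n * G z) (fps_shift n r)"
\<comment> \<open>The zero series has \<open>subdegree\<close> 0, so the bound on the subdegree used
  below fails for it.\<close>
proof (cases "r = 0")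
  case True
  have c0: "complex_fps 0 = 0" by (intro fps_ext) simp
  from assms(1) obtain \<phi> where p: "\<phi> has_fps_expansion complex_fps r" "\<forall>\<^sub>F z in at_infinity. G z = \<phi> (inverse z)"
    unfolding expands_def by blast
  have "\<forall>\<^sub>F w in nhds 0. \<phi> w = 0" using p(1) by (simp add: True c0 has_fps_expansion_0_iff)
  then have "\<forall>\<^sub>F z in at_infinity. \<phi> (inverse z) = 0"
    using tendsto_inverse_0 by (rule eventually_compose_filterlim)
  then have "\<forall>\<^sub>F z in at_infinity. z ^ n * G z = 0"
    using p(2) by eventually_elim simp
  then show ?thesis unfolding expands_def
    by (intro exI[of _ "\<lambda>_. 0"]) (simp add: True c0)
next
  case False
  from assms(1) obtain \<phi> where p: "\<phi> has_fps_expansion complex_fps r" "\<forall>\<^sub>F z in at_infinity. G z = \<phi> (inverse z)"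
    unfolding expands_def by blast
  have "complex_fps r \<noteq> 0" using False by (auto simp: fps_eq_iff)
  then have "n \<le> subdegree (complex_fps r)" using assms(2) by (intro subdegree_geI) auto
  from has_fps_expansion_shift[OF p(1) this refl]
  have "(\<lambda>x. if x = 0 then fps_nth (complex_fps r) n else \<phi> x / x ^ n) has_fps_expansion complex_fps (fps_shift n r)"
    by (simp add: complex_fps_shift)
  moreover have "\<forall>\<^sub>F z in at_infinity. z ^ n * G z
     = (if inverse z = 0 then fps_nth (complex_fps r) n else \<phi> (inverse z) / inverse z ^ n)"
    using p(2) eventually_not_equal_at_infinity[of 0]
    by eventually_elim (simp add: field_simps)
  ultimately show ?thesis unfolding expands_def by blast
qed

lemma expands_tendsto:
  assumes "expands G r" shows "(G \<longlongrightarrow> of_real (fps_nth r 0)) at_infinity"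
proof -
  from assms obtain \<phi> where p: "\<phi> has_fps_expansion complex_fps r" "\<forall>\<^sub>F z in at_infinity. G z = \<phi> (inverse z)"
    unfolding expands_def by blast
  have "((\<lambda>z. \<phi> (inverse z)) \<longlongrightarrow> fps_nth (complex_fps r) 0) at_infinity"
    by (rule filterlim_compose[OF has_fps_expansion_imp_tendsto_0[OF p(1)] tendsto_inverse_0])
  then show ?thesis using p(2) by (simp add: tendsto_cong)
qed

lemma expands_eventually_nz:
  "expands G r \<Longrightarrow> fps_nth r 0 \<noteq> 0 \<Longrightarrow> \<forall>\<^sub>F z in at_infinity. G z \<noteq> 0"
  using expands_tendsto tendsto_imp_eventually_ne by fastforce

lemma expands_bigo_0:
  assumes "expands G r" "\<And>i. i < n \<Longrightarrow> fps_nth r i = 0"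
  shows "G \<in> O[at_infinity](\<lambda>z. 1 / z ^ n)"
proof -
  have "(\<lambda>z. z ^ n * G z) \<in> O[at_infinity](\<lambda>_. 1)"
    by (rule bigoI_tendsto[OF _ ]) (use expands_tendsto[OF expands_shift[OF assms]] in auto)
  then have "(\<lambda>z. 1 / z ^ n * (z ^ n * G z)) \<in> O[at_infinity](\<lambda>z. 1 / z ^ n * 1)"
    by (intro landau_o.big.mult landau_o.big_refl)
  moreover have "\<forall>\<^sub>F z in at_infinity. 1 / z ^ n * (z ^ n * G z) = G z"
    using eventually_not_equal_at_infinity[of 0] by eventually_elim simp
  ultimately show ?thesis by (simp add: landau_o.big.in_cong)
qed

lemma expands_bigo:
  assumes "expands G r"
  shows "(\<lambda>z. G z - (\<Sum>j<N. of_real (fps_nth r j) / z ^ j)) \<in> O[at_infinity](\<lambda>z. 1 / z ^ N)"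
proof -
  define q where "q n = (\<Sum>j<n. fps_const (fps_nth r j) * fps_X ^ j)" for n
  have c: "of_real a / z ^ j = of_real a * (1 / z ^ j)" for a :: real and z :: complex and j by simp
  have "expands (\<lambda>z. \<Sum>j<n. of_real (fps_nth r j) / z ^ j) (q n)" for n
  proof (induction n)
    case 0 show ?case using expands_const[of 0] by (simp add: q_def)
  next
    case (Suc n)
    then have "expands (\<lambda>z. (\<Sum>j<n. of_real (fps_nth r j) / z ^ j) + of_real (fps_nth r n) * (1 / z ^ n))
       (q n + fps_const (fps_nth r n) * fps_X ^ n)"
      by (intro expands_add expands_cmult expands_inverse_power)
    then show ?case by (simp add: q_def)
  qed
  then have "expands (\<lambda>z. G z - (\<Sum>j<N. of_real (fps_nth r j) / z ^ j)) (r - q N)"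
    by (intro expands_diff assms)
  then show ?thesis
  proof (rule expands_bigo_0)
    fix i assume i: "i < N"
    have "fps_nth (q N) i = (\<Sum>j<N. if j = i then fps_nth r j else 0)"
      unfolding q_def fps_sum_nth by (intro sum.cong) (auto simp: fps_X_power_nth)
    then show "fps_nth (r - q N) i = 0" using i by simp
  qed
qed

section \<open>Uniqueness of sectorial expansions, and one step of the continued fraction\<close>

lemma sector_le: "at_infinity_sector \<delta> \<le> at_infinity"
  by (simp add: at_infinity_sector_def)

lemma expands_has_asymptotics_at_infinity:
  assumes "expands F r" "fps_nth r 0 = 0"
  shows "(\<lambda>z. F z + (\<Sum>j<N. complex_of_real (- fps_nth r (Suc j)) / z ^ (j + 1))) \<in> O[at_infinity](\<lambda>z. 1 / z ^ (N + 1))"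
proof -
  have eq: "F z - (\<Sum>j<Suc N. of_real (fps_nth r j) / z ^ j)
      = F z + (\<Sum>j<N. complex_of_real (- fps_nth r (Suc j)) / z ^ (j + 1))" for z
    unfolding sum.lessThan_Suc_shift using assms(2) by (simp add: sum_negf)
  show ?thesis using expands_bigo[OF assms(1), of "Suc N"] unfolding eq by simp
qed

lemma expands_has_asymptotics:
  assumes "expands F r" "fps_nth r 0 = 0"
  shows "has_asymptotics F (\<lambda>j. - fps_nth r (Suc j))"
  unfolding has_asymptotics_def
  using expands_has_asymptotics_at_infinity[OF assms] landau_o.big.filter_mono[OF sector_le] by blast

text \<open>This ray shows that the sectors reach infinity; uniqueness of limits along them depends
  on it.\<close>

lemma imaginary_axis_sector:
  assumes "\<delta> < pi / 2" shows "filterlim (\<lambda>y::real. \<i> * of_real y) (at_infinity_sector \<delta>) at_top"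
  unfolding at_infinity_sector_def filterlim_inf filterlim_principal
proof
  show "filterlim (\<lambda>y::real. \<i> * of_real y) at_infinity at_top"
    unfolding filterlim_at_infinity_conv_norm_at_top
    by (simp add: norm_mult filterlim_abs_real)
  show "\<forall>\<^sub>F y in at_top. \<i> * complex_of_real y \<in> {z. \<delta> < Arg z \<and> Arg z < pi - \<delta>}"
    using eventually_gt_at_top[of 0]
  proof eventually_elim
    case (elim y)
    have "Arg (\<i> * of_real y) = pi / 2" using elim by (simp add: Arg_times_of_real2)
    then show ?case using assms by simp
  qed
qed

lemma sector_not_bot: "\<delta> < pi / 2 \<Longrightarrow> at_infinity_sector \<delta> \<noteq> bot"
  using imaginary_axis_sector[of \<delta>, unfolded filterlim_iff, rule_format, of "\<lambda>_. False"]
  by (auto simp: trivial_limit_at_top_linorder)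

text \<open>At the first index where the coefficients differ, a nonzero constant would be O(1/z)
  along a sector. The angle pi/4 is below pi/2, so that sector is nontrivial.\<close>

lemma has_asymptotics_unique:
  assumes "has_asymptotics F s" "has_asymptotics F s'"
  shows "s = s'"
proof (rule ccontr)
  assume "s \<noteq> s'"
  then have ex: "\<exists>n. s n \<noteq> s' n" by auto
  define n where "n = (LEAST n. s n \<noteq> s' n)"
  have n: "s n \<noteq> s' n" unfolding n_def using ex by (rule LeastI_ex)
  have less: "s j = s' j" if "j < n" for j using not_less_Least[of j "\<lambda>n. s n \<noteq> s' n"] that by (auto simp: n_def)
  define S where "S = at_infinity_sector (pi / 4)"
  have Sbot: "S \<noteq> bot" unfolding S_def by (rule sector_not_bot) simp
  have Sinf: "S \<le> at_infinity" unfolding S_def by (rule sector_le)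
  have "(\<lambda>z. (F z + (\<Sum>j<Suc n. complex_of_real (s j) / z ^ (j + 1)))
     - (F z + (\<Sum>j<Suc n. complex_of_real (s' j) / z ^ (j + 1)))) \<in> O[S](\<lambda>z. 1 / z ^ (Suc n + 1))"
    unfolding S_def
    by (rule sum_in_bigo(2)[OF assms(1)[unfolded has_asymptotics_def, rule_format, of "pi / 4" "Suc n"]
          assms(2)[unfolded has_asymptotics_def, rule_format, of "pi / 4" "Suc n"]]) auto
  moreover have "(F z + (\<Sum>j<Suc n. complex_of_real (s j) / z ^ (j + 1)))
     - (F z + (\<Sum>j<Suc n. complex_of_real (s' j) / z ^ (j + 1))) = of_real (s n - s' n) / z ^ (n + 1)" for z
    using less by (simp add: diff_divide_distrib)
  ultimately have "(\<lambda>z. of_real (s n - s' n) / z ^ (n + 1)) \<in> O[S](\<lambda>z. 1 / z ^ (Suc n + 1))" by simp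
  then have "(\<lambda>z. z ^ (n + 1) * (of_real (s n - s' n) / z ^ (n + 1))) \<in> O[S](\<lambda>z. z ^ (n + 1) * (1 / z ^ (Suc n + 1)))"
    by (intro landau_o.big.mult landau_o.big_refl)
  moreover have ev: "\<forall>\<^sub>F z in S. z \<noteq> 0" using eventually_not_equal_at_infinity[of 0] Sinf by (rule filter_leD[rotated])
  have "\<forall>\<^sub>F z in S. z ^ (n + 1) * (of_real (s n - s' n) / z ^ (n + 1)) = of_real (s n - s' n)"
    using ev by eventually_elim simp
  moreover have "\<forall>\<^sub>F z in S. z ^ (n + 1) * (1 / z ^ (Suc n + 1)) = inverse z"
    using ev by eventually_elim (simp add: field_simps)
  ultimately have O: "(\<lambda>z. complex_of_real (s n - s' n)) \<in> O[S](\<lambda>z. inverse z)"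
    by (simp add: landau_o.big.in_cong landau_o.big.cong)
  have "((\<lambda>z. inverse z) \<longlongrightarrow> (0::complex)) S" using tendsto_inverse_0 Sinf by (rule tendsto_mono[rotated])
  then have "(\<lambda>z::complex. inverse z) \<in> o[S](\<lambda>_. 1 :: complex)"
    by (intro smalloI_tendsto) auto
  from landau_o.big_small_trans[OF O this]
  have "((\<lambda>z::complex. complex_of_real (s n - s' n)) \<longlongrightarrow> 0) S"
    by (auto dest: smalloD_tendsto)
  then have "complex_of_real (s n - s' n) = 0" using Sbot tendsto_const tendsto_unique by metis
  then show False using n by simp
qed

lemma asymp_coeffs_eq: "has_asymptotics F s \<Longrightarrow> asymp_coeffs F = s"
  unfolding asymp_coeffs_def by (rule the_equality) (auto intro: has_asymptotics_unique)

text \<open>\<open>c\<close> is the first nonzero asymptotic coefficient; the sign comes from the expansion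
  \<open>G \<sim> - \<Sum>j. s j / z ^ (j + 1)\<close>.\<close>

definition leads :: "(complex \<Rightarrow> complex) \<Rightarrow> real \<Rightarrow> bool" where
  "leads G c \<longleftrightarrow> c \<noteq> 0 \<and> (\<exists>r k. expands G r \<and> (\<forall>i\<le>k. fps_nth r i = 0) \<and> fps_nth r (Suc k) = - c)"

lemma leads_asymptotics:
  assumes "leads G c"
  obtains s where "has_asymptotics G s" "s (LEAST j. s j \<noteq> 0) = c" "\<exists>j. s j \<noteq> 0"
proof -
  obtain r k where r: "expands G r" "\<forall>i\<le>k. fps_nth r i = 0" "fps_nth r (Suc k) = - c" "c \<noteq> 0"
    using assms unfolding leads_def by blast
  define s where "s = (\<lambda>j. - fps_nth r (Suc j))"
  have "(LEAST j. s j \<noteq> 0) = k"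
  proof (rule Least_equality)
    show "s k \<noteq> 0" using r by (simp add: s_def)
    fix j assume "s j \<noteq> 0"
    then show "k \<le> j" using r(2) by (metis s_def Suc_leI neg_equal_0_iff_equal not_le)
  qed
  moreover have "has_asymptotics G s" unfolding s_def using r by (intro expands_has_asymptotics) auto
  moreover have "s k = c" using r by (simp add: s_def)
  ultimately show ?thesis using that r by auto
qed

lemma leads_first_coeff: "leads G c \<Longrightarrow> first_coeff G = c"
  using leads_asymptotics asymp_coeffs_eq unfolding first_coeff_def by metis

lemma leads_normalized: "leads G c \<Longrightarrow> normalized G \<longleftrightarrow> \<bar>c\<bar> = 1"
proof -
  assume "leads G c"
  then obtain s where s: "has_asymptotics G s" "s (LEAST j. s j \<noteq> 0) = c" "\<exists>j. s j \<noteq> 0"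
    by (rule leads_asymptotics)
  have "s' = s" if "has_asymptotics G s'" for s' using that s(1) by (rule has_asymptotics_unique)
  then show ?thesis unfolding normalized_def using s by metis
qed

lemma leads_tendsto: "leads G c \<Longrightarrow> (G \<longlongrightarrow> 0) at_infinity"
  unfolding leads_def using expands_tendsto by fastforce

lemma leads_cmult:
  assumes "leads G c" "a \<noteq> 0" shows "leads (\<lambda>z. of_real a * G z) (a * c)"
proof -
  obtain r k where r: "expands G r" "\<forall>i\<le>k. fps_nth r i = 0" "fps_nth r (Suc k) = - c" "c \<noteq> 0"
    using assms unfolding leads_def by blast
  then show ?thesis unfolding leads_def using assms(2)
    by (intro conjI exI[of _ "fps_const a * r"] exI[of _ k] expands_cmult) auto
qed

lemma leads_cong: "leads G c \<Longrightarrow> (\<forall>\<^sub>F z in at_infinity. H z = G z) \<Longrightarrow> leads H c"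
  unfolding leads_def using expands_cong by blast

lemma poly_tendsto_0_imp_0:
  fixes q :: "complex poly"
  assumes "(poly q \<longlongrightarrow> 0) F" "F \<le> at_infinity" "F \<noteq> bot"
  shows "q = 0"
proof (cases "degree q = 0")
  case True
  then obtain c where c: "q = [:c:]" by (auto elim: degree_eq_zeroE)
  then have "poly q = (\<lambda>_. c)" by auto
  then have "((\<lambda>_. c) \<longlongrightarrow> 0) F" using assms(1) by simp
  then have "c = 0" using assms(3) tendsto_const tendsto_unique by metis
  then show ?thesis using c by simp
next
  case False
  then have "filterlim (poly q) at_infinity at_infinity" by (intro filterlim_poly_at_infinity) auto
  then have "filterlim (poly q) at_infinity F" using assms(2) by (rule filterlim_mono[OF _ order.refl])
  then show ?thesis using assms(1,3) not_tendsto_and_filterlim_at_infinity by blast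
qed

text \<open>Exhibiting a decomposition with decaying remainder suffices to evaluate the
  descriptions: two candidate polynomials differ by one that tends to 0, and the square of
  \<open>step_b G\<close> has to scale the leading coefficient \<open>\<beta>\<close> to modulus
  1.\<close>

lemma gen_step:
  assumes fc: "first_coeff G = \<epsilon>" and \<epsilon>: "\<epsilon> \<noteq> 0" and p: "lead_coeff p = 1"
    and eq: "\<forall>\<^sub>F z in at_infinity. - 1 / G z = of_real \<epsilon> * poly (map_poly of_real p) z + V z"
    and V: "leads V \<beta>"
  shows "principal_poly G = p"
    and "\<forall>\<^sub>F z in at_infinity. step_remainder G z = V z"
    and "(step_b G)\<^sup>2 = \<bar>\<beta>\<bar>" "\<beta> \<noteq> 0"
proof -
  let ?P = "\<lambda>p. \<forall>\<delta>>0. ((\<lambda>z. - 1 / G z - complex_of_real (first_coeff G) * poly (map_poly complex_of_real p) z)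
              \<longlongrightarrow> 0) (at_infinity_sector \<delta>)"
  have ev: "\<forall>\<^sub>F z in at_infinity. - 1 / G z - complex_of_real (first_coeff G) * poly (map_poly complex_of_real p) z = V z"
    using eq by eventually_elim (simp add: fc)
  then have lim: "((\<lambda>z. - 1 / G z - complex_of_real (first_coeff G) * poly (map_poly complex_of_real p) z) \<longlongrightarrow> 0) at_infinity"
    using leads_tendsto[OF V] by (simp add: tendsto_cong)
  show pp: "principal_poly G = p"
    unfolding principal_poly_def
  proof (rule the_equality)
    show "lead_coeff p = 1 \<and> ?P p" using p lim tendsto_mono[OF sector_le] by blast
  next
    fix p' assume p': "lead_coeff p' = 1 \<and> ?P p'"
    define S where "S = at_infinity_sector (pi / 4)"
    have Sbot: "S \<noteq> bot" unfolding S_def by (rule sector_not_bot) simp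
    have Sinf: "S \<le> at_infinity" unfolding S_def by (rule sector_le)
    have "((\<lambda>z. ((- 1 / G z - complex_of_real \<epsilon> * poly (map_poly complex_of_real p) z)
       - (- 1 / G z - complex_of_real \<epsilon> * poly (map_poly complex_of_real p') z)) / of_real \<epsilon>)
        \<longlongrightarrow> (0 - 0) / of_real \<epsilon>) S"
      using p' lim tendsto_mono[OF sector_le] \<epsilon> unfolding S_def fc by (intro tendsto_intros) auto
    then have "((\<lambda>z. poly (map_poly complex_of_real p' - map_poly complex_of_real p) z) \<longlongrightarrow> 0) S"
      using \<epsilon> by (simp add: diff_divide_distrib)
    then have "map_poly complex_of_real p' - map_poly complex_of_real p = 0"
      by (rule poly_tendsto_0_imp_0[OF _ Sinf Sbot])
    then have "coeff p' i = coeff p i" for i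
      by (metis (no_types) coeff_map_poly eq_iff_diff_eq_0 of_real_0 of_real_eq_iff)
    then show "p' = p" by (simp add: poly_eq_iff)
  qed
  show rem: "\<forall>\<^sub>F z in at_infinity. step_remainder G z = V z"
    using ev by (simp add: step_remainder_def pp)
  show \<beta>: "\<beta> \<noteq> 0" using V by (simp add: leads_def)
  have norm: "normalized (\<lambda>z. step_remainder G z / complex_of_real (b\<^sup>2)) \<longleftrightarrow> b = sqrt \<bar>\<beta>\<bar>" if "b > 0" for b
  proof -
    have "leads (\<lambda>z. of_real (1 / b\<^sup>2) * V z) (1 / b\<^sup>2 * \<beta>)" using that by (intro leads_cmult V) auto
    then have "leads (\<lambda>z. step_remainder G z / complex_of_real (b\<^sup>2)) (1 / b\<^sup>2 * \<beta>)"
      by (rule leads_cong) (use rem in \<open>auto elim: eventually_mono\<close>)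
    then have "normalized (\<lambda>z. step_remainder G z / complex_of_real (b\<^sup>2)) \<longleftrightarrow> \<bar>1 / b\<^sup>2 * \<beta>\<bar> = 1"
      by (rule leads_normalized)
    also have "\<dots> \<longleftrightarrow> b\<^sup>2 = \<bar>\<beta>\<bar>" using that by (auto simp: abs_mult field_simps)
    also have "\<dots> \<longleftrightarrow> b = sqrt \<bar>\<beta>\<bar>" using that by (metis abs_ge_zero less_imp_le real_sqrt_pow2 real_sqrt_unique)
    finally show ?thesis .
  qed
  have "step_b G = sqrt \<bar>\<beta>\<bar>"
    unfolding step_b_def using norm \<beta> by (intro the_equality conjI norm[THEN iffD2]) auto
  then show "(step_b G)\<^sup>2 = \<bar>\<beta>\<bar>" by simp
qed

text \<open>The functions of the continued fraction are, up to real factors, the quotients of consecutive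
  members of any sequence that satisfies its recurrence and decays.\<close>

lemma gen_chain:
  fixes \<Phi> :: "nat \<Rightarrow> complex \<Rightarrow> complex" and p :: "nat \<Rightarrow> real poly" and C :: "nat \<Rightarrow> real"
  assumes p: "\<And>j. lead_coeff (p j) = 1"
    and T: "\<And>j. leads (\<lambda>z. - (\<Phi> (Suc j) z / \<Phi> j z)) (C j)"
    and rec: "\<And>j. \<forall>\<^sub>F z in at_infinity. \<Phi> (Suc (Suc j)) z
               = poly (map_poly of_real (p j)) z * \<Phi> (Suc j) z - of_real (C j) * \<Phi> j z"
    and nz: "\<And>j. \<forall>\<^sub>F z in at_infinity. \<Phi> j z \<noteq> 0"
    and F: "\<forall>\<^sub>F z in at_infinity. F z = - (\<Phi> 1 z / \<Phi> 0 z)"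
  shows "gen_p F j = p j" and "gen_c F j = C (Suc j)"
proof -
  have C: "C j \<noteq> 0" for j using T[of j] by (simp add: leads_def)
  \<comment> \<open>The normalization of \<open>F\<close> leaves the sign of \<open>C 0\<close>, and
    each step multiplies the leading sign by that of the next \<open>C\<close>.\<close>
  define \<epsilon> where "\<epsilon> j = (\<Prod>i\<le>j. sgn (C i))" for j
  have \<epsilon>: "\<epsilon> j * \<epsilon> j = 1" for j
  proof (induction j)
    case 0 show ?case using C[of 0] by (simp add: \<epsilon>_def sgn_if)
  next
    case (Suc j)
    have "\<epsilon> (Suc j) = \<epsilon> j * sgn (C (Suc j))" by (simp add: \<epsilon>_def)
    moreover have "sgn (C (Suc j)) * sgn (C (Suc j)) = 1" using C[of "Suc j"] by (simp add: sgn_if)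
    ultimately show ?case using Suc by (metis (no_types, opaque_lifting) mult.assoc mult.commute mult_1)
  qed
  have \<epsilon>_nz: "\<epsilon> j \<noteq> 0" for j using \<epsilon>[of j] by auto
  have \<epsilon>_Suc: "\<epsilon> (Suc j) = \<epsilon> j * sgn (C (Suc j))" for j by (simp add: \<epsilon>_def)
  \<comment> \<open>The quotient has leading coefficient \<open>C j\<close>, so \<open>W j\<close>
    is its multiple with leading coefficient \<open>\<epsilon> j\<close>; this turns out to be
    \<open>gen_F F j\<close> near infinity.\<close>
  define W where "W j z = of_real (\<epsilon> j / C j) * - (\<Phi> (Suc j) z / \<Phi> j z)" for j z
  have W: "leads (W j) (\<epsilon> j)" for j
  proof -
    have e: "\<epsilon> j / C j * C j = \<epsilon> j" using C[of j] by simp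
    show ?thesis
      using leads_cmult[OF T[of j], of "\<epsilon> j / C j"] C[of j] \<epsilon>_nz[of j] unfolding W_def[abs_def] e by simp
  qed
  have V: "leads (\<lambda>z. of_real (\<epsilon> j) * - (\<Phi> (Suc (Suc j)) z / \<Phi> (Suc j) z)) (\<epsilon> j * C (Suc j))" for j
    by (intro leads_cmult T \<epsilon>_nz)
  have step: "principal_poly G = p j"
     "\<forall>\<^sub>F z in at_infinity. step_remainder G z = of_real (\<epsilon> j) * - (\<Phi> (Suc (Suc j)) z / \<Phi> (Suc j) z)"
     "(step_b G)\<^sup>2 = \<bar>C (Suc j)\<bar>" "first_coeff G = \<epsilon> j"
    if G: "\<forall>\<^sub>F z in at_infinity. G z = W j z" for G j
  proof -
    show fc: "first_coeff G = \<epsilon> j" by (rule leads_first_coeff[OF leads_cong[OF W G]])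
    have "\<forall>\<^sub>F z in at_infinity. - 1 / G z = of_real (\<epsilon> j) * poly (map_poly of_real (p j)) z
        + of_real (\<epsilon> j) * - (\<Phi> (Suc (Suc j)) z / \<Phi> (Suc j) z)"
      using G rec[of j] nz[of j] nz[of "Suc j"]
    proof eventually_elim
      case (elim z)
      have "1 / complex_of_real (\<epsilon> j) = of_real (\<epsilon> j)"
        using \<epsilon>[of j] \<epsilon>_nz[of j] by (simp add: field_simps flip: of_real_mult)
      moreover have "- 1 / W j z = (1 / of_real (\<epsilon> j)) * (of_real (C j) * \<Phi> j z / \<Phi> (Suc j) z)"
        by (simp add: W_def)
      then have "- 1 / G z = (1 / of_real (\<epsilon> j)) * (of_real (C j) * \<Phi> j z / \<Phi> (Suc j) z)"
        using elim by simp
      ultimately have "- 1 / G z = of_real (\<epsilon> j) * (of_real (C j) * \<Phi> j z / \<Phi> (Suc j) z)"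
        by simp
      also have "of_real (C j) * \<Phi> j z / \<Phi> (Suc j) z
          = poly (map_poly of_real (p j)) z - \<Phi> (Suc (Suc j)) z / \<Phi> (Suc j) z"
        using elim by (simp add: field_simps)
      finally show ?case by (simp add: right_diff_distrib)
    qed
    note gs = gen_step[OF fc \<epsilon>_nz p this V]
    have "\<bar>\<epsilon> j\<bar> = 1" using \<epsilon>[of j] by (auto simp: square_eq_1_iff)
    then show "principal_poly G = p j"
     "\<forall>\<^sub>F z in at_infinity. step_remainder G z = of_real (\<epsilon> j) * - (\<Phi> (Suc (Suc j)) z / \<Phi> (Suc j) z)"
     "(step_b G)\<^sup>2 = \<bar>C (Suc j)\<bar>" using gs by (simp_all add: abs_mult)
  qed
  have G: "\<forall>\<^sub>F z in at_infinity. gen_F F j z = W j z" for j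
  proof (induction j)
    case 0
    have fc: "first_coeff F = C 0" by (rule leads_first_coeff[OF leads_cong[OF T]]) (use F in simp)
    have e: "complex_of_real (\<epsilon> 0 / C 0) = 1 / of_real \<bar>C 0\<bar>"
      using C[of 0] by (simp add: \<epsilon>_def sgn_if)
    show ?case unfolding W_def e using F by eventually_elim (simp add: fc)
  next
    case (Suc j)
    have e: "complex_of_real (\<epsilon> (Suc j) / C (Suc j)) = of_real (\<epsilon> j) / of_real \<bar>C (Suc j)\<bar>"
      using C[of "Suc j"] by (simp add: \<epsilon>_Suc sgn_if)
    show ?case unfolding W_def e using step(2)[OF Suc] by eventually_elim (simp add: step(3)[OF Suc])
  qed
  show "gen_p F j = p j" by (simp add: gen_p_def step(1)[OF G])
  have "gen_c F j = \<epsilon> j * \<epsilon> (Suc j) * \<bar>C (Suc j)\<bar>"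
    by (simp only: gen_c_def step(3,4)[OF G])
  also have "\<dots> = \<epsilon> j * \<epsilon> j * (sgn (C (Suc j)) * \<bar>C (Suc j)\<bar>)" by (simp add: \<epsilon>_Suc)
  finally show "gen_c F j = C (Suc j)" by (simp add: \<epsilon> sgn_mult_abs)
qed

section \<open>Functions of the second kind at infinity\<close>

context interval_supported_measure
begin

definition stieltjes_fps :: "real poly \<Rightarrow> real fps" where
  "stieltjes_fps q = Abs_fps (\<lambda>i. case i of 0 \<Rightarrow> 0 | Suc k \<Rightarrow> - (LINT t|\<sigma>. poly q t * t ^ k))"

lemma stieltjes_fps_nth [simp]: "fps_nth (stieltjes_fps q) 0 = 0"
  "fps_nth (stieltjes_fps q) (Suc k) = - (LINT t|\<sigma>. poly q t * t ^ k)"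
  by (simp_all add: stieltjes_fps_def)

text \<open>The geometric series of the Cauchy kernel in w = 1/z converges for |w| < 1 uniformly in
  t on [-1, 1], so it may be integrated term by term.\<close>

lemma expands_stieltjes: "expands (\<lambda>z. stieltjes z q) (stieltjes_fps q)"
proof (rule expandsI)
  define \<phi> where "\<phi> w = (if w = 0 then 0 else stieltjes (inverse w) q)" for w
  have "bounded (poly q ` {-1..1})" by (intro compact_imp_bounded compact_continuous_image continuous_intros) simp
  then obtain M where "\<forall>y\<in>poly q ` {-1..1}. norm y \<le> M" by (auto simp: bounded_iff)
  then have M: "\<bar>poly q t\<bar> \<le> M" if "t \<in> {-1..1}" for t using that by auto
  have int: "integrable \<sigma> (\<lambda>t. poly q t * t ^ k)" for k
    using integrable_poly_mult[of q "monom 1 k"] by (simp add: poly_monom)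
  have sums: "(\<lambda>n. fps_nth (complex_fps (stieltjes_fps q)) n * w ^ n) sums \<phi> w" if "cmod w < 1" for w
  proof (cases "w = 0")
    case True
    have "(\<lambda>n. fps_nth (complex_fps (stieltjes_fps q)) n * w ^ n) = (\<lambda>n. 0)"
    proof
      fix n show "fps_nth (complex_fps (stieltjes_fps q)) n * w ^ n = 0" using True by (cases n) auto
    qed
    then show ?thesis using True by (simp add: \<phi>_def)
  next
    case False
    define f where "f k t = - complex_of_real (poly q t * t ^ k) * w ^ Suc k" for k t
    have fi: "integrable \<sigma> (f k)" for k
      unfolding f_def using int[of k]
      by (intro integrable_mult_left integrable_minus integrable_of_real)
    have fn: "cmod (f k t) \<le> M * cmod w ^ Suc k" if "t \<in> {-1..1}" for k t
    proof -
      have "\<bar>t\<bar> ^ k \<le> 1" using that by (intro power_le_one) auto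
      then have "\<bar>poly q t\<bar> * \<bar>t\<bar> ^ k \<le> M * 1" using M[OF that] by (intro mult_mono) (auto intro: order.trans[OF abs_ge_zero])
      then have "\<bar>poly q t\<bar> * \<bar>t\<bar> ^ k * cmod w ^ Suc k \<le> M * cmod w ^ Suc k" by (intro mult_right_mono) auto
      then show ?thesis by (simp add: f_def norm_mult norm_power power_abs)
    qed
    have geo: "summable (\<lambda>k. M * cmod w ^ Suc k)"
      using that by (intro summable_mult) (simp add: summable_mult summable_geometric)
    have s1: "AE t in \<sigma>. summable (\<lambda>k. norm (f k t))"
      using AE_interval by eventually_elim (rule summable_comparison_test'[OF geo], use fn in auto)
    have s2: "summable (\<lambda>k. LINT t|\<sigma>. norm (f k t))"
    proof (rule summable_comparison_test')
      show "summable (\<lambda>k. measure \<sigma> (space \<sigma>) * (M * cmod w ^ Suc k))" by (intro summable_mult geo)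
      fix k :: nat
      have "(LINT t|\<sigma>. norm (f k t)) \<le> (LINT t|\<sigma>. M * cmod w ^ Suc k)"
        by (intro integral_mono_AE integrable_norm fi eventually_mono[OF AE_interval fn]) auto
      then show "norm (LINT t|\<sigma>. norm (f k t)) \<le> measure \<sigma> (space \<sigma>) * (M * cmod w ^ Suc k)"
        by (simp add: integral_nonneg_AE)
    qed
    have "(\<lambda>k. LINT t|\<sigma>. f k t) sums (LINT t|\<sigma>. (\<Sum>k. f k t))"
      by (rule sums_integral[OF fi s1 s2])
    also have "(LINT t|\<sigma>. (\<Sum>k. f k t)) = stieltjes (inverse w) q"
      unfolding stieltjes_def
    proof (rule integral_cong_AE)
      show "AE t in \<sigma>. (\<Sum>k. f k t) = of_real (poly q t) / (of_real t - inverse w)"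
        using AE_interval
      proof eventually_elim
        case (elim t)
        have "cmod (of_real t * w) < 1" using elim that mult_left_le_one_le[of "cmod w" "\<bar>t\<bar>"]
          by (simp add: norm_mult abs_le_iff)
        then have g: "(\<lambda>k. (of_real t * w) ^ k) sums (1 / (1 - of_real t * w))" and nz: "1 - of_real t * w \<noteq> 0"
          by (auto intro: geometric_sums)
        have "(\<lambda>k. (- complex_of_real (poly q t) * w) * (of_real t * w) ^ k) sums
            ((- complex_of_real (poly q t) * w) * (1 / (1 - of_real t * w)))"
          by (intro sums_mult g)
        also have "(\<lambda>k. (- complex_of_real (poly q t) * w) * (of_real t * w) ^ k) = (\<lambda>k. f k t)"
          by (simp add: f_def fun_eq_iff power_mult_distrib mult_ac)
        finally have "(\<Sum>k. f k t) = (- complex_of_real (poly q t) * w) * (1 / (1 - of_real t * w))"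
          by (rule sums_unique[symmetric])
        also have "\<dots> = of_real (poly q t) / (of_real t - inverse w)"
        proof -
          have e: "of_real t - inverse w = - ((1 - of_real t * w) / w)" using False by (simp add: field_simps)
          show ?thesis unfolding e divide_minus_right by simp
        qed
        finally show ?case .
      qed
      show "(\<lambda>t. \<Sum>k. f k t) \<in> borel_measurable \<sigma>"
        using borel_measurable_integrable[OF fi] by (intro borel_measurable_suminf)
    qed (simp add: borel_measurable_iff)
    also have "(\<lambda>k. LINT t|\<sigma>. f k t) = (\<lambda>k. fps_nth (complex_fps (stieltjes_fps q)) (Suc k) * w ^ Suc k)"
    proof
      fix k
      have "(LINT t|\<sigma>. f k t) = (LINT t|\<sigma>. - complex_of_real (poly q t * t ^ k)) * w ^ Suc k"
        unfolding f_def by (rule integral_mult_left_zero)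
      also have "\<dots> = - complex_of_real (LINT t|\<sigma>. poly q t * t ^ k) * w ^ Suc k"
        by (simp del: of_real_mult of_real_power)
      finally show "(LINT t|\<sigma>. f k t) = fps_nth (complex_fps (stieltjes_fps q)) (Suc k) * w ^ Suc k" by simp
    qed
    finally have "(\<lambda>k. fps_nth (complex_fps (stieltjes_fps q)) (Suc k) * w ^ Suc k) sums stieltjes (inverse w) q" .
    then show ?thesis
      using False sums_Suc_iff[of "\<lambda>n. fps_nth (complex_fps (stieltjes_fps q)) n * w ^ n" "stieltjes (inverse w) q"]
      by (simp add: \<phi>_def)
  qed
  show "\<phi> has_fps_expansion complex_fps (stieltjes_fps q)"
  proof (rule has_fps_expansionI)
    have "\<forall>\<^sub>F w in nhds 0. w \<in> ball (0::complex) 1" by (intro eventually_nhds_in_open) auto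
    then show "\<forall>\<^sub>F w in nhds 0. (\<lambda>n. fps_nth (complex_fps (stieltjes_fps q)) n * w ^ n) sums \<phi> w"
      by eventually_elim (use sums in simp)
  qed
  show "\<forall>\<^sub>F z in at_infinity. stieltjes z q = \<phi> (inverse z)"
    using eventually_not_equal_at_infinity[of 0] by eventually_elim (simp add: \<phi>_def)
qed

text \<open>Orthogonality kills the moments of \<open>A n\<close> below its degree, and the first
  surviving one is its squared norm.\<close>

lemma B_leading: "\<exists>r. expands (\<lambda>z. z ^ n * B z n) r \<and> fps_nth r 0 = - h n"
proof (cases n)
  case 0
  then show ?thesis using expands_const[of "-1"] by (intro exI[of _ "fps_const (-1)"]) (simp add: h_0)
next
  case (Suc m)
  have z: "fps_nth (stieltjes_fps (A n)) i = 0" if "i < n" for i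
  proof (cases i)
    case (Suc k)
    then have "ip (A (Suc m)) (monom 1 k) = 0" using that \<open>n = Suc m\<close> by (intro A_orthogonal) (simp add: degree_monom_eq)
    then show ?thesis using Suc \<open>n = Suc m\<close> by (simp add: ip_def poly_monom)
  qed simp
  have "ip (A (Suc m)) (monom 1 m) = h n"
  proof (cases m)
    case 0 then show ?thesis by (simp add: h_def Suc monom_0 pCons_one)
  next
    case (Suc k)
    have "degree (monom 1 m - A (Suc m)) \<le> k"
      using degree_reduce[of "monom 1 m" k] Suc by (simp add: degree_monom_eq)
    then have "ip (A (Suc m)) (monom 1 m - A (Suc m)) = 0" using Suc by (intro A_orthogonal) simp
    then show ?thesis using \<open>n = Suc m\<close> by (simp add: ip_linear h_Suc)
  qed
  then have "fps_nth (fps_shift n (stieltjes_fps (A n))) 0 = - h n" by (simp add: Suc ip_def poly_monom)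
  moreover have "expands (\<lambda>z. z ^ n * stieltjes z (A n)) (fps_shift n (stieltjes_fps (A n)))"
    by (rule expands_shift[OF expands_stieltjes]) (rule z)
  then have "expands (\<lambda>z. z ^ n * B z n) (fps_shift n (stieltjes_fps (A n)))" by (simp add: B_def Suc)
  ultimately show ?thesis by blast
qed

lemma B_bigo: "(\<lambda>z. B z n) \<in> O[at_infinity](\<lambda>z. 1 / z ^ n)"
proof -
  obtain r where r: "expands (\<lambda>z. z ^ n * B z n) r" using B_leading by blast
  have "expands (\<lambda>z. 1 / z ^ n * (z ^ n * B z n)) (fps_X ^ n * r)"
    by (intro expands_mult expands_inverse_power r)
  then have "expands (\<lambda>z. B z n) (fps_X ^ n * r)"
    by (rule expands_cong) (use eventually_not_equal_at_infinity[of 0] in \<open>eventually_elim, simp\<close>)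
  then show ?thesis by (rule expands_bigo_0) (simp add: fps_X_power_mult_nth)
qed

end

section \<open>The continued fraction of F\<close>

locale shifted_measure = interval_supported_measure \<sigma> for \<sigma> :: "real measure" + fixes s :: real
begin

definition nn :: "nat \<Rightarrow> nat" where "nn = normal_index (extended_moments \<sigma> s)"

sublocale dx: darboux b g "\<xi> s" nn unfolding nn_def by (rule darboux)

sublocale bi: block_index nn
  by standard (simp_all add: dx.nn_0 dx.nn_Suc)

definition FF :: "complex \<Rightarrow> complex" where "FF z = (stieltjes z 1 - of_real s) / z"

definition FF_fps :: "real fps" where "FF_fps = fps_X * (stieltjes_fps 1 - fps_const s)"

lemma expands_FF: "expands FF FF_fps"
  using expands_mult[OF expands_inverse_z expands_diff[OF expands_stieltjes expands_const], of 1 s]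
  by (simp add: FF_def[abs_def] FF_fps_def divide_inverse mult.commute)

lemma FF_fps_nth: "fps_nth FF_fps 0 = 0" "- fps_nth FF_fps (Suc j) = extended_moments \<sigma> s j"
  by (simp add: FF_fps_def) (cases j, simp_all add: FF_fps_def extended_moments_def moment_def)

lemma asymp_coeffs_FF: "asymp_coeffs FF = extended_moments \<sigma> s"
  using asymp_coeffs_eq[OF expands_has_asymptotics[OF expands_FF FF_fps_nth(1)]] by (simp add: FF_fps_nth(2))

lemma FF_bigo: "(\<lambda>z. (\<Sum>j<N. of_real (extended_moments \<sigma> s j) / z ^ (j + 1)) + FF z) \<in> O[at_infinity](\<lambda>z. 1 / z ^ (N + 1))"
  using expands_has_asymptotics_at_infinity[OF expands_FF FF_fps_nth(1), of N]
  by (simp only: FF_fps_nth(2)) (simp add: add.commute)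

lemma eta_eq: "dx.eta n = h n" by (simp add: dx.eta_def h_prod)

text \<open>The decaying solution of the recurrence of the generalized Jacobi matrix, indexed so
  that F is minus the quotient of its first two members.\<close>

definition \<Phi> :: "nat \<Rightarrow> complex \<Rightarrow> complex" where
  "\<Phi> j z = (case j of 0 \<Rightarrow> -1 | Suc i \<Rightarrow> dx.Y (B z) i / z)"

definition cf_coeff :: "nat \<Rightarrow> real" where "cf_coeff j = (case j of 0 \<Rightarrow> dx.l 0 | Suc i \<Rightarrow> dx.c i)"

definition lead0 :: "nat \<Rightarrow> real" where
  "lead0 j = (case j of 0 \<Rightarrow> -1 | Suc i \<Rightarrow> - dx.l i * h (nn i))"

lemma lead0_nz: "lead0 j \<noteq> 0"
  using h_pos[of "nn (j - 1)"] by (cases j) (simp_all add: lead0_def dx.l_nz)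

lemma eventually_off_interval: "\<forall>\<^sub>F z in at_infinity. off_interval z \<and> z \<noteq> 0"
proof -
  have "\<forall>\<^sub>F z :: complex in at_infinity. 2 \<le> cmod z" by (auto simp: eventually_at_infinity)
  then show ?thesis
  proof eventually_elim
    case (elim z) then show ?case using off_interval_large[of z] by auto
  qed
qed

text \<open>In a long block \<open>a\<close> vanishes and only the faster decaying \<open>B\<close>
  remains, so one additional order of decay appears: the exponent grows by the block size in both
  cases.\<close>

lemma \<Phi>_expand: "\<exists>r. expands (\<lambda>z. z ^ nn j * \<Phi> j z) r \<and> fps_nth r 0 = lead0 j"
proof (cases j)
  case 0
  show ?thesis using expands_const[of "-1"]
    by (intro exI[of _ "fps_const (-1)"]) (simp add: 0 \<Phi>_def lead0_def dx.nn_0)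
next
  case (Suc i)
  let ?n = "nn i"
  obtain r1 where r1: "expands (\<lambda>z. z ^ Suc ?n * B z (Suc ?n)) r1" "fps_nth r1 0 = - h (Suc ?n)" using B_leading by blast
  obtain r0 where r0: "expands (\<lambda>z. z ^ ?n * B z ?n) r0" "fps_nth r0 0 = - h ?n" using B_leading by blast
  show ?thesis
  proof (cases "\<xi> s (Suc ?n) = 0")
    case True
    note lb = dx.long_block[OF True]
    have "expands (\<lambda>z. z ^ nn j * \<Phi> j z) r1"
      by (rule expands_cong[OF r1(1)])
        (use eventually_not_equal_at_infinity[of 0] in \<open>eventually_elim, simp add: Suc \<Phi>_def dx.Y_def lb\<close>)
    moreover have "fps_nth r1 0 = lead0 j"
      using r1(2) h_pos[of ?n] by (simp add: Suc lead0_def lb g_def)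
    ultimately show ?thesis by blast
  next
    case False
    note sb = dx.short_block[OF False]
    have "expands (\<lambda>z. inverse z * (z ^ Suc ?n * B z (Suc ?n)) + of_real (dx.l i) * (z ^ ?n * B z ?n))
       (fps_X * r1 + fps_const (dx.l i) * r0)"
      by (intro expands_add expands_mult expands_inverse_z expands_const r0 r1)
    then have "expands (\<lambda>z. z ^ nn j * \<Phi> j z) (fps_X * r1 + fps_const (dx.l i) * r0)"
      by (rule expands_cong)
        (use eventually_not_equal_at_infinity[of 0] in \<open>eventually_elim, simp add: Suc \<Phi>_def dx.Y_def sb field_simps\<close>)
    moreover have "fps_nth (fps_X * r1 + fps_const (dx.l i) * r0) 0 = lead0 j"
      using r0(2) by (simp add: Suc lead0_def)
    ultimately show ?thesis by blast
  qed
qed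

lemma \<Phi>_nz: "\<forall>\<^sub>F z in at_infinity. \<Phi> j z \<noteq> 0"
proof -
  obtain r where r: "expands (\<lambda>z. z ^ nn j * \<Phi> j z) r" "fps_nth r 0 = lead0 j" using \<Phi>_expand by blast
  have "\<forall>\<^sub>F z in at_infinity. z ^ nn j * \<Phi> j z \<noteq> 0" using r lead0_nz by (intro expands_eventually_nz) auto
  then show ?thesis by eventually_elim simp
qed

lemma lead0_Suc: "lead0 (Suc j) = cf_coeff j * lead0 j"
proof (cases j)
  case (Suc i)
  then show ?thesis using h_pos[of "nn i"] dx.l_nz[of i]
    by (simp add: lead0_def cf_coeff_def dx.c_def dx.u_def eta_eq)
qed (simp add: lead0_def cf_coeff_def dx.nn_0 h_0)

lemma \<Phi>_ratio_leads: "leads (\<lambda>z. - (\<Phi> (Suc j) z / \<Phi> j z)) (cf_coeff j)"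
proof -
  obtain r where r: "expands (\<lambda>z. z ^ nn j * \<Phi> j z) r" "fps_nth r 0 = lead0 j" using \<Phi>_expand by blast
  obtain q where q: "expands (\<lambda>z. z ^ nn (Suc j) * \<Phi> (Suc j) z) q" "fps_nth q 0 = lead0 (Suc j)" using \<Phi>_expand by blast
  obtain k where k: "nn (Suc j) = nn j + Suc k"
    using bi.n_less[of j] by (metis less_iff_Suc_add add_Suc_right)
  define f where "f = fps_const (-1) * (fps_X ^ Suc k * (q * inverse r))"
  have r0: "fps_nth r 0 \<noteq> 0" using r lead0_nz by simp
  have "expands (\<lambda>z. of_real (-1) * (1 / z ^ Suc k * ((z ^ nn (Suc j) * \<Phi> (Suc j) z) * inverse (z ^ nn j * \<Phi> j z)))) f"
    unfolding f_def by (intro expands_mult expands_const expands_inverse_power expands_inverse q r r0)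
  then have "expands (\<lambda>z. - (\<Phi> (Suc j) z / \<Phi> j z)) f"
    by (rule expands_cong)
      (use eventually_not_equal_at_infinity[of 0] in \<open>eventually_elim, simp add: k power_add field_simps\<close>)
  moreover have "fps_nth f i = 0" if "i \<le> k" for i using that by (simp add: f_def fps_X_power_mult_nth del: power_Suc)
  moreover have "fps_nth f (Suc k) = - cf_coeff j"
    using r(2) q(2) lead0_nz[of j] by (simp add: f_def fps_X_power_mult_nth lead0_Suc del: power_Suc)
  moreover have "cf_coeff j \<noteq> 0" by (simp add: cf_coeff_def dx.l_nz dx.c_nz split: nat.split)
  ultimately show ?thesis unfolding leads_def by blast
qed

lemma \<Phi>_rec:
  assumes "off_interval z" "z \<noteq> 0"
  shows "\<Phi> (Suc (Suc j)) z = poly (map_poly of_real (dx.p j)) z * \<Phi> (Suc j) z - of_real (cf_coeff j) * \<Phi> j z"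
proof (cases j)
  case 0
  show ?thesis using assms dx.Y_Suc_0[OF B_rec[OF assms(1)]]
    by (simp add: 0 \<Phi>_def cf_coeff_def diff_divide_distrib add_divide_distrib)
next
  case (Suc i)
  show ?thesis using assms dx.Y_Suc_Suc[OF B_rec[OF assms(1)], of i]
    by (simp add: Suc \<Phi>_def cf_coeff_def diff_divide_distrib)
qed

text \<open>From \<open>\<xi> s 0 = -1\<close> and \<open>\<xi> s 1 = s\<close> one gets
  \<open>dx.a 0 = s\<close>, and \<open>B z 0 = -1\<close> turns it into the term \<open>- s\<close>
  of the numerator.\<close>

lemma \<Phi>_1: "FF z = - (\<Phi> 1 z / \<Phi> 0 z)"
  using \<xi>_1[of s] by (simp add: FF_def \<Phi>_def dx.Y_def dx.nn_0 dx.a_def B_def)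

lemma gen_FF: "gen_p FF j = dx.p j" "gen_c FF j = dx.c j"
proof -
  have "\<forall>\<^sub>F z in at_infinity. \<Phi> (Suc (Suc j)) z
               = poly (map_poly of_real (dx.p j)) z * \<Phi> (Suc j) z - of_real (cf_coeff j) * \<Phi> j z" for j
    using eventually_off_interval by eventually_elim (use \<Phi>_rec in blast)
  note gc = gen_chain[of dx.p \<Phi> cf_coeff FF, OF dx.lead_coeff_p \<Phi>_ratio_leads this \<Phi>_nz]
  show "gen_p FF j = dx.p j" "gen_c FF j = dx.c j"
    using gc(1)[of j] gc(2)[of j] \<Phi>_1 by (simp_all add: cf_coeff_def)
qed

end

section \<open>Bounded factors\<close>

lemma l2_bounded_entries:
  assumes "l2_bounded M" obtains C where "\<And>i k. \<bar>M i k\<bar> \<le> C"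
proof -
  obtain C where C: "\<forall>x :: nat \<Rightarrow> complex. summable (\<lambda>n. (cmod (x n))\<^sup>2) \<longrightarrow>
     (\<forall>i. summable (\<lambda>j. complex_of_real (M i j) * x j)) \<and>
     summable (\<lambda>i. (cmod (\<Sum>j. complex_of_real (M i j) * x j))\<^sup>2) \<and>
     sqrt (\<Sum>i. (cmod (\<Sum>j. complex_of_real (M i j) * x j))\<^sup>2) \<le> C * sqrt (\<Sum>n. (cmod (x n))\<^sup>2)"
    using assms unfolding l2_bounded_def by (rule exE)
  have "\<bar>M i k\<bar> \<le> C" for i k
  proof -
    define x :: "nat \<Rightarrow> complex" where "x j = of_bool (j = k)" for j
    have "(\<lambda>n. (cmod (x n))\<^sup>2) = (\<lambda>n. if n = k then 1 else 0)" by (auto simp: x_def)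
    then have s: "(\<lambda>n. (cmod (x n))\<^sup>2) sums 1" using sums_single[of k "\<lambda>_. 1::real"] by simp
    have "(\<lambda>j. complex_of_real (M i j) * x j) = (\<lambda>j. if j = k then of_real (M i k) else 0)" for i
      by (auto simp: x_def)
    then have e: "(\<Sum>j. complex_of_real (M i j) * x j) = of_real (M i k)" for i
      using sums_unique[OF sums_single[of k "\<lambda>_. complex_of_real (M i k)"]] by simp
    have C1: "summable (\<lambda>i. (M i k)\<^sup>2)" "sqrt (\<Sum>i. (M i k)\<^sup>2) \<le> C"
      using C[rule_format, of x] s unfolding e by (simp_all add: sums_iff)
    have "(M i k)\<^sup>2 \<le> (\<Sum>i. (M i k)\<^sup>2)" using sum_le_suminf[OF C1(1), of "{i}"] by simp
    then have "\<bar>M i k\<bar> \<le> sqrt (\<Sum>i. (M i k)\<^sup>2)" using real_sqrt_le_mono by fastforce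
    then show ?thesis using C1(2) by simp
  qed
  then show ?thesis using that by blast
qed

lemma square_sum3_le: "((x::real) + y + z)\<^sup>2 \<le> 3 * (x\<^sup>2 + y\<^sup>2 + z\<^sup>2)"
proof -
  have "0 \<le> (x - y)\<^sup>2 + (y - z)\<^sup>2 + (x - z)\<^sup>2" by simp
  then show ?thesis by (simp add: power2_eq_square algebra_simps)
qed

text \<open>The band has width 2 because the last rows of neighbouring blocks are at most two apart.
  The shifted sequences \<open>X1\<close> and \<open>X2\<close> have the same sum as
  \<open>X\<close>, and the inequality for the square of three terms turns this into the norm bound
  \<open>3 * C\<close>.\<close>

lemma l2_bounded_banded:
  assumes C: "\<And>i k. \<bar>M i k\<bar> \<le> C" and band: "\<And>i k. M i k \<noteq> 0 \<Longrightarrow> k \<le> i \<and> i \<le> k + 2"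
  shows "l2_bounded M"
  unfolding l2_bounded_def
proof (intro exI[of _ "3 * C"] allI impI conjI)
  fix x :: "nat \<Rightarrow> complex"
  assume sx: "summable (\<lambda>n. (cmod (x n))\<^sup>2)"
  have C0: "C \<ge> 0" using C order.trans[OF abs_ge_zero] by blast
  define X where "X n = (cmod (x n))\<^sup>2" for n
  define X1 where "X1 n = (case n of 0 \<Rightarrow> 0 | Suc m \<Rightarrow> X m)" for n
  define X2 where "X2 n = (case n of 0 \<Rightarrow> 0 | Suc m \<Rightarrow> X1 m)" for n
  define S where "S = (\<Sum>n. X n)"
  have s0: "X sums S" using sx unfolding X_def[abs_def] S_def by (simp add: summable_sums)
  have s1: "X1 sums S" using s0 sums_Suc_iff[of X1 S] by (simp add: X1_def)
  have s2: "X2 sums S" using s1 sums_Suc_iff[of X2 S] by (simp add: X2_def)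
  have fin: "finite {j. M i j \<noteq> 0}" for i
    by (rule finite_subset[of _ "{..i}"]) (use band in auto)
  then have fin': "finite {j. complex_of_real (M i j) * x j \<noteq> 0}" for i
    by (rule rev_finite_subset) auto
  define y where "y i = (\<Sum>j. complex_of_real (M i j) * x j)" for i
  have y_le: "(cmod (y i))\<^sup>2 \<le> 3 * C\<^sup>2 * (X i + X1 i + X2 i)" for i
  proof -
    have y: "y i = (\<Sum>j\<in>{j. M i j \<noteq> 0}. complex_of_real (M i j) * x j)"
      unfolding y_def by (rule suminf_finite) (use fin in auto)
    have "cmod (y i) \<le> (\<Sum>j\<in>{j. M i j \<noteq> 0}. C * cmod (x j))"
      unfolding y by (rule sum_norm_le) (use C in \<open>auto simp: norm_mult intro: mult_right_mono\<close>)
    also have "\<dots> \<le> (\<Sum>j\<in>{i - 2..i}. C * cmod (x j))"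
      using band C0 by (intro sum_mono2) force+
    also have "\<dots> \<le> C * (sqrt (X i) + sqrt (X1 i) + sqrt (X2 i))"
    proof -
      consider "i = 0" | "i = 1" | m where "i = Suc (Suc m)" by (metis One_nat_def not0_implies_Suc)
      then show ?thesis
      proof cases
        case 3
        have "{i - 2..i} = {m, Suc m, i}" using 3 by auto
        then show ?thesis using 3 by (simp add: X1_def X2_def X_def algebra_simps)
      next
        case 2
        have "{i - 2..i} = {0, 1}" using 2 by auto
        then show ?thesis using 2 by (simp add: X1_def X2_def X_def algebra_simps)
      qed (simp add: X1_def X2_def X_def)
    qed
    finally have "(cmod (y i))\<^sup>2 \<le> (C * (sqrt (X i) + sqrt (X1 i) + sqrt (X2 i)))\<^sup>2"
      by (intro power_mono) auto
    also have "\<dots> \<le> C\<^sup>2 * (3 * ((sqrt (X i))\<^sup>2 + (sqrt (X1 i))\<^sup>2 + (sqrt (X2 i))\<^sup>2))"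
      unfolding power_mult_distrib by (intro mult_left_mono square_sum3_le) simp
    also have "\<dots> = 3 * C\<^sup>2 * (X i + X1 i + X2 i)"
    proof -
      have "X i \<ge> 0" "X1 i \<ge> 0" "X2 i \<ge> 0" by (auto simp: X_def X1_def X2_def split: nat.split)
      then show ?thesis by simp
    qed
    finally show ?thesis .
  qed
  have s3: "(\<lambda>i. 3 * C\<^sup>2 * (X i + X1 i + X2 i)) sums (3 * C\<^sup>2 * (S + S + S))"
    by (intro sums_mult sums_add s0 s1 s2)
  have sy: "summable (\<lambda>i. (cmod (y i))\<^sup>2)"
    by (rule summable_comparison_test'[OF sums_summable[OF s3], of 0]) (use y_le in auto)
  show "summable (\<lambda>j. complex_of_real (M i j) * x j)" for i
    by (rule summable_finite[OF fin']) simp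
  show "summable (\<lambda>i. (cmod (\<Sum>j. complex_of_real (M i j) * x j))\<^sup>2)" using sy by (simp add: y_def)
  have "(\<Sum>i. (cmod (y i))\<^sup>2) \<le> 3 * C\<^sup>2 * (S + S + S)"
    using suminf_le[OF y_le sy sums_summable[OF s3]] sums_unique[OF s3] by simp
  then have "sqrt (\<Sum>i. (cmod (y i))\<^sup>2) \<le> sqrt ((3 * C)\<^sup>2 * S)"
    by (intro real_sqrt_le_mono) (simp add: power2_eq_square)
  also have "\<dots> = 3 * C * sqrt S" using C0 by (simp add: real_sqrt_mult)
  finally show "sqrt (\<Sum>i. (cmod (\<Sum>j. complex_of_real (M i j) * x j))\<^sup>2) \<le> 3 * C * sqrt (\<Sum>n. (cmod (x n))\<^sup>2)"
    by (simp add: y_def S_def X_def)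
qed

context block_index
begin

lemma block_L_bounded:
  assumes l: "\<And>j. \<bar>l (Suc j)\<bar> \<le> C" and e: "\<And>j. n (Suc j) = Suc (Suc (n j)) \<Longrightarrow> \<bar>e j\<bar> \<le> C'"
    and "C' \<ge> 0"
  shows "l2_bounded (block_L n e l)"
proof (rule l2_bounded_banded)
  have C: "C \<ge> 0" using l order.trans[OF abs_ge_zero] by blast
  fix i k
  show "\<bar>block_L n e l i k\<bar> \<le> 1 + C' + C"
  proof (rule block_cases[of i])
    fix j assume "i = n j" "n (Suc j) = Suc (Suc (n j))"
    then show ?thesis using C assms(3) by (simp add: block_L_first)
  next
    fix j assume "Suc i = n (Suc j)"
    then have i: "i = last_row j" by (simp add: last_row_def)
    have "\<bar>if n (Suc j) = Suc (Suc (n j)) then of_bool (k = n j) * e j else 0\<bar> \<le> C'"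
      using e[of j] assms(3) by auto
    moreover have "\<bar>case j of 0 \<Rightarrow> 0 | Suc m \<Rightarrow> of_bool (k = last_row m) * l j\<bar> \<le> C"
      using l C by (auto split: nat.split)
    moreover have "\<bar>of_bool (k = last_row j) :: real\<bar> \<le> 1" by simp
    ultimately show ?thesis unfolding i block_L_last by linarith
  qed
  show "k \<le> i \<and> i \<le> k + 2" if nz: "block_L n e l i k \<noteq> 0"
  proof (rule block_cases[of i])
    fix j assume "i = n j" "n (Suc j) = Suc (Suc (n j))"
    then show ?thesis using nz by (simp add: block_L_first)
  next
    fix j assume si: "Suc i = n (Suc j)"
    then have i: "i = last_row j" by (simp add: last_row_def)
    have "k = last_row j \<or> k = n j \<or> (\<exists>m. j = Suc m \<and> k = last_row m)"
      using nz unfolding i block_L_last by (auto split: nat.splits if_splits)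
    then have "k = i \<or> k = n j \<or> Suc k = n j" using i by (auto simp: row_bounds)
    moreover have "n j \<le> i" "i \<le> Suc (n j)" using si n_gap[of j] by auto
    ultimately show ?thesis by auto
  qed
qed

lemma block_L_bounded_imp:
  assumes "l2_bounded (block_L n e l)"
  obtains C where "\<And>j. \<bar>l (Suc j)\<bar> \<le> C"
proof -
  obtain C where C: "\<And>i k. \<bar>block_L n e l i k\<bar> \<le> C" using l2_bounded_entries[OF assms] by blast
  have "block_L n e l (last_row (Suc j)) (last_row j) = l (Suc j)" for j
    using row_bounds(4)[of j] row_bounds(5)[of "Suc j"] n_less[of "Suc j"]
    unfolding block_L_last by auto
  then show ?thesis using that C by metis
qed

end

section \<open>The factors L of both factorizations and their boundedness\<close>

context shifted_measure
begin

text \<open>Both sides satisfy the recurrence with coefficients \<open>dx.p\<close> and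
  \<open>dx.c\<close>, and the boundary term of \<open>Y_Suc_0\<close> vanishes since
  \<open>cA x 0 = 0\<close>.\<close>

lemma poly_gen_P: "poly (gen_P FF j) x = dx.Y (cA x) j"
proof -
  have id: "map_poly of_real r = r" for r :: "real poly" by (simp add: map_poly_idI)
  show ?thesis
  proof (induction FF j rule: gen_P.induct)
    case 1 show ?case by (simp add: dx.Y_def dx.nn_0)
  next
    case 2 show ?case
      using dx.Y_Suc_0[OF cA_rec, of x] by (simp add: gen_FF id) (simp add: dx.Y_def dx.nn_0)
  next
    case (3 j) then show ?case
      using dx.Y_Suc_Suc[OF cA_rec, of x j] by (simp add: gen_FF id)
  qed
qed

text \<open>By the choice of \<open>dx.a\<close> the product of the left side with
  \<open>\<xi> s (nn j)\<close> is the Casorati determinant of \<open>cA 0\<close> and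
  \<open>\<xi> s\<close>, a product of the coefficients \<open>g\<close>.\<close>

lemma Y_cA_0: "dx.Y (cA (0::real)) j = - h (nn j) / \<xi> s (nn j)"
proof -
  have "cA 0 (Suc (nn j)) * \<xi> s (nn j) - \<xi> s (Suc (nn j)) * cA 0 (nn j) = - h (nn j)"
    using three_term_wronskian[OF cA_rec[of 0] \<xi>_rec[of s], of "nn j"] by (simp add: h_prod)
  moreover have "dx.Y (cA 0) j = (cA 0 (Suc (nn j)) * \<xi> s (nn j) - \<xi> s (Suc (nn j)) * cA 0 (nn j)) / \<xi> s (nn j)"
    using dx.x_nn[of j] by (simp add: dx.Y_def dx.a_def field_simps)
  ultimately show ?thesis by simp
qed

lemma gen_P_ratio: "- poly (gen_P FF (Suc j)) 0 / poly (gen_P FF j) 0 = dx.u j"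
  unfolding poly_gen_P Y_cA_0 dx.u_def dx.l_def eta_eq
  using dx.x_nn[of j] dx.x_nn[of "Suc j"] h_pos[of "nn j"] by (simp add: field_simps)

lemma gen_jacobi_FF: "gen_jacobi FF = bi.block_J dx.p dx.c"
  unfolding gen_jacobi_def bi.block_J_def asymp_coeffs_FF gen_FF nn_def[symmetric] Let_def ..

lemma long_iff: "nn (Suc j) = Suc (Suc (nn j)) \<longleftrightarrow> \<xi> s (Suc (nn j)) = 0"
  and short_iff: "nn (Suc j) = Suc (nn j) \<longleftrightarrow> \<xi> s (Suc (nn j)) \<noteq> 0"
  by (simp_all add: dx.nn_Suc)

lemma block_LU_exists:
  "block_LU_factorization FF (block_L nn (\<lambda>j. - coeff (dx.p j) 1) dx.l) (block_U nn dx.u)"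
proof -
  have "inf_mult (block_L nn (\<lambda>j. - coeff (dx.p j) 1) dx.l) (block_U nn dx.u) = bi.block_J dx.p dx.c"
    by (rule bi.block_LU_mult) (simp_all add: dx.coeff_p_0 dx.l'_def dx.c_def)
  note m = this[symmetric]
  show ?thesis
    unfolding block_LU_factorization_def gen_jacobi_FF asymp_coeffs_FF nn_def[symmetric] gen_P_ratio gen_FF
    by (rule conjI[OF m], rule exI[of _ dx.u], rule exI[of _ "\<lambda>j. - coeff (dx.p j) 1"], rule exI[of _ dx.l])
      (auto simp: dx.c_def dx.u_nz)
qed

text \<open>The prescribed quotients force the entries \<open>l (Suc j)\<close> of any such factor.
  The entries \<open>e\<close> of long blocks are diagonal coefficients of \<open>J\<close>, of
  modulus at most 1, so boundedness depends on \<open>l\<close> alone.\<close>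

lemma LU_bounded_iff:
  "(\<exists>L U. block_LU_factorization FF L U \<and> l2_bounded L) \<longleftrightarrow> (\<exists>C. \<forall>j. \<bar>dx.l (Suc j)\<bar> \<le> C)"
proof
  assume "\<exists>L U. block_LU_factorization FF L U \<and> l2_bounded L"
  then obtain e l where L: "l2_bounded (block_L nn e l)" and l: "\<And>j. l (Suc j) = dx.c j / dx.u j"
    unfolding block_LU_factorization_def asymp_coeffs_FF nn_def[symmetric] gen_P_ratio gen_FF by auto
  have "l (Suc j) = dx.l (Suc j)" for j by (simp add: l dx.c_def dx.u_nz)
  then show "\<exists>C. \<forall>j. \<bar>dx.l (Suc j)\<bar> \<le> C" using bi.block_L_bounded_imp[OF L] by metis
next
  assume "\<exists>C. \<forall>j. \<bar>dx.l (Suc j)\<bar> \<le> C"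
  then obtain C where C: "\<And>j. \<bar>dx.l (Suc j)\<bar> \<le> C" by blast
  have "l2_bounded (block_L nn (\<lambda>j. - coeff (dx.p j) 1) dx.l)"
    using C by (rule bi.block_L_bounded[where C' = 1]) (simp_all add: long_iff dx.coeff_p_1[simplified] b_bound)
  then show "\<exists>L U. block_LU_factorization FF L U \<and> l2_bounded L" using block_LU_exists by blast
qed

lemma P_hat_quotient: "- P_hat \<sigma> s (nn (Suc (Suc j)) - 1) 0 / P_hat \<sigma> s (nn (Suc j) - 1) 0 = dx.l (Suc j)"
proof -
  have "nn (Suc j) > 0" for j using bi.n_less[of j] by simp
  then show ?thesis by (simp add: P_hat_eq dx.l_def)
qed

text \<open>The relations of \<open>short_block\<close> and \<open>long_block\<close> are the
  entries of \<open>J\<close>; the value of \<open>dx.a\<close> at the next block is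
  \<open>dx.l\<close> or 0 according to the size of that block.\<close>

lemma block_UL_exists:
  "block_UL_factorization \<sigma> s (block_U nn dx.u) (block_L nn (\<lambda>j. b (nn j)) dx.l)"
proof -
  have lr: "Suc (bi.last_row j) = nn (Suc j)" for j by (rule bi.row_bounds)
  have a: "dx.a (nn (Suc j)) = (if nn (Suc (Suc j)) = Suc (nn (Suc j)) then dx.l (Suc j) else 0)" for j
    using dx.short_block(2)[of "Suc j"] dx.long_block(2)[of "Suc j"] unfolding short_iff by auto
  have "inf_mult (block_U nn dx.u) (block_L nn (\<lambda>j. b (nn j)) dx.l) = bi.tridiag b (\<lambda>k. g (Suc k))"
  proof (rule bi.block_UL_mult)
    fix j assume "nn (Suc (Suc j)) = Suc (Suc (nn (Suc j)))"
    then show "dx.l (Suc j) = g (Suc (bi.last_row j))" unfolding lr long_iff by (rule dx.long_block(3))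
  next
    fix j assume "nn (Suc j) = Suc (nn j)"
    then show "b (nn j) = (if nn (Suc (Suc j)) = Suc (nn (Suc j)) then dx.l (Suc j) else 0) + dx.u j"
      using dx.short_block(4)[of j] unfolding short_iff[of j] a by simp
  next
    fix j assume "nn (Suc (Suc j)) = Suc (nn (Suc j))"
    then show "g (Suc (bi.last_row j)) = dx.u (Suc j) * dx.l (Suc j)"
      unfolding lr short_iff by (rule dx.short_block(3)[symmetric])
  next
    fix j assume "nn (Suc j) = Suc (Suc (nn j))"
    then show "b (Suc (nn j)) = (if nn (Suc (Suc j)) = Suc (nn (Suc j)) then dx.l (Suc j) else 0) \<and> g (Suc (nn j)) = dx.u j"
      using dx.long_block(4,5)[of j] unfolding long_iff a by simp
  qed simp
  note m = this[unfolded bi.tridiag_def, symmetric]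
  show ?thesis
    unfolding block_UL_factorization_def nn_def[symmetric] Let_def monic_jacobi_eq bi.tridiag_def
    by (rule conjI[OF m], rule exI[of _ dx.u], rule exI[of _ "\<lambda>j. b (nn j)"], rule exI[of _ dx.l])
      (auto simp: P_hat_quotient[simplified] dest!: Suc_le_D)
qed

lemma UL_bounded_iff:
  "(\<exists>U L. block_UL_factorization \<sigma> s U L \<and> l2_bounded L) \<longleftrightarrow> (\<exists>C. \<forall>j. \<bar>dx.l (Suc j)\<bar> \<le> C)"
proof
  assume "\<exists>U L. block_UL_factorization \<sigma> s U L \<and> l2_bounded L"
  then obtain e l where L: "l2_bounded (block_L nn e l)"
    and l: "\<And>j. j \<ge> 1 \<Longrightarrow> l j = - P_hat \<sigma> s (nn (Suc j) - 1) 0 / P_hat \<sigma> s (nn j - 1) 0"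
    unfolding block_UL_factorization_def nn_def[symmetric] Let_def by auto
  have "l (Suc j) = dx.l (Suc j)" for j using l[of "Suc j"] P_hat_quotient[of j] by simp
  then show "\<exists>C. \<forall>j. \<bar>dx.l (Suc j)\<bar> \<le> C" using bi.block_L_bounded_imp[OF L] by metis
next
  assume "\<exists>C. \<forall>j. \<bar>dx.l (Suc j)\<bar> \<le> C"
  then obtain C where C: "\<And>j. \<bar>dx.l (Suc j)\<bar> \<le> C" by blast
  have "l2_bounded (block_L nn (\<lambda>j. b (nn j)) dx.l)"
    using C by (rule bi.block_L_bounded[where C' = 1]) (simp_all add: b_bound)
  then show "\<exists>U L. block_UL_factorization \<sigma> s U L \<and> l2_bounded L" using block_UL_exists by blast
qed

text \<open>On blocks of size 1 the two numbers coincide; on blocks of size 2 \<open>dx.a\<close> is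
  0 and \<open>dx.l\<close> is a coefficient \<open>g\<close> at a positive index, hence at most 1.
  Block 0, where \<open>g 0\<close> could occur, is excluded.\<close>

lemma l_bounded_iff_a_bounded:
  "(\<exists>C. \<forall>j. \<bar>dx.l (Suc j)\<bar> \<le> C) \<longleftrightarrow> (\<exists>C. \<forall>j. \<bar>dx.a (nn (Suc j))\<bar> \<le> C)"
proof -
  have pos: "nn (Suc j) = Suc (nn (Suc j) - 1)" for j using bi.n_less[of j] by simp
  have l: "\<bar>dx.l (Suc j)\<bar> \<le> max 1 \<bar>dx.a (nn (Suc j))\<bar>" and a: "\<bar>dx.a (nn (Suc j))\<bar> \<le> \<bar>dx.l (Suc j)\<bar>" for j
  proof -
    have g1: "\<bar>g (nn (Suc j))\<bar> \<le> 1"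
      using g_bound[of "nn (Suc j) - 1"] g_pos[of "nn (Suc j)"] pos[of j] by simp
    show "\<bar>dx.l (Suc j)\<bar> \<le> max 1 \<bar>dx.a (nn (Suc j))\<bar>" "\<bar>dx.a (nn (Suc j))\<bar> \<le> \<bar>dx.l (Suc j)\<bar>"
      using dx.short_block(2)[of "Suc j"] dx.long_block(2,3)[of "Suc j"] g1
      by (cases "\<xi> s (Suc (nn (Suc j))) = 0"; auto)+
  qed
  show ?thesis
  proof
    assume "\<exists>C. \<forall>j. \<bar>dx.l (Suc j)\<bar> \<le> C" then show "\<exists>C. \<forall>j. \<bar>dx.a (nn (Suc j))\<bar> \<le> C"
      using a order.trans by blast
  next
    assume "\<exists>C. \<forall>j. \<bar>dx.a (nn (Suc j))\<bar> \<le> C"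
    then obtain C where "\<And>j. \<bar>dx.a (nn (Suc j))\<bar> \<le> C" by blast
    then have "\<bar>dx.l (Suc j)\<bar> \<le> max 1 C" for j using l[of j] max.mono[OF order.refl, of _ C 1] order.trans by blast
    then show "\<exists>C. \<forall>j. \<bar>dx.l (Suc j)\<bar> \<le> C" by blast
  qed
qed

end

section \<open>Diagonal Pade approximants\<close>

lemma three_term_unique:
  assumes "three_term b g z X" "three_term b g z X'" "X 0 = X' 0" "X (Suc 0) = X' (Suc 0)"
  shows "X n = X' n"
proof -
  have "X n = X' n \<and> X (Suc n) = X' (Suc n)"
    by (induction n) (use assms in \<open>auto simp: three_termD[OF assms(1)] three_termD[OF assms(2)]\<close>)
  then show ?thesis ..
qed

lemma three_term_lincomb:
  assumes "three_term b g z X" "three_term b g z X'"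
  shows "three_term b g z (\<lambda>n. X n + c * X' n)"
  unfolding three_term_def by (simp add: three_termD[OF assms(1)] three_termD[OF assms(2)] algebra_simps)

context interval_supported_measure
begin

text \<open>\<open>D (Suc n)\<close> is the polynomial of the second kind belonging to
  \<open>A (Suc n)\<close>; the recurrence makes it visibly a polynomial and the starting value -1
  makes it start at index 0.\<close>

fun D :: "nat \<Rightarrow> real poly" where
  "D 0 = [:-1:]"
| "D (Suc 0) = 0"
| "D (Suc (Suc n)) = [:0, 1:] * D (Suc n) - Polynomial.smult (b n) (D (Suc n)) - Polynomial.smult (g n) (D n)"

definition cD :: "'a::real_field \<Rightarrow> nat \<Rightarrow> 'a" where "cD z n = poly (map_poly of_real (D n)) z"

lemma cD_rec: "three_term b g z (cD z)"
  unfolding three_term_def cD_def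
  by (simp add: poly_of_real_hom map_poly_pCons algebra_simps del: mult_pCons_left)

lemma degree_D: "degree (D n) \<le> n - 1"
proof -
  have "degree (D n) \<le> n - 1 \<and> degree (D (Suc n)) \<le> n"
  proof (induction n)
    case (Suc n)
    then show ?case
      by (auto intro!: degree_diff_le order.trans[OF degree_smult_le] order.trans[OF degree_mult_le])
  qed simp
  then show ?thesis ..
qed

lemma B_eq_D_A: "off_interval z \<Longrightarrow> B z n = cD z n + stieltjes z 1 * cA z n"
  by (rule three_term_unique[OF B_rec three_term_lincomb[OF cD_rec cA_rec]])
    (simp_all add: B_def cD_def map_poly_pCons)

lemma \<xi>_eq_D_A: "\<xi> s n = poly (D n) 0 + s * poly (A n) 0"
proof -
  have id: "map_poly of_real r = r" for r :: "real poly" by (simp add: map_poly_idI)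
  have "\<xi> s n = cD 0 n + s * cA 0 n"
    by (rule three_term_unique[OF \<xi>_rec three_term_lincomb[OF cD_rec cA_rec]])
      (simp_all add: \<xi>_1 cD_def map_poly_pCons)
  then show ?thesis by (simp add: cD_def cA_def id)
qed

lemma stieltjes_1_bound:
  assumes "d > 0" "\<And>t. t \<in> {-1..1} \<Longrightarrow> cmod (of_real t - z) \<ge> d"
  shows "cmod (stieltjes z 1) \<le> h 1 / d"
  using norm_B_mult_cA[OF assms, of 0] by (simp add: B_def)

end

section \<open>Numerators and denominators of the diagonal approximants\<close>

context shifted_measure
begin

text \<open>\<open>den j\<close> and \<open>num j\<close> are the denominator and the numerator of the approximant of order \<open>nn j\<close>, as
  polynomials in \<open>z\<close>; the polynomials in \<open>1 / z\<close> of \<open>is_pade\<close> are their reversals.\<close>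

definition pA :: "nat \<Rightarrow> real poly" where
  "pA j = A (Suc (nn j)) + Polynomial.smult (dx.a (nn j)) (A (nn j))"
definition pD :: "nat \<Rightarrow> real poly" where
  "pD j = D (Suc (nn j)) + Polynomial.smult (dx.a (nn j)) (D (nn j))"
definition pN :: "nat \<Rightarrow> real poly" where
  "pN j = poly_shift 1 (Polynomial.smult s (pA j) + pD j)"
definition den :: "nat \<Rightarrow> complex poly" where "den j = map_poly of_real (pA j)"
definition num :: "nat \<Rightarrow> complex poly" where "num j = map_poly of_real (- pN j)"

lemma degree_pA: "degree (pA j) \<le> nn j" and coeff_pA: "coeff (pA j) (nn j) = 1"
proof -
  have z: "degree (A (nn j)) \<le> nn j \<and> coeff (A (nn j)) (nn j) = 0"
    by (cases "nn j") (auto simp: degree_A coeff_eq_0)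
  then show "degree (pA j) \<le> nn j" unfolding pA_def
    by (intro degree_add_le order.trans[OF degree_smult_le]) (auto simp: degree_A)
  show "coeff (pA j) (nn j) = 1" using z by (simp add: pA_def lead_coeff_A)
qed

lemma degree_pD: "degree (pD j) \<le> nn j"
  unfolding pD_def using degree_D[of "Suc (nn j)"] degree_D[of "nn j"]
  by (intro degree_add_le order.trans[OF degree_smult_le]) auto

lemma coeff_pN: "k \<ge> nn j \<Longrightarrow> coeff (pN j) k = 0"
  using degree_pA[of j] degree_pD[of j] by (simp add: pN_def coeff_poly_shift coeff_eq_0)

text \<open>The constant term is \<open>\<xi> s (Suc n) + dx.a n * \<xi> s n\<close> with
  \<open>n = nn j\<close>, which vanishes by the choice of \<open>dx.a\<close>. This divisibility by
  z keeps numerator and denominator at the order \<open>nn j\<close>.\<close>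

lemma pN_shift: "pCons 0 (pN j) = Polynomial.smult s (pA j) + pD j"
proof -
  have "coeff (Polynomial.smult s (pA j) + pD j) 0
      = \<xi> s (Suc (nn j)) + dx.a (nn j) * \<xi> s (nn j)"
    by (simp add: \<xi>_eq_D_A poly_0_coeff_0 pA_def pD_def algebra_simps)
  also have "\<dots> = 0" using dx.x_nn[of j] by (simp add: dx.a_def)
  finally show ?thesis
    by (intro poly_eqI) (simp add: pN_def coeff_pCons coeff_poly_shift split: nat.split)
qed

lemma poly_den: "poly (den j) z = cA z (Suc (nn j)) + of_real (dx.a (nn j)) * cA z (nn j)"
  by (simp add: den_def pA_def cA_def poly_of_real_hom)

lemma poly_num: "- (z * poly (num j) z)
   = of_real s * poly (den j) z + (cD z (Suc (nn j)) + of_real (dx.a (nn j)) * cD z (nn j))"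
proof -
  have "z * poly (map_poly of_real (pN j)) z = poly (map_poly of_real (pCons 0 (pN j))) z"
    by (simp add: map_poly_pCons)
  also have "\<dots> = of_real s * poly (den j) z + (cD z (Suc (nn j)) + of_real (dx.a (nn j)) * cD z (nn j))"
    unfolding pN_shift by (simp add: den_def pD_def cD_def poly_of_real_hom)
  moreover have "map_poly complex_of_real (- pN j) = - map_poly of_real (pN j)"
    by (intro poly_eqI) (simp add: coeff_map_poly)
  ultimately show ?thesis by (simp add: num_def)
qed

text \<open>At a common zero the same combination would annihilate both \<open>cA z\<close> and
  \<open>cD z\<close>, and their Casorati determinant, which is \<open>- h (nn j)\<close>, would
  vanish.\<close>

lemma num_den_coprime: "poly (num j) z \<noteq> 0 \<or> poly (den j) z \<noteq> 0"
proof (rule ccontr)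
  assume "\<not> ?thesis"
  then have d: "cA z (Suc (nn j)) = - of_real (dx.a (nn j)) * cA z (nn j)"
    and n: "cD z (Suc (nn j)) = - of_real (dx.a (nn j)) * cD z (nn j)"
    using poly_num[of z j] by (simp_all add: poly_den add_eq_0_iff2)
  have "cA z (Suc (nn j)) * cD z (nn j) - cD z (Suc (nn j)) * cA z (nn j) = - of_real (h (nn j))"
    using three_term_wronskian[OF cA_rec[of z] cD_rec[of z], of "nn j"] by (simp add: h_prod cD_def map_poly_pCons)
  then have "of_real (h (nn j)) = (0 :: complex)" unfolding d n by (simp add: algebra_simps)
  then show False using h_pos[of "nn j"] by simp
qed

lemma degree_den: "degree (den j) \<le> nn j" and coeff_den: "coeff (den j) (nn j) = 1"
  using degree_pA[of j] coeff_pA[of j] by (simp_all add: den_def degree_map_poly coeff_map_poly)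
lemma den_nz: "den j \<noteq> 0" using coeff_den[of j] by auto
lemma coeff_num: "k \<ge> nn j \<Longrightarrow> coeff (num j) k = 0"
  by (simp add: num_def coeff_map_poly coeff_pN)
lemma degree_num: "degree (num j) \<le> nn j"
  by (rule degree_le) (simp add: coeff_num)

lemma FF_minus_pade:
  assumes "off_interval z" "z \<noteq> 0" "poly (den j) z \<noteq> 0"
  shows "FF z - poly (num j) z / poly (den j) z = pade_err (dx.a (nn j)) z (nn j)"
proof -
  let ?Y = "cD z (Suc (nn j)) + of_real (dx.a (nn j)) * cD z (nn j)"
  have "poly (num j) z = - (of_real s * poly (den j) z + ?Y) / z"
    unfolding poly_num[symmetric] using assms(2) by simp
  then have "FF z - poly (num j) z / poly (den j) z = (stieltjes z 1 * poly (den j) z + ?Y) / (z * poly (den j) z)"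
    using assms(2,3) by (simp add: FF_def field_simps)
  also have "stieltjes z 1 * poly (den j) z + ?Y = B z (Suc (nn j)) + of_real (dx.a (nn j)) * B z (nn j)"
    by (simp add: B_eq_D_A[OF assms(1)] poly_den algebra_simps)
  finally show ?thesis by (simp add: pade_err_def poly_den)
qed

definition pade_map :: "nat \<Rightarrow> riemann_sphere \<Rightarrow> riemann_sphere" where
  "pade_map j x = (case x of Cpt z \<Rightarrow> ratio_point (poly (num j) z) (poly (den j) z)
     | Infty \<Rightarrow> ratio_point (poly (reversed_poly (nn j) (num j)) 0) (poly (reversed_poly (nn j) (den j)) 0))"

lemma reversed_poly_den_0: "poly (reversed_poly (nn j) (den j)) 0 = 1" by (simp add: poly_reversed_poly_0 coeff_den)

lemma pade_map_Infty: "pade_map j Infty = Cpt 0"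
  by (simp add: pade_map_def poly_reversed_poly_0 coeff_num coeff_den ratio_point_def)

lemma continuous_pade_map: "continuous_on UNIV (pade_map j)"
proof -
  have "poly (reversed_poly (nn j) (den j)) 0 \<noteq> 0" by (simp add: reversed_poly_den_0)
  then show ?thesis unfolding pade_map_def[abs_def]
    using num_den_coprime poly_reversed_poly[OF degree_num] poly_reversed_poly[OF degree_den]
    by (intro continuous_rational_map) auto
qed

lemma reversed_poly_quotient:
  assumes "z \<noteq> 0"
  shows "poly (reversed_poly (nn j) (num j)) (1 / z) / poly (reversed_poly (nn j) (den j)) (1 / z) = poly (num j) z / poly (den j) z"
    and "poly (reversed_poly (nn j) (den j)) (1 / z) = 0 \<longleftrightarrow> poly (den j) z = 0"
  using assms by (simp_all add: poly_reversed_poly degree_num degree_den)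

lemma den_bigo: "(\<lambda>z. 1 / poly (den j) z) \<in> O[at_infinity](\<lambda>z. 1 / z ^ nn j)"
proof -
  have d: "degree (den j) = nn j"
    using degree_den[of j] le_degree[of "den j" "nn j"] coeff_den[of j] by simp
  have "((\<lambda>z. poly (den j) z / z ^ nn j) \<longlongrightarrow> 1) at_infinity"
    using poly_divide_tendsto_aux[of "den j"] by (simp add: d coeff_den)
  then have "((\<lambda>z. inverse (poly (den j) z / z ^ nn j)) \<longlongrightarrow> inverse 1) at_infinity"
    by (rule tendsto_inverse) simp
  then have "((\<lambda>z. (1 / poly (den j) z) / (1 / z ^ nn j)) \<longlongrightarrow> 1) at_infinity"
    by (simp add: field_simps)
  then show ?thesis
    by (rule bigoI_tendsto) (use eventually_not_equal_at_infinity[of 0] in \<open>eventually_elim, simp\<close>)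
qed

text \<open>With n the order, the numerator decays like z^(-n) by orthogonality and the denominator
  including the factor z has degree n + 1; together this is the contact required of an
  approximant.\<close>

lemma pade_err_bigo:
  "(\<lambda>z. pade_err (dx.a (nn j)) z (nn j)) \<in> O[at_infinity](\<lambda>z. 1 / z ^ (2 * nn j + 1))"
proof -
  let ?n = "nn j"
  have "(\<lambda>z::complex. inverse z * (1 / z ^ ?n)) \<in> O[at_infinity](\<lambda>z. 1 * (1 / z ^ ?n))"
  proof (rule landau_o.big.mult[OF _ landau_o.big_refl])
    show "inverse \<in> O[at_infinity](\<lambda>z::complex. 1 :: complex)"
      by (rule bigoI_tendsto[where c = 0]) (use tendsto_inverse_0 in auto)
  qed
  moreover have "(1::complex) / z ^ Suc ?n = inverse z * (1 / z ^ ?n)" for z by (simp add: field_simps)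
  ultimately have "(\<lambda>z::complex. 1 / z ^ Suc ?n) \<in> O[at_infinity](\<lambda>z. 1 / z ^ ?n)" by simp
  then have 1: "(\<lambda>z. B z (Suc ?n)) \<in> O[at_infinity](\<lambda>z. 1 / z ^ ?n)"
    by (rule landau_o.big_trans[OF B_bigo])
  have "(\<lambda>z. of_real (dx.a ?n) * B z ?n) \<in> O[at_infinity](\<lambda>z. 1 / z ^ ?n)"
    by (cases "dx.a ?n = 0") (simp_all add: B_bigo)
  then have "(\<lambda>z. B z (Suc ?n) + of_real (dx.a ?n) * B z ?n) \<in> O[at_infinity](\<lambda>z. 1 / z ^ ?n)"
    by (intro sum_in_bigo 1)
  then have "(\<lambda>z. (B z (Suc ?n) + of_real (dx.a ?n) * B z ?n) * ((1 / z) * (1 / poly (den j) z)))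
     \<in> O[at_infinity](\<lambda>z. (1 / z ^ ?n) * ((1 / z) * (1 / z ^ ?n)))"
    by (intro landau_o.big.mult den_bigo landau_o.big_refl)
  then show ?thesis
    by (simp add: pade_err_def poly_den power_add mult_2 mult_ac)
qed

lemma off_interval_eventually_den:
  "\<forall>\<^sub>F z in at_infinity. off_interval z \<and> z \<noteq> 0 \<and> poly (den j) z \<noteq> 0"
proof -
  have "\<forall>\<^sub>F z in at_infinity. poly (den j) z \<noteq> 0"
  proof -
    have "bounded {z. poly (den j) z = 0}" using poly_roots_finite[OF den_nz] finite_imp_bounded by blast
    then obtain K where "\<forall>z\<in>{z. poly (den j) z = 0}. cmod z \<le> K" by (auto simp: bounded_iff)
    then show ?thesis unfolding eventually_at_infinity by (intro exI[of _ "K + 1"]) force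
  qed
  then show ?thesis using eventually_off_interval by eventually_elim simp
qed

lemma is_pade_pade_map: "is_pade (extended_moments \<sigma> s) (nn j) (nn j) (pade_map j)"
  unfolding is_pade_def
proof (rule conjI[OF continuous_pade_map], rule exI[of _ "reversed_poly (nn j) (num j)"],
    rule exI[of _ "reversed_poly (nn j) (den j)"], intro conjI)
  let ?A = "reversed_poly (nn j) (num j)" and ?B = "reversed_poly (nn j) (den j)"
  show "degree ?A \<le> nn j" "degree ?B \<le> nn j" by (rule degree_reversed_poly)+
  show "poly ?B 0 \<noteq> 0" by (simp add: reversed_poly_den_0)
  show "\<forall>z. z \<noteq> 0 \<and> poly ?B (1 / z) \<noteq> 0 \<longrightarrow> pade_map j (Cpt z) = Cpt (poly ?A (1 / z) / poly ?B (1 / z))"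
  proof (intro allI impI)
    fix z assume z: "z \<noteq> 0 \<and> poly ?B (1 / z) \<noteq> 0"
    then have "poly (den j) z \<noteq> 0" using reversed_poly_quotient(2)[of z j] by blast
    then show "pade_map j (Cpt z) = Cpt (poly ?A (1 / z) / poly ?B (1 / z))"
      using z by (simp add: reversed_poly_quotient(1) pade_map_def ratio_point_def)
  qed
  have "(\<lambda>z. ((\<Sum>i<nn j + nn j. of_real (extended_moments \<sigma> s i) / z ^ (i + 1)) + FF z) - pade_err (dx.a (nn j)) z (nn j))
     \<in> O[at_infinity](\<lambda>z. 1 / z ^ (nn j + nn j + 1))"
    using pade_err_bigo[of j] by (intro sum_in_bigo FF_bigo) (simp add: mult_2)
  moreover have "\<forall>\<^sub>F z in at_infinity. ((\<Sum>i<nn j + nn j. of_real (extended_moments \<sigma> s i) / z ^ (i + 1)) + FF z) - pade_err (dx.a (nn j)) z (nn j)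
      = (\<Sum>i<nn j + nn j. of_real (extended_moments \<sigma> s i) / z ^ (i + 1)) + poly ?A (1 / z) / poly ?B (1 / z)"
    using off_interval_eventually_den[of j]
  proof eventually_elim
    case (elim z)
    then have "pade_err (dx.a (nn j)) z (nn j) = FF z - poly (num j) z / poly (den j) z"
      by (intro FF_minus_pade[symmetric]) auto
    moreover have "z \<noteq> 0" using elim by blast
    ultimately show ?case by (simp add: reversed_poly_quotient(1))
  qed
  ultimately show "(\<lambda>z. (\<Sum>i<nn j + nn j. of_real (extended_moments \<sigma> s i) / z ^ (i + 1)) + poly ?A (1 / z) / poly ?B (1 / z))
     \<in> O[at_infinity](\<lambda>z. 1 / z ^ (nn j + nn j + 1))"
    by (simp only: landau_o.big.in_cong)
qed

text \<open>Two approximants A/B and A'/B' give a polynomial A B' - A' B of degree at most 2n in 1/z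
  that is O(z^(-2n-1)), hence zero. \<open>Bp\<close> collects the zeros of both denominators, where
  \<open>is_pade\<close> supplies no formula.\<close>

lemma is_pade_unique:
  assumes "is_pade (extended_moments \<sigma> s) (nn j) (nn j) R"
  obtains Bp where "Bp \<noteq> 0" "\<And>z. z \<noteq> 0 \<Longrightarrow> poly Bp (1 / z) \<noteq> 0 \<Longrightarrow> poly (den j) z \<noteq> 0 \<Longrightarrow>
     R (Cpt z) = Cpt (poly (num j) z / poly (den j) z)"
proof -
  let ?S = "\<lambda>z. \<Sum>i<nn j + nn j. complex_of_real (extended_moments \<sigma> s i) / z ^ (i + 1)"
  from assms obtain A B where AB: "degree A \<le> nn j" "degree B \<le> nn j" "poly B 0 \<noteq> 0"
    "\<And>z. z \<noteq> 0 \<and> poly B (1 / z) \<noteq> 0 \<Longrightarrow> R (Cpt z) = Cpt (poly A (1 / z) / poly B (1 / z))"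
    "(\<lambda>z. ?S z + poly A (1 / z) / poly B (1 / z)) \<in> O[at_infinity](\<lambda>z. 1 / z ^ (nn j + nn j + 1))"
    unfolding is_pade_def by auto
  from is_pade_pade_map[of j] obtain A' B' where AB': "degree A' \<le> nn j" "degree B' \<le> nn j" "poly B' 0 \<noteq> 0"
    "\<And>z. z \<noteq> 0 \<and> poly B' (1 / z) \<noteq> 0 \<Longrightarrow> pade_map j (Cpt z) = Cpt (poly A' (1 / z) / poly B' (1 / z))"
    "(\<lambda>z. ?S z + poly A' (1 / z) / poly B' (1 / z)) \<in> O[at_infinity](\<lambda>z. 1 / z ^ (nn j + nn j + 1))"
    unfolding is_pade_def by auto
  have lim: "((\<lambda>z. poly p (1 / z)) \<longlongrightarrow> poly p 0) at_infinity" for p :: "complex poly"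
    unfolding divide_inverse mult_1 by (intro tendsto_poly tendsto_inverse_0)
  have O1: "(\<lambda>z. poly p (1 / z)) \<in> O[at_infinity](\<lambda>_. 1)" for p :: "complex poly"
    by (rule bigoI_tendsto[where c = "poly p 0"]) (use lim[of p] in auto)
  have nz: "\<forall>\<^sub>F z in at_infinity. poly p (1 / z) \<noteq> 0" if "poly p 0 \<noteq> 0" for p :: "complex poly"
    using tendsto_imp_eventually_ne[OF lim that] .
  define Q where "Q = A * B' - A' * B"
  have "Q = 0"
  proof (rule inverse_poly_bigo_imp_0)
    show "degree Q \<le> nn j + nn j" unfolding Q_def using AB(1,2) AB'(1,2)
      by (intro degree_diff_le order.trans[OF degree_mult_le]) auto
    have "(\<lambda>z. (?S z + poly A (1 / z) / poly B (1 / z)) - (?S z + poly A' (1 / z) / poly B' (1 / z)))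
       \<in> O[at_infinity](\<lambda>z. 1 / z ^ (nn j + nn j + 1))"
      by (intro sum_in_bigo AB AB')
    then have "(\<lambda>z. poly B (1 / z) * (poly B' (1 / z) * ((?S z + poly A (1 / z) / poly B (1 / z)) - (?S z + poly A' (1 / z) / poly B' (1 / z)))))
       \<in> O[at_infinity](\<lambda>z. 1 * (1 * (1 / z ^ (nn j + nn j + 1))))"
      by (intro landau_o.big.mult O1)
    moreover have "\<forall>\<^sub>F z in at_infinity. poly B (1 / z) * (poly B' (1 / z) * ((?S z + poly A (1 / z) / poly B (1 / z)) - (?S z + poly A' (1 / z) / poly B' (1 / z))))
        = poly Q (1 / z)"
      using nz[OF AB(3)] nz[OF AB'(3)] by eventually_elim (simp add: Q_def field_simps)
    ultimately show "(\<lambda>z. poly Q (1 / z)) \<in> O[at_infinity](\<lambda>z. 1 / z ^ Suc (nn j + nn j))"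
      by (simp add: landau_o.big.in_cong)
  qed
  show ?thesis
  proof
    show "B * B' \<noteq> 0" using AB(3) AB'(3) by auto
    fix z assume z: "z \<noteq> 0" "poly (B * B') (1 / z) \<noteq> 0" "poly (den j) z \<noteq> 0"
    then have B: "poly B (1 / z) \<noteq> 0" "poly B' (1 / z) \<noteq> 0" by auto
    have "poly A (1 / z) * poly B' (1 / z) = poly A' (1 / z) * poly B (1 / z)"
      using \<open>Q = 0\<close> by (metis Q_def eq_iff_diff_eq_0 poly_mult)
    then have "R (Cpt z) = pade_map j (Cpt z)" using AB(4) AB'(4) z(1) B by (simp add: field_simps)
    then show "R (Cpt z) = Cpt (poly (num j) z / poly (den j) z)" using z(3) by (simp add: pade_map_def ratio_point_def)
  qed
qed

end

section \<open>Convergence of the approximants and boundedness of the numbers a\<close>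

context shifted_measure
begin

lemma FF_bound:
  assumes "d > 0" "\<And>t. t \<in> {-1..1} \<Longrightarrow> cmod (of_real t - z) \<ge> d" "cmod z \<ge> r" "r > 0"
  shows "cmod (FF z) \<le> (h 1 / d + \<bar>s\<bar>) / r"
proof -
  have "cmod (FF z) = cmod (stieltjes z 1 - of_real s) / cmod z" by (simp add: FF_def norm_divide)
  also have "\<dots> \<le> (h 1 / d + \<bar>s\<bar>) / r"
  proof (intro frac_le)
    show "cmod (stieltjes z 1 - of_real s) \<le> h 1 / d + \<bar>s\<bar>"
      using stieltjes_1_bound[OF assms(1,2)] norm_triangle_ineq4[of "stieltjes z 1" "of_real s"] by simp
    show "0 \<le> h 1 / d + \<bar>s\<bar>" using h_pos[of 1] assms(1) by (simp add: add_nonneg_nonneg)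
  qed (use assms in auto)
  finally show ?thesis .
qed

lemma nn_ge: "j \<le> nn j"
  using strict_mono_imp_increasing[OF bi.strict_mono_n] .

text \<open>The enlargement \<open>C + 4\<close> is the radius from which
  \<open>pade_err_large\<close> applies. Inside that circle the real points are removed, so the two
  error estimates together cover every compact set of the remaining domain.\<close>

lemma pade_converges:
  assumes C: "\<And>j. \<bar>dx.a (nn (Suc j))\<bar> \<le> C"
    and ext: "\<And>z. off_interval z \<Longrightarrow> G (Cpt z) = Cpt (FF z)" "G Infty = Cpt 0"
  shows "locally_uniform_limit
     (- (\<lambda>x. Cpt (complex_of_real x)) ` {- 1 - (C + 4)..1 + (C + 4)}) pade_map G"
  unfolding locally_uniform_limit_def
proof (intro allI impI, elim conjE)
  fix K assume K: "compact K" and KS: "K \<subseteq> - (\<lambda>x. Cpt (complex_of_real x)) ` {- 1 - (C + 4)..1 + (C + 4)}"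
  have C0: "C \<ge> 0" using C order.trans[OF abs_ge_zero] by blast
  \<comment> \<open>On this part the imaginary part has no zero, so compactness bounds it away from
    0, as \<open>pade_err_nonreal\<close> requires.\<close>
  define Z where "Z = {z. Cpt z \<in> K} \<inter> cball 0 (C + 4)"
  have "closed {z. Cpt z \<in> K}"
    using continuous_closed_vimage[OF compact_imp_closed[OF K], of Cpt] continuous_on_Cpt[of UNIV]
    by (simp add: vimage_def continuous_on_eq_continuous_at)
  then have Zc: "compact Z" unfolding Z_def by (intro closed_Int_compact) auto
  have Im: "Im z \<noteq> 0" if "z \<in> Z" for z
  proof
    assume "Im z = 0"
    then have z: "z = of_real (Re z)" by (simp add: complex_eq_iff)
    have "\<bar>Re z\<bar> \<le> C + 4" using that abs_Re_le_cmod[of z] by (simp add: Z_def)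
    then have "Re z \<in> {- 1 - (C + 4)..1 + (C + 4)}" by auto
    moreover have "Cpt (of_real (Re z)) \<in> K" using that z by (simp add: Z_def)
    ultimately show False using KS by blast
  qed
  obtain \<delta> where \<delta>: "\<delta> > 0" "\<And>z. z \<in> Z \<Longrightarrow> \<bar>Im z\<bar> \<ge> \<delta>"
  proof (cases "Z = {}")
    case True then show ?thesis using that[of 1] by simp
  next
    case False
    have "continuous_on Z (\<lambda>z. \<bar>Im z\<bar>)" by (intro continuous_intros)
    from continuous_attains_inf[OF Zc False this]
    obtain w where w: "w \<in> Z" "\<And>z. z \<in> Z \<Longrightarrow> \<bar>Im w\<bar> \<le> \<bar>Im z\<bar>" by blast
    then show ?thesis using that[of "\<bar>Im w\<bar>"] Im by simp
  qed
  obtain K1 r where r: "0 \<le> r" "r < 1" and near: "\<And>z a n. \<bar>Im z\<bar> \<ge> \<delta> \<Longrightarrow> cmod z \<le> C + 4 \<Longrightarrow> \<bar>a\<bar> \<le> C \<Longrightarrow>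
      cA z (Suc (Suc n)) + of_real a * cA z (Suc n) \<noteq> 0 \<and> cmod (pade_err a z (Suc n)) \<le> K1 * r ^ n"
    using pade_err_nonreal[of \<delta> "C + 4" C] \<delta>(1) C0 by (metis add_nonneg_nonneg zero_le_numeral)
  define e where "e j = \<bar>K1\<bar> * r ^ j + h 1 * (2 + C) * (1 / 4) ^ j" for j
  define f where "f j x = (case x of Cpt z \<Rightarrow> poly (num j) z / poly (den j) z | Infty \<Rightarrow> 0)" for j x
  define F where "F x = (case x of Cpt z \<Rightarrow> FF z | Infty \<Rightarrow> 0)" for x
  have off: "off_interval z" if "Cpt z \<in> K" for z
  proof (cases "cmod z \<le> C + 4")
    case True
    then show ?thesis using Im[of z] that off_interval_nonreal by (simp add: Z_def)
  next
    case False then show ?thesis using off_interval_large C0 by simp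
  qed
  have z0: "z \<noteq> 0" if "Cpt z \<in> K" for z using off[OF that] by (auto simp: off_interval_def)
  have est: "poly (den (Suc j)) z \<noteq> 0 \<and> cmod (FF z - poly (num (Suc j)) z / poly (den (Suc j)) z) \<le> e j"
    if zK: "Cpt z \<in> K" for z j
  proof -
    \<comment> \<open>The errors decay geometrically in \<open>k\<close>; since \<open>nn\<close>
      grows at least like its index, they decay at the same rate in \<open>j\<close>.\<close>
    obtain k where k: "nn (Suc j) = Suc k" using nn_ge[of "Suc j"] by (cases "nn (Suc j)") auto
    then have jk: "j \<le> k" using nn_ge[of "Suc j"] by simp
    have *: "poly (den (Suc j)) z \<noteq> 0 \<and> cmod (pade_err (dx.a (Suc k)) z (Suc k)) \<le> e j"
    proof (cases "cmod z \<le> C + 4")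
      case True
      then have "\<bar>Im z\<bar> \<ge> \<delta>" using \<delta>(2) zK by (simp add: Z_def)
      note N = near[OF this True C[of j, unfolded k], of k]
      have "K1 * r ^ k \<le> \<bar>K1\<bar> * r ^ j" using r jk by (intro mult_mono power_decreasing) auto
      also have "\<dots> \<le> e j" using h_pos[of 1] C0 by (simp add: e_def)
      finally show ?thesis using N by (simp add: poly_den k)
    next
      case False
      then have z: "cmod z \<ge> C + 4" by simp
      note N = pade_err_large[OF C[of j, unfolded k] z, of k]
      have "h 1 * (2 + C) * (1 / 4) ^ k \<le> h 1 * (2 + C) * (1 / 4) ^ j"
        using h_pos[of 1] C0 jk by (intro mult_left_mono power_decreasing) auto
      also have "\<dots> \<le> e j" using r by (simp add: e_def)
      finally show ?thesis using N by (simp add: poly_den k)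
    qed
    then show ?thesis using FF_minus_pade[OF off[OF zK] z0[OF zK], of "Suc j"] k by simp
  qed
  have lim_e: "e \<longlonglongrightarrow> 0"
  proof -
    have "(\<lambda>j. \<bar>K1\<bar> * r ^ j + h 1 * (2 + C) * (1 / 4) ^ j) \<longlonglongrightarrow> \<bar>K1\<bar> * 0 + h 1 * (2 + C) * 0"
      using r by (intro tendsto_intros LIMSEQ_power_zero) auto
    then show ?thesis by (simp add: e_def[abs_def])
  qed
  \<comment> \<open>The error estimates are for positive orders, so the approximant of order
    \<open>nn 0 = 0\<close> is dropped from the sequence.\<close>
  have "uniform_limit K (\<lambda>j. f (Suc j)) F sequentially"
  proof (rule uniform_limitI)
    fix \<epsilon> :: real assume "\<epsilon> > 0"
    then have "\<forall>\<^sub>F j in sequentially. dist (e j) 0 < \<epsilon>" using lim_e tendstoD by blast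
    then show "\<forall>\<^sub>F j in sequentially. \<forall>x\<in>K. dist (f (Suc j) x) (F x) < \<epsilon>"
    proof eventually_elim
      case (elim j)
      show ?case
      proof
        fix x assume x: "x \<in> K"
        show "dist (f (Suc j) x) (F x) < \<epsilon>"
        proof (cases x)
          case (Cpt z)
          then have "cmod (FF z - poly (num (Suc j)) z / poly (den (Suc j)) z) \<le> e j" using est x by blast
          then show ?thesis using elim by (simp add: Cpt f_def F_def dist_norm norm_minus_commute)
        next
          case Infty then show ?thesis using \<open>\<epsilon> > 0\<close> by (simp add: f_def F_def)
        qed
      qed
    qed
  qed
  moreover have "cmod (F x) \<le> (h 1 / \<delta> + \<bar>s\<bar>) / \<delta> + (h 1 / 1 + \<bar>s\<bar>) / 1" if x: "x \<in> K" for x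
  proof -
    have p: "(h 1 / \<delta> + \<bar>s\<bar>) / \<delta> \<ge> 0" "(h 1 / 1 + \<bar>s\<bar>) / 1 \<ge> 0" using h_pos[of 1] \<delta>(1) by simp_all
    show ?thesis
    proof (cases x)
      case (Cpt z)
      show ?thesis
      proof (cases "cmod z \<le> C + 4")
        case True
        then have i: "\<bar>Im z\<bar> \<ge> \<delta>" using \<delta>(2) x Cpt by (simp add: Z_def)
        have "cmod (FF z) \<le> (h 1 / \<delta> + \<bar>s\<bar>) / \<delta>"
          using i \<delta>(1) abs_Im_le_cmod[of z] order.trans[OF i dist_interval_nonreal] by (intro FF_bound) auto
        then show ?thesis using p by (simp add: F_def Cpt)
      next
        case False
        have "cmod (FF z) \<le> (h 1 / 1 + \<bar>s\<bar>) / 1"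
        proof (rule FF_bound)
          show "1 \<le> cmod (complex_of_real t - z)" if "t \<in> {-1..1}" for t
            using dist_interval_large[OF that, of z] False C0 by simp
        qed (use False C0 in auto)
        then show ?thesis using p by (simp add: F_def Cpt)
      qed
    qed (use p in \<open>simp add: F_def\<close>)
  qed
  ultimately have "uniform_limit K (\<lambda>j x. Cpt (f (Suc j) x)) (\<lambda>x. Cpt (F x)) sequentially"
    by (rule uniform_limit_Cpt)
  moreover have "Cpt (f (Suc j) x) = pade_map (Suc j) x" if "x \<in> K" for j x
  proof (cases x)
    case (Cpt z)
    then show ?thesis using est[of z j] that by (simp add: f_def pade_map_def ratio_point_def)
  qed (simp add: f_def pade_map_Infty)
  moreover have "Cpt (F x) = G x" if "x \<in> K" for x
    by (cases x) (use ext off that in \<open>auto simp: F_def\<close>)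
  ultimately have "uniform_limit K (\<lambda>j. pade_map (Suc j)) G sequentially"
    by (subst uniform_limit_cong'[of K _ "\<lambda>j x. Cpt (f (Suc j) x)" _ "\<lambda>x. Cpt (F x)"]) auto
  then show "uniform_limit K pade_map G sequentially"
    by (rule filterlim_sequentially_Suc[THEN iffD1])
qed

lemma eventually_at_avoid_finite:
  fixes x :: complex
  assumes "finite S" shows "\<forall>\<^sub>F z in at x. z \<notin> S"
proof -
  have "open (- (S - {x}))" using assms by (intro open_Compl finite_imp_closed) simp
  then show ?thesis unfolding eventually_at_topological by (intro exI[of _ "- (S - {x})"]) auto
qed

text \<open>A value of \<open>dx.a\<close> beyond \<open>\<rho> + 3\<close> creates a real pole near
  infinity, close to which the approximant is large while F stays bounded, so their chordal distance
  is at least \<eta>. Uniform convergence on a single cap around infinity thus bounds all but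
  finitely many of the numbers.\<close>

lemma pade_convergence_bounds:
  assumes pade: "\<And>j. is_pade (extended_moments \<sigma> s) (nn j) (nn j) (R j)"
    and lim: "locally_uniform_limit (- (\<lambda>x. Cpt (complex_of_real x)) ` {- 1 - \<epsilon>..1 + \<epsilon>}) R G"
    and \<epsilon>: "\<epsilon> \<ge> 0"
    and ext: "\<And>z. off_interval z \<Longrightarrow> G (Cpt z) = Cpt (FF z)"
  shows "\<exists>C. \<forall>j. \<bar>dx.a (nn (Suc j))\<bar> \<le> C"
proof -
  \<comment> \<open>The cap has to miss the removed interval and to lie in the region
    \<open>cmod z \<ge> 4\<close> of the estimates for large arguments.\<close>
  define \<rho> where "\<rho> = \<epsilon> + 4"
  define K where "K = insert Infty (Cpt ` {z. cmod z \<ge> \<rho>})"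
  define M where "M = h 1 / 1 + \<bar>s\<bar>"
  have "compact K" unfolding K_def using \<epsilon> by (intro compact_outer_cap) (simp add: \<rho>_def)
  moreover have "K \<subseteq> - (\<lambda>x. Cpt (complex_of_real x)) ` {- 1 - \<epsilon>..1 + \<epsilon>}"
    using \<epsilon> by (auto simp: K_def \<rho>_def abs_le_iff)
  ultimately have U: "uniform_limit K R G sequentially" using lim unfolding locally_uniform_limit_def by blast
  define \<eta> where "\<eta> = 1 / (1 + M\<^sup>2)"
  have "1 + M\<^sup>2 > 0" by (smt (verit) zero_le_power2)
  then have "\<eta> > 0" by (simp add: \<eta>_def)
  then have "\<forall>\<^sub>F j in sequentially. \<forall>x\<in>K. dist (R j x) (G x) < \<eta>" using U by (rule uniform_limitD[rotated])
  moreover have "\<bar>dx.a (nn j)\<bar> \<le> \<rho> + 3" if close: "\<forall>x\<in>K. dist (R j x) (G x) < \<eta>" and j: "j \<ge> 1" for j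
  proof (rule ccontr)
    assume "\<not> ?thesis"
    \<comment> \<open>The additional 1 places the pole in the interior of the cap, together with a
      neighbourhood.\<close>
    then have big: "\<bar>dx.a (nn j)\<bar> \<ge> (\<rho> + 1) + 2" by simp
    obtain k where k: "nn j = Suc k" using nn_ge[of j] j by (cases "nn j") auto
    obtain x :: real where x: "\<bar>x\<bar> \<ge> \<rho> + 1" "cA x (Suc (Suc k)) + dx.a (nn j) * cA x (Suc k) = 0"
      using large_pole[OF _ big, of k] \<epsilon> by (auto simp: \<rho>_def)
    let ?x = "complex_of_real x"
    have "poly (den j) ?x = of_real (cA x (Suc (Suc k)) + dx.a (nn j) * cA x (Suc k))"
      by (simp add: poly_den k cA_of_real)
    then have den0: "poly (den j) ?x = 0" by (simp add: x(2))
    then have num0: "poly (num j) ?x \<noteq> 0" using num_den_coprime[of j ?x] by simp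
    obtain Bp where Bp: "Bp \<noteq> 0" "\<And>z. z \<noteq> 0 \<Longrightarrow> poly Bp (1 / z) \<noteq> 0 \<Longrightarrow> poly (den j) z \<noteq> 0 \<Longrightarrow>
        R j (Cpt z) = Cpt (poly (num j) z / poly (den j) z)"
      using is_pade_unique[OF pade] by blast
    \<comment> \<open>\<open>is_pade_unique\<close> describes \<open>R j\<close> only off finitely
      many points, so the pole is approached through a punctured neighbourhood that avoids
      them.\<close>
    have "finite ((\<lambda>w. 1 / w) ` {w. poly Bp w = 0})" by (intro finite_imageI poly_roots_finite Bp(1))
    then have e1: "\<forall>\<^sub>F z in at ?x. z \<notin> (\<lambda>w. 1 / w) ` {w. poly Bp w = 0}" by (rule eventually_at_avoid_finite)
    have e2: "\<forall>\<^sub>F z in at ?x. z \<notin> {z. poly (den j) z = 0}"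
      by (intro eventually_at_avoid_finite poly_roots_finite den_nz)
    have e3: "\<forall>\<^sub>F z in at ?x. cmod z > \<rho>"
    proof -
      have "((\<lambda>z. cmod z) \<longlongrightarrow> cmod ?x) (at ?x)" by (intro tendsto_intros)
      then show ?thesis using x(1) by (intro order_tendstoD(1)) auto
    qed
    have "filterlim (\<lambda>z. poly (num j) z / poly (den j) z) at_infinity (at ?x)"
    proof (rule filterlim_divide_at_infinity)
      show "((\<lambda>z. poly (num j) z) \<longlongrightarrow> poly (num j) ?x) (at ?x)" by (intro tendsto_intros)
      have "((\<lambda>z. poly (den j) z) \<longlongrightarrow> poly (den j) ?x) (at ?x)" by (intro tendsto_intros)
      then show "filterlim (\<lambda>z. poly (den j) z) (at 0) (at ?x)"
        unfolding filterlim_at den0 using e2 by simp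
    qed (rule num0)
    then have e4: "\<forall>\<^sub>F z in at ?x. cmod (poly (num j) z / poly (den j) z) \<ge> 2 * M + 2"
      by (simp only: filterlim_at_infinity_conv_norm_at_top filterlim_at_top)
    have "\<forall>\<^sub>F z in at ?x. False"
      using e1 e2 e3 e4
    proof eventually_elim
      case (elim z)
      have z: "cmod z \<ge> 4" "z \<noteq> 0" using elim(3) \<epsilon> by (auto simp: \<rho>_def)
      have "poly Bp (1 / z) \<noteq> 0"
      proof
        assume "poly Bp (1 / z) = 0"
        then have "z \<in> (\<lambda>w. 1 / w) ` {w. poly Bp w = 0}" by (intro image_eqI[of _ _ "1 / z"]) auto
        then show False using elim by blast
      qed
      then have R: "R j (Cpt z) = Cpt (poly (num j) z / poly (den j) z)" using Bp(2) z elim by blast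
      have "cmod (FF z) \<le> (h 1 / 1 + \<bar>s\<bar>) / 1"
      proof (rule FF_bound)
        show "1 \<le> cmod (complex_of_real t - z)" if "t \<in> {-1..1}" for t
          using dist_interval_large[OF that, of z] z by simp
      qed (use z in auto)
      then have "dist (R j (Cpt z)) (Cpt (FF z)) \<ge> \<eta>"
        unfolding R \<eta>_def using elim(4) by (intro sphere_dist_lower) (simp_all add: M_def)
      moreover have "Cpt z \<in> K" using elim(3) by (simp add: K_def)
      moreover have "G (Cpt z) = Cpt (FF z)" using z by (intro ext off_interval_large) simp
      ultimately show False using close by force
    qed
    then show False by simp
  qed
  ultimately obtain N where N: "\<And>j. j \<ge> N \<Longrightarrow> j \<ge> 1 \<Longrightarrow> \<bar>dx.a (nn j)\<bar> \<le> \<rho> + 3"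
    unfolding eventually_sequentially by blast
  have "\<bar>dx.a (nn (Suc j))\<bar> \<le> (\<rho> + 3) + (\<Sum>i\<le>N. \<bar>dx.a (nn i)\<bar>)" for j
  proof (cases "Suc j \<ge> N")
    case True
    then show ?thesis using N[of "Suc j"] by (simp add: add_increasing2 sum_nonneg)
  next
    case False
    then have "\<bar>dx.a (nn (Suc j))\<bar> \<le> (\<Sum>i\<le>N. \<bar>dx.a (nn i)\<bar>)"
      by (intro member_le_sum[of "Suc j" "{..N}" "\<lambda>i. \<bar>dx.a (nn i)\<bar>"]) auto
    then show ?thesis using \<epsilon> by (simp add: \<rho>_def)
  qed
  then show ?thesis by blast
qed

end

theorem theorem6p9:
  fixes \<sigma> :: "real measure" and s :: real
    and \<FF> :: "complex \<Rightarrow> complex" and \<nn> :: "nat \<Rightarrow> nat"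
  assumes "finite_measure \<sigma>" and "sets \<sigma> = sets borel"
    and "measure_support \<sigma> \<subseteq> {-1..1}" and "infinite (measure_support \<sigma>)"
    and "\<FF> = (\<lambda>z. 1 / z * (LINT t:{-1..1}|\<sigma>. 1 / (complex_of_real t - z)) - complex_of_real s / z)"
    and "\<FF> \<in> class_D"
    and "\<nn> = normal_index (extended_moments \<sigma> s)"
  shows
    "((\<exists>L U. block_LU_factorization \<FF> L U \<and> l2_bounded L)
        \<longleftrightarrow> (\<exists>U L. block_UL_factorization \<sigma> s U L \<and> l2_bounded L)) \<and>
     ((\<exists>U L. block_UL_factorization \<sigma> s U L \<and> l2_bounded L)
        \<longleftrightarrow> (\<exists>R. (\<forall>j. is_pade (extended_moments \<sigma> s) (\<nn> j) (\<nn> j) (R j)) \<and>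
              (\<exists>\<epsilon>\<ge>0. locally_uniform_limit
                 (- (\<lambda>x. Cpt (complex_of_real x)) ` {- 1 - \<epsilon>..1 + \<epsilon>})
                 R (sphere_extension \<FF>))))"
proof -
  interpret finite_measure \<sigma> by fact
  interpret shifted_measure \<sigma> s
    by unfold_locales (fact assms)+
  have FF: "\<FF> = FF"
  proof
    fix z
    \<comment> \<open>This holds for every z, also on the interval: the integrands agree on [-1, 1],
      which carries the measure.\<close>
    have "(LINT t:{-1..1}|\<sigma>. 1 / (complex_of_real t - z)) = stieltjes z 1"
      unfolding set_lebesgue_integral_def stieltjes_def
      by (rule integral_cong_AE)
        (use AE_interval in \<open>auto simp: borel_measurable_iff indicator_def elim: eventually_mono\<close>)
    then show "\<FF> z = FF z" by (simp add: assms(5) FF_def diff_divide_distrib)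
  qed
  have nn: "\<nn> = nn" by (simp add: assms(7) nn_def)
  have ext: "sphere_extension FF (Cpt z) = Cpt (FF z)" "sphere_extension FF Infty = Cpt 0" for z
    by (simp_all add: sphere_extension_def)
  \<comment> \<open>Each of the three statements reduces to a bound on \<open>dx.a\<close> at the
    positive normal indices; the two factorizations reach it through \<open>dx.l\<close>.\<close>
  have "(\<exists>C. \<forall>j. \<bar>dx.a (nn (Suc j))\<bar> \<le> C) \<longleftrightarrow>
    (\<exists>R. (\<forall>j. is_pade (extended_moments \<sigma> s) (nn j) (nn j) (R j)) \<and>
              (\<exists>\<epsilon>\<ge>0. locally_uniform_limit
                 (- (\<lambda>x. Cpt (complex_of_real x)) ` {- 1 - \<epsilon>..1 + \<epsilon>})
                 R (sphere_extension FF)))"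
    (is "_ \<longleftrightarrow> ?converges")
  proof
    assume "\<exists>C. \<forall>j. \<bar>dx.a (nn (Suc j))\<bar> \<le> C"
    then obtain C where C: "\<And>j. \<bar>dx.a (nn (Suc j))\<bar> \<le> C" by blast
    have "C + 4 \<ge> 0" using C[of 0] by linarith
    then show ?converges using pade_converges[OF C ext] is_pade_pade_map by blast
  next
    assume ?converges
    then show "\<exists>C. \<forall>j. \<bar>dx.a (nn (Suc j))\<bar> \<le> C"
      using pade_convergence_bounds ext(1) by blast
  qed
  then show ?thesis
    unfolding FF nn LU_bounded_iff UL_bounded_iff l_bounded_iff_a_bounded by simp
qed

end
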